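(* Let $u_{ij}$, $1\le i,j\le 2$, be the generators of the algebra $A_o(2)$. For each $i,j\in\{1,2\}$, the law of $u_{ij}^2$ with respect to the Haar functional of $A_o(2)$ is the uniform (Lebesgue) measure on $[0,1]$.
   Context: $A_o(n)$ is the universal (unital) $C^*$-algebra generated by $n^2$ elements $u_{ij}$, $1\le i,j\le n$, subject to the relations making $u=(u_{ij})$ an orthogonal matrix, i.e. $u_{ij}=u_{ij}^*$ for all $i,j$ and $uu^t=u^tu=1$. It is a Hopf $C^*$-algebra with comultiplication $\Delta(u_{ij})=\sum_{k} u_{ik}\otimes u_{kj}$. The Haar functional $\int:A_o(n)\to\mathbb{C}$ is the unique positive unital linear form satisfying $(\mathrm{id}\otimes\int)\Delta(a)=(\int\otimes \mathrm{id})\Delta(a)=(\int a)\,1$ for all $a$. The law of a self-adjoint element $a\in A_o(n)$ is the real probability measure $\mu$ with $\int\varphi(x)\,d\mu(x)=\int\varphi(a)$ for all continuous $\varphi:\mathbb{R}\to\mathbb{C}$. *)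

theory Defs
  imports "HOL-Probability.Probability" "HOL-Algebra.Module"
begin

section \<open>Unital C*-algebras\<close>

definition complex_ring :: "complex ring" where
  "complex_ring = \<lparr>carrier = UNIV, monoid.mult = (*), one = 1, zero = 0, add = (+)\<rparr>"

record 'a cstar = "(complex, 'a) module" +
  star :: "'a \<Rightarrow> 'a"
  cnorm :: "'a \<Rightarrow> real"

text \<open>The zero algebra is admitted.\<close>

locale cstar_algebra = ring A + Module.module complex_ring A for A :: "'a cstar" (structure) +
  assumes smult_mult_left:
      "\<lbrakk>x \<in> carrier A; y \<in> carrier A\<rbrakk> \<Longrightarrow> (c \<odot> x) \<otimes> y = c \<odot> (x \<otimes> y)"
    and smult_mult_right:
      "\<lbrakk>x \<in> carrier A; y \<in> carrier A\<rbrakk> \<Longrightarrow> x \<otimes> (c \<odot> y) = c \<odot> (x \<otimes> y)"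
    and star_closed: "x \<in> carrier A \<Longrightarrow> star A x \<in> carrier A"
    and star_star: "x \<in> carrier A \<Longrightarrow> star A (star A x) = x"
    and star_add:
      "\<lbrakk>x \<in> carrier A; y \<in> carrier A\<rbrakk> \<Longrightarrow> star A (x \<oplus> y) = star A x \<oplus> star A y"
    and star_smult: "x \<in> carrier A \<Longrightarrow> star A (c \<odot> x) = cnj c \<odot> star A x"
    and star_mult:
      "\<lbrakk>x \<in> carrier A; y \<in> carrier A\<rbrakk> \<Longrightarrow> star A (x \<otimes> y) = star A y \<otimes> star A x"
    and cnorm_nonneg: "x \<in> carrier A \<Longrightarrow> 0 \<le> cnorm A x"
    and cnorm_eq_0: "x \<in> carrier A \<Longrightarrow> cnorm A x = 0 \<longleftrightarrow> x = \<zero>"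
    and cnorm_triangle:
      "\<lbrakk>x \<in> carrier A; y \<in> carrier A\<rbrakk> \<Longrightarrow> cnorm A (x \<oplus> y) \<le> cnorm A x + cnorm A y"
    and cnorm_smult: "x \<in> carrier A \<Longrightarrow> cnorm A (c \<odot> x) = cmod c * cnorm A x"
    and cnorm_mult:
      "\<lbrakk>x \<in> carrier A; y \<in> carrier A\<rbrakk> \<Longrightarrow> cnorm A (x \<otimes> y) \<le> cnorm A x * cnorm A y"
    and cstar_identity: "x \<in> carrier A \<Longrightarrow> cnorm A (star A x \<otimes> x) = (cnorm A x)\<^sup>2"
    and complete:
      "\<lbrakk>\<forall>n. X n \<in> carrier A; \<forall>e>0. \<exists>N. \<forall>m\<ge>N. \<forall>n\<ge>N. cnorm A (X m \<ominus> X n) < e\<rbrakk>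
        \<Longrightarrow> \<exists>x \<in> carrier A. (\<lambda>n. cnorm A (X n \<ominus> x)) \<longlonglongrightarrow> 0"

text \<open>Membership in \<^const>\<open>ring_hom\<close> includes preservation of the unit.\<close>

definition star_hom :: "'a cstar \<Rightarrow> 'b cstar \<Rightarrow> ('a \<Rightarrow> 'b) \<Rightarrow> bool" where
  "star_hom A B f \<longleftrightarrow> f \<in> ring_hom A B \<and>
     (\<forall>c. \<forall>x\<in>carrier A. f (c \<odot>\<^bsub>A\<^esub> x) = c \<odot>\<^bsub>B\<^esub> f x) \<and>
     (\<forall>x\<in>carrier A. f (star A x) = star B (f x))"

definition bounded_linear_map :: "'a cstar \<Rightarrow> 'b cstar \<Rightarrow> ('a \<Rightarrow> 'b) \<Rightarrow> bool" where
  "bounded_linear_map A B f \<longleftrightarrow> f \<in> carrier A \<rightarrow> carrier B \<and>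
     (\<forall>x\<in>carrier A. \<forall>y\<in>carrier A. f (x \<oplus>\<^bsub>A\<^esub> y) = f x \<oplus>\<^bsub>B\<^esub> f y) \<and>
     (\<forall>c. \<forall>x\<in>carrier A. f (c \<odot>\<^bsub>A\<^esub> x) = c \<odot>\<^bsub>B\<^esub> f x) \<and>
     (\<exists>K. \<forall>x\<in>carrier A. cnorm B (f x) \<le> K * cnorm A x)"

definition closed_star_subalgebra :: "'a cstar \<Rightarrow> 'a set \<Rightarrow> bool" where
  "closed_star_subalgebra A S \<longleftrightarrow> S \<subseteq> carrier A \<and> \<one>\<^bsub>A\<^esub> \<in> S \<and>
     (\<forall>x\<in>S. \<forall>y\<in>S. x \<oplus>\<^bsub>A\<^esub> y \<in> S \<and> x \<otimes>\<^bsub>A\<^esub> y \<in> S) \<and>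
     (\<forall>c. \<forall>x\<in>S. c \<odot>\<^bsub>A\<^esub> x \<in> S) \<and> (\<forall>x\<in>S. star A x \<in> S) \<and>
     (\<forall>x\<in>carrier A. (\<forall>e>0. \<exists>y\<in>S. cnorm A (x \<ominus>\<^bsub>A\<^esub> y) < e) \<longrightarrow> x \<in> S)"

definition generates :: "'a cstar \<Rightarrow> 'a set \<Rightarrow> bool" where
  "generates A G \<longleftrightarrow> G \<subseteq> carrier A \<and>
     (\<forall>S. closed_star_subalgebra A S \<and> G \<subseteq> S \<longrightarrow> S = carrier A)"


section \<open>The algebra \<open>A\<^sub>o(n)\<close>\<close>

definition orthogonal_matrix_in :: "'a cstar \<Rightarrow> nat \<Rightarrow> (nat \<Rightarrow> nat \<Rightarrow> 'a) \<Rightarrow> bool" where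
  "orthogonal_matrix_in A n u \<longleftrightarrow> (\<forall>i\<in>{1..n}. \<forall>j\<in>{1..n}.
     u i j \<in> carrier A \<and> star A (u i j) = u i j \<and>
     (\<Oplus>\<^bsub>A\<^esub>k\<in>{1..n}. u i k \<otimes>\<^bsub>A\<^esub> u j k) = (if i = j then \<one>\<^bsub>A\<^esub> else \<zero>\<^bsub>A\<^esub>) \<and>
     (\<Oplus>\<^bsub>A\<^esub>k\<in>{1..n}. u k i \<otimes>\<^bsub>A\<^esub> u k j) = (if i = j then \<one>\<^bsub>A\<^esub> else \<zero>\<^bsub>A\<^esub>))"

text \<open>
  The universal property is tested against all C*-algebras \<open>B\<close> whose carrier lies in the same
  type \<open>'a\<close>. This is the full universal property. The image of \<open>A\<close> in a C*-algebra of any type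
  lies in the C*-subalgebra generated by the finitely many \<open>v i j\<close>, which is separable and so has
  at most the cardinality of the continuum. If \<open>'a\<close> carries a nonzero C*-algebra, then \<open>'a\<close> has
  at least that cardinality, since the algebra contains a copy of the complex numbers, and the
  subalgebra can be transported to a carrier inside \<open>'a\<close>. If \<open>'a\<close> carries only zero algebras,
  then \<open>A\<close> is zero and has no Haar functional in the sense below. Uniqueness of \<open>f\<close> on the
  carrier follows from \<^const>\<open>generates\<close>.
\<close>

definition is_Ao :: "nat \<Rightarrow> 'a cstar \<Rightarrow> (nat \<Rightarrow> nat \<Rightarrow> 'a) \<Rightarrow> bool" where
  "is_Ao n A u \<longleftrightarrow> cstar_algebra A \<and> orthogonal_matrix_in A n u \<and>
     generates A {u i j | i j. i \<in> {1..n} \<and> j \<in> {1..n}} \<and>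
     (\<forall>(B :: 'a cstar) v. cstar_algebra B \<and> orthogonal_matrix_in B n v \<longrightarrow>
        (\<exists>f. star_hom A B f \<and> (\<forall>i\<in>{1..n}. \<forall>j\<in>{1..n}. f (u i j) = v i j)))"


section \<open>C*-tensor products, comultiplication, Haar functional\<close>

text \<open>
  \<open>T\<close> is a completion of the algebraic tensor product of \<open>A\<close> and \<open>B\<close> in some C*-norm, with
  elementary tensors \<open>t a b\<close>. The independence clause says that the canonical map
  from the algebraic tensor product into \<open>T\<close> is injective. No particular C*-norm is singled out:
  each of them dominates the minimal one, so the slice maps below exist for all of them, and for
  the nuclear algebra \<open>A\<^sub>o(2)\<close> they all coincide.
\<close>

definition cstar_tensor ::
    "'a cstar \<Rightarrow> 'b cstar \<Rightarrow> 't cstar \<Rightarrow> ('a \<Rightarrow> 'b \<Rightarrow> 't) \<Rightarrow> bool" where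
  "cstar_tensor A B T t \<longleftrightarrow> cstar_algebra A \<and> cstar_algebra B \<and> cstar_algebra T \<and>
     (\<forall>a\<in>carrier A. \<forall>b\<in>carrier B. t a b \<in> carrier T) \<and>
     (\<forall>a\<in>carrier A. \<forall>a'\<in>carrier A. \<forall>b\<in>carrier B. t (a \<oplus>\<^bsub>A\<^esub> a') b = t a b \<oplus>\<^bsub>T\<^esub> t a' b) \<and>
     (\<forall>a\<in>carrier A. \<forall>b\<in>carrier B. \<forall>b'\<in>carrier B. t a (b \<oplus>\<^bsub>B\<^esub> b') = t a b \<oplus>\<^bsub>T\<^esub> t a b') \<and>
     (\<forall>c. \<forall>a\<in>carrier A. \<forall>b\<in>carrier B.
        t (c \<odot>\<^bsub>A\<^esub> a) b = c \<odot>\<^bsub>T\<^esub> t a b \<and> t a (c \<odot>\<^bsub>B\<^esub> b) = c \<odot>\<^bsub>T\<^esub> t a b) \<and>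
     (\<forall>a\<in>carrier A. \<forall>a'\<in>carrier A. \<forall>b\<in>carrier B. \<forall>b'\<in>carrier B.
        t a b \<otimes>\<^bsub>T\<^esub> t a' b' = t (a \<otimes>\<^bsub>A\<^esub> a') (b \<otimes>\<^bsub>B\<^esub> b')) \<and>
     (\<forall>a\<in>carrier A. \<forall>b\<in>carrier B. star T (t a b) = t (star A a) (star B b)) \<and>
     t \<one>\<^bsub>A\<^esub> \<one>\<^bsub>B\<^esub> = \<one>\<^bsub>T\<^esub> \<and>
     (\<forall>(N::nat) a b. (\<forall>k<N. a k \<in> carrier A \<and> b k \<in> carrier B) \<and>
        (\<forall>c :: nat \<Rightarrow> complex.
           (\<Oplus>\<^bsub>B\<^esub>k\<in>{..<N}. c k \<odot>\<^bsub>B\<^esub> b k) = \<zero>\<^bsub>B\<^esub> \<longrightarrow> (\<forall>k<N. c k = 0)) \<and>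
        (\<Oplus>\<^bsub>T\<^esub>k\<in>{..<N}. t (a k) (b k)) = \<zero>\<^bsub>T\<^esub> \<longrightarrow> (\<forall>k<N. a k = \<zero>\<^bsub>A\<^esub>)) \<and>
     (\<forall>x\<in>carrier T. \<forall>e>0. \<exists>(N::nat) a b. (\<forall>k<N. a k \<in> carrier A \<and> b k \<in> carrier B) \<and>
        cnorm T (x \<ominus>\<^bsub>T\<^esub> (\<Oplus>\<^bsub>T\<^esub>k\<in>{..<N}. t (a k) (b k))) < e)"

definition is_comult ::
    "nat \<Rightarrow> 'a cstar \<Rightarrow> (nat \<Rightarrow> nat \<Rightarrow> 'a) \<Rightarrow> 't cstar \<Rightarrow> ('a \<Rightarrow> 'a \<Rightarrow> 't) \<Rightarrow> ('a \<Rightarrow> 't) \<Rightarrow> bool" where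
  "is_comult n A u T t \<Delta> \<longleftrightarrow> star_hom A T \<Delta> \<and>
     (\<forall>i\<in>{1..n}. \<forall>j\<in>{1..n}. \<Delta> (u i j) = (\<Oplus>\<^bsub>T\<^esub>k\<in>{1..n}. t (u i k) (u k j)))"

definition positive_unital_form :: "'a cstar \<Rightarrow> ('a \<Rightarrow> complex) \<Rightarrow> bool" where
  "positive_unital_form A h \<longleftrightarrow>
     (\<forall>x\<in>carrier A. \<forall>y\<in>carrier A. h (x \<oplus>\<^bsub>A\<^esub> y) = h x + h y) \<and>
     (\<forall>c. \<forall>x\<in>carrier A. h (c \<odot>\<^bsub>A\<^esub> x) = c * h x) \<and>
     (\<forall>x\<in>carrier A. h (star A x \<otimes>\<^bsub>A\<^esub> x) \<in> nonneg_Reals) \<and>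
     h \<one>\<^bsub>A\<^esub> = 1"

text \<open>
  \<open>S\<close> is the slice map \<open>id \<otimes> h\<close>, respectively \<open>h \<otimes> id\<close>. Each is unique on the
  carrier, because the elementary tensors span a dense subspace.
\<close>

definition is_right_slice ::
    "'a cstar \<Rightarrow> 't cstar \<Rightarrow> ('a \<Rightarrow> 'a \<Rightarrow> 't) \<Rightarrow> ('a \<Rightarrow> complex) \<Rightarrow> ('t \<Rightarrow> 'a) \<Rightarrow> bool" where
  "is_right_slice A T t h S \<longleftrightarrow> bounded_linear_map T A S \<and>
     (\<forall>a\<in>carrier A. \<forall>b\<in>carrier A. S (t a b) = h b \<odot>\<^bsub>A\<^esub> a)"

definition is_left_slice ::
    "'a cstar \<Rightarrow> 't cstar \<Rightarrow> ('a \<Rightarrow> 'a \<Rightarrow> 't) \<Rightarrow> ('a \<Rightarrow> complex) \<Rightarrow> ('t \<Rightarrow> 'a) \<Rightarrow> bool" where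
  "is_left_slice A T t h S \<longleftrightarrow> bounded_linear_map T A S \<and>
     (\<forall>a\<in>carrier A. \<forall>b\<in>carrier A. S (t a b) = h a \<odot>\<^bsub>A\<^esub> b)"

definition is_haar ::
    "'a cstar \<Rightarrow> 't cstar \<Rightarrow> ('a \<Rightarrow> 'a \<Rightarrow> 't) \<Rightarrow> ('a \<Rightarrow> 't) \<Rightarrow> ('a \<Rightarrow> complex) \<Rightarrow> bool" where
  "is_haar A T t \<Delta> h \<longleftrightarrow> positive_unital_form A h \<and>
     (\<exists>S. is_right_slice A T t h S \<and> (\<forall>x\<in>carrier A. S (\<Delta> x) = h x \<odot>\<^bsub>A\<^esub> \<one>\<^bsub>A\<^esub>)) \<and>
     (\<exists>S. is_left_slice A T t h S \<and> (\<forall>x\<in>carrier A. S (\<Delta> x) = h x \<odot>\<^bsub>A\<^esub> \<one>\<^bsub>A\<^esub>))"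


section \<open>Laws of self-adjoint elements\<close>

definition spectrum :: "'a cstar \<Rightarrow> 'a \<Rightarrow> complex set" where
  "spectrum A a = {z. z \<odot>\<^bsub>A\<^esub> \<one>\<^bsub>A\<^esub> \<ominus>\<^bsub>A\<^esub> a \<notin> Units A}"

text \<open>
  \<open>\<Phi>\<close> is the continuous functional calculus \<open>\<phi> \<mapsto> \<phi>(a)\<close>, that is, the unital star
  homomorphism from the continuous functions on the spectrum to \<open>A\<close> that sends the identity
  function to \<open>a\<close>, written on continuous functions on the whole line (each continuous
  function on the spectrum extends to one). The last clause says that \<open>\<Phi> \<phi>\<close> depends only on
  the restriction of \<open>\<phi>\<close> to the spectrum.
\<close>

definition functional_calculus ::
    "'a cstar \<Rightarrow> 'a \<Rightarrow> ((real \<Rightarrow> complex) \<Rightarrow> 'a) \<Rightarrow> bool" where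
  "functional_calculus A a \<Phi> \<longleftrightarrow>
     (\<forall>f. continuous_on UNIV f \<longrightarrow> \<Phi> f \<in> carrier A) \<and>
     (\<forall>f g. continuous_on UNIV f \<and> continuous_on UNIV g \<longrightarrow>
        \<Phi> (\<lambda>x. f x + g x) = \<Phi> f \<oplus>\<^bsub>A\<^esub> \<Phi> g \<and> \<Phi> (\<lambda>x. f x * g x) = \<Phi> f \<otimes>\<^bsub>A\<^esub> \<Phi> g) \<and>
     (\<forall>c f. continuous_on UNIV f \<longrightarrow> \<Phi> (\<lambda>x. c * f x) = c \<odot>\<^bsub>A\<^esub> \<Phi> f) \<and>
     (\<forall>f. continuous_on UNIV f \<longrightarrow> \<Phi> (\<lambda>x. cnj (f x)) = star A (\<Phi> f)) \<and>
     \<Phi> (\<lambda>x. 1) = \<one>\<^bsub>A\<^esub> \<and> \<Phi> complex_of_real = a \<and>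
     (\<forall>f. continuous_on UNIV f \<and> (\<forall>x. complex_of_real x \<in> spectrum A a \<longrightarrow> f x = 0) \<longrightarrow>
        \<Phi> f = \<zero>\<^bsub>A\<^esub>)"

definition has_law :: "'a cstar \<Rightarrow> ('a \<Rightarrow> complex) \<Rightarrow> 'a \<Rightarrow> real measure \<Rightarrow> bool" where
  "has_law A h a \<mu> \<longleftrightarrow> a \<in> carrier A \<and> star A a = a \<and> prob_space \<mu> \<and> sets \<mu> = sets borel \<and>
     (\<exists>\<Phi>. functional_calculus A a \<Phi> \<and>
        (\<forall>\<phi> :: real \<Rightarrow> complex. continuous_on UNIV \<phi> \<longrightarrow>
           integrable \<mu> \<phi> \<and> (\<integral>x. \<phi> x \<partial>\<mu>) = h (\<Phi> \<phi>)))"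

end

theory Submission
  imports Defs "HOL-Complex_Analysis.Cauchy_Integral_Formula" "HOL-Computational_Algebra.Polynomial"
    "HOL-Real_Asymp.Real_Asymp"
begin

text \<open>
  Let \<open>r, s\<close> be a column of \<open>u\<close>, so \<open>r\<^sup>2 + s\<^sup>2 = 1\<close>. The elements \<open>m = r\<^sup>2 - s\<^sup>2\<close>, \<open>n = rs + sr\<close> and
  \<open>k = \<i>(rs - sr)\<close> lie on a sphere, \<open>m\<^sup>2 + n\<^sup>2 + k\<^sup>2 = 1\<close>, and \<open>m\<close> commutes with \<open>n\<close> and \<open>k\<close>. With
  the analogous \<open>m', n', k'\<close> of the \<open>i\<close>-th row, \<open>\<Delta> (2 u\<^sub>i\<^sub>j\<^sup>2 - 1) = m' \<otimes> m + n' \<otimes> n - k' \<otimes> k\<close>.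
  Apply \<open>id \<otimes> h\<close> to powers of this identity and evaluate the first leg in two by two matrices, which
  the universal property allows: once with a scalar rotation in place of \<open>u\<close>, once with multiples of
  Pauli matrices. By invariance \<open>cos \<theta> m + sin \<theta> n\<close> and \<open>cos \<theta> m + sin \<theta> k\<close> have the moments of
  \<open>w = 2 u\<^sub>i\<^sub>j\<^sup>2 - 1\<close> for all \<open>\<theta>\<close>. The second order terms in \<open>\<theta>\<close> and the sphere equation yield
  \<open>(2l + 3) h (w\<^sup>2\<^sup>l\<^sup>+\<^sup>2) = (2l + 1) h (w\<^sup>2\<^sup>l)\<close>, the recursion of the uniform law on \<open>[-1, 1]\<close>.

  The functional calculus rests on the bound of the norm of \<open>p(x)\<close>, for \<open>x\<close> self-adjoint of norm at
  most \<open>1\<close>, by the supremum of \<open>|p|\<close> on \<open>[-1, 1]\<close>. As \<open>x + \<i> sqrt (1 - x\<^sup>2)\<close> is unitary,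
  Chebyshev polynomials of \<open>x\<close> have norm at most \<open>1\<close>; this bounds the norm of \<open>p(x)\<close> up to a factor linear
  in the degree, and the C*-identity removes the factor by passing to powers of \<open>p\<^sup>* p\<close>.
\<close>

section \<open>Seminorms on polynomials with the C*-identity\<close>

abbreviation pcnj :: "complex poly \<Rightarrow> complex poly" where
  "pcnj \<equiv> map_poly cnj"

lemma pcnj_add: "pcnj (p + q) = pcnj p + pcnj q"
  by (rule poly_eqI) (simp add: coeff_map_poly)

lemma pcnj_diff: "pcnj (p - q) = pcnj p - pcnj q"
  by (rule poly_eqI) (simp add: coeff_map_poly)

lemma pcnj_smult: "pcnj (Polynomial.smult c p) = Polynomial.smult (cnj c) (pcnj p)"
  by (rule poly_eqI) (simp add: coeff_map_poly)

lemma pcnj_mult: "pcnj (p * q) = pcnj p * pcnj q"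
proof -
  \<comment> \<open>Over an infinite field the values determine a polynomial, and the value of
    \<open>pcnj p\<close> at \<open>z\<close> is the conjugate of the value of \<open>p\<close> at
    \<open>cnj z\<close>.\<close>
  have "poly (pcnj (p * q)) = poly (pcnj p * pcnj q)"
    by (rule ext) simp
  then show ?thesis
    by (simp add: poly_eq_poly_eq_iff)
qed

lemma pcnj_power: "pcnj (p ^ n) = pcnj p ^ n"
  by (induction n) (auto simp: pcnj_mult)

lemma pcnj_pcnj [simp]: "pcnj (pcnj p) = p"
  by (rule poly_eqI) (simp add: coeff_map_poly)

lemma pcnj_X [simp]: "pcnj [:0, 1:] = [:0, 1:]"
  by (simp add: map_poly_pCons)

lemma two_mult_poly: "2 * p = Polynomial.smult 2 (p :: complex poly)"
  by (simp add: numeral_poly)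

lemma two_mult_half [simp]: "2 * Polynomial.smult (1 / 2) p = (p :: complex poly)"
  by (simp add: two_mult_poly)

section \<open>Chebyshev polynomials of the first kind and bounds for Chebyshev coefficients\<close>

fun chebyshev :: "nat \<Rightarrow> complex poly" where
  "chebyshev 0 = 1"
| "chebyshev (Suc 0) = [:0, 1:]"
| "chebyshev (Suc (Suc n)) = Polynomial.smult 2 ([:0, 1:] * chebyshev (Suc n)) - chebyshev n"

lemma chebyshev_cos: "poly (chebyshev n) (of_real (cos t)) = of_real (cos (real n * t))"
proof (induction n rule: chebyshev.induct)
  case (3 n)
  have "cos (real (Suc (Suc n)) * t) = 2 * cos t * cos (real (Suc n) * t) - cos (real n * t)"
    using cos_times_cos[of t "real (Suc n) * t"] cos_minus[of "real n * t"]
    by (simp add: algebra_simps)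
  then show ?case
    using 3 by simp
qed auto

lemma X_chebyshev_Suc:
  "[:0, 1:] * chebyshev (Suc n) = Polynomial.smult (1/2) (chebyshev (Suc (Suc n)) + chebyshev n)"
  by (simp add: smult_diff_right smult_add_right)

text \<open>Split off the constant term, \<open>p = a + X q\<close>. Multiplication by
  \<open>X\<close> sends a Chebyshev polynomial to a combination of its neighbours, so the largest
  index grows by at most one.\<close>

lemma chebyshev_expansion:
  "\<exists>c. p = (\<Sum>k\<le>degree p. Polynomial.smult (c k) (chebyshev k))"
proof -
  have "\<exists>c. p = (\<Sum>k\<le>d. Polynomial.smult (c k) (chebyshev k))" if "degree p \<le> d" for d p
    using that
  proof (induction d arbitrary: p)
    case 0
    then have "p = Polynomial.smult (coeff p 0) (chebyshev 0)"
      by (metis chebyshev.simps(1) degree_0_id le_0_eq smult_1_left smult_one mult.right_neutral)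
    then show ?case
      by (intro exI[of _ "\<lambda>_. coeff p 0"]) simp
  next
    case (Suc d)
    obtain a q where p: "p = pCons a q"
      by (metis pCons_cases)
    then have "degree q \<le> d"
      using Suc.prems by (auto simp: degree_pCons_eq_if split: if_splits)
    then obtain c where c: "q = (\<Sum>k\<le>d. Polynomial.smult (c k) (chebyshev k))"
      using Suc.IH by blast
    \<comment> \<open>\<open>S\<close> is the span of the Chebyshev polynomials up to index
      \<open>Suc d\<close>; its closure properties place \<open>a + X q\<close> in it.\<close>
    define S where "S = {f :: complex poly. \<exists>c. f = (\<Sum>k\<le>Suc d. Polynomial.smult (c k) (chebyshev k))}"
    have S_add: "f + g \<in> S" if fg: "f \<in> S" "g \<in> S" for f g
    proof -
      obtain c1 c2 where "f = (\<Sum>k\<le>Suc d. Polynomial.smult (c1 k) (chebyshev k))"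
          "g = (\<Sum>k\<le>Suc d. Polynomial.smult (c2 k) (chebyshev k))"
        using fg by (auto simp: S_def)
      then have "f + g = (\<Sum>k\<le>Suc d. Polynomial.smult (c1 k + c2 k) (chebyshev k))"
        by (simp only: smult_add_left sum.distrib)
      then show ?thesis
        unfolding S_def by (intro CollectI exI[of _ "\<lambda>k. c1 k + c2 k"])
    qed
    have S_smult: "Polynomial.smult a f \<in> S" if f: "f \<in> S" for a f
    proof -
      obtain c1 where c1: "f = (\<Sum>k\<le>Suc d. Polynomial.smult (c1 k) (chebyshev k))"
        using f unfolding S_def by blast
      then have "Polynomial.smult a f = (\<Sum>k\<le>Suc d. Polynomial.smult (a * c1 k) (chebyshev k))"
        by (intro poly_eqI) (simp only: coeff_sum coeff_smult sum_distrib_left mult.assoc)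
      then show ?thesis
        unfolding S_def by (intro CollectI exI[of _ "\<lambda>k. a * c1 k"])
    qed
    have S_T: "chebyshev k \<in> S" if "k \<le> Suc d" for k
    proof -
      have "chebyshev k = (\<Sum>i\<le>Suc d. Polynomial.smult (if i = k then 1 else 0) (chebyshev i))"
        using that by (simp only: if_distrib[of "\<lambda>a. Polynomial.smult a _"] smult_1_left smult_0_left)
          (simp add: sum.delta)
      then show ?thesis
        unfolding S_def by (intro CollectI exI[of _ "\<lambda>i. if i = k then 1 else 0"])
    qed
    have S_X: "[:0, 1:] * chebyshev k \<in> S" if "k \<le> d" for k
    proof (cases k)
      case 0
      then show ?thesis
        using S_T[of "Suc 0"] by simp
    next
      case (Suc l)
      then show ?thesis
        using that unfolding Suc X_chebyshev_Suc by (intro S_smult S_add S_T) auto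
    qed
    have "(\<Sum>k\<in>K. Polynomial.smult (c k) ([:0, 1:] * chebyshev k)) \<in> S" if "finite K" "K \<subseteq> {..d}" for K
      using that
    proof (induction K rule: finite_induct)
      case empty
      show ?case
        using S_smult[OF S_T[of 0], of 0] by simp
    next
      case (insert x F)
      then show ?case
        unfolding sum.insert[OF insert.hyps(1,2)] by (intro S_add S_smult S_X) auto
    qed
    then have "[:0, 1:] * q \<in> S"
      unfolding c sum_distrib_left mult_smult_right by blast
    moreover have "Polynomial.smult a (chebyshev 0) \<in> S"
      by (intro S_smult S_T) auto
    ultimately have "Polynomial.smult a (chebyshev 0) + [:0, 1:] * q \<in> S"
      by (intro S_add)
    moreover have "Polynomial.smult a (chebyshev 0) + [:0, 1:] * q = p"
      by (simp add: p)
    ultimately show ?case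
      unfolding S_def by auto
  qed
  then show ?thesis
    by blast
qed

text \<open>Cauchy's estimate on the unit disc for the \<open>n\<close>-th derivative at 0, which is
  \<open>fact n\<close> times the coefficient.\<close>

lemma coeff_bound_unit_circle:
  fixes p :: "complex poly"
  assumes "\<And>z. cmod z = 1 \<Longrightarrow> cmod (poly p z) \<le> B"
  shows "cmod (coeff p n) \<le> B"
proof -
  have 1: "(deriv ^^ n) (poly p) = poly ((pderiv ^^ n) p)" for n
  proof (induction n)
    case (Suc n)
    then show ?case
      by (auto intro!: DERIV_imp_deriv)
  qed auto
  \<comment> \<open>Each differentiation shifts the index, so the induction needs all
    \<open>k\<close>; at \<open>k = 0\<close> the Pochhammer symbol is the factorial.\<close>
  have 2: "coeff ((pderiv ^^ n) p) k = pochhammer (of_nat (Suc k)) n * coeff p (n + k)" for n k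
  proof (induction n arbitrary: k)
    case (Suc n)
    have "coeff ((pderiv ^^ Suc n) p) k
        = of_nat (Suc k) * (pochhammer (of_nat (Suc (Suc k))) n * coeff p (n + Suc k))"
      by (simp only: funpow.simps o_apply coeff_pderiv Suc.IH)
    then show ?case
      by (simp add: pochhammer_rec add.commute)
  qed auto
  have "cmod ((deriv ^^ n) (poly p) 0) \<le> fact n * B / 1 ^ n"
    by (rule Cauchy_inequality) (auto intro!: holomorphic_intros continuous_intros assms)
  moreover have "(deriv ^^ n) (poly p) 0 = fact n * coeff p n"
    using 2[of n 0] by (simp add: 1 poly_0_coeff_0 pochhammer_fact)
  ultimately show ?thesis
    by (simp add: norm_mult)
qed

text \<open>At \<open>x = cos t\<close> the expansion is a Fourier polynomial with coefficients
  \<open>c k / 2\<close> at the frequencies \<open>k\<close> and \<open>- k\<close>. Multiplied by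
  \<open>cis (d * t)\<close> it becomes a polynomial on the unit circle, whose coefficients Cauchy's
  estimate bounds.\<close>

lemma chebyshev_coeff_bound:
  assumes p: "p = (\<Sum>k\<le>d. Polynomial.smult (c k) (chebyshev k))"
    and B: "\<And>x::real. \<bar>x\<bar> \<le> 1 \<Longrightarrow> cmod (poly p (of_real x)) \<le> B"
    and "k \<le> d"
  shows "cmod (c k) \<le> 2 * B"
proof -
  \<comment> \<open>The shift by \<open>d\<close> makes all exponents nonnegative. The two monomials
    of the term \<open>k = 0\<close> coincide.\<close>
  define Q where "Q = (\<Sum>k\<le>d. monom (c k / 2) (d + k) + monom (c k / 2) (d - k))"
  have "cmod (poly Q z) \<le> B" if "cmod z = 1" for z
  proof -
    have "z = rcis (cmod z) (Arg z)"
      by (rule rcis_cmod_Arg[symmetric])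
    then obtain t where z: "z = cis t"
      unfolding \<open>cmod z = 1\<close> rcis_def by simp
    have "poly Q z = (\<Sum>k\<le>d. cis (d * t) * (c k * of_real (cos (k * t))))"
      unfolding Q_def poly_sum
    proof (rule sum.cong[OF refl])
      fix k assume "k \<in> {..d}"
      then have "cis t ^ (d + k) = cis (d * t + k * t)" "cis t ^ (d - k) = cis (d * t - k * t)"
        by (simp_all only: Complex.DeMoivre of_nat_add of_nat_diff distrib_right left_diff_distrib atMost_iff)
      moreover have "cis (a + b) + cis (a - b) = 2 * (cis a * of_real (cos b))" for a b
        by (simp add: complex_eq_iff cos_add cos_diff sin_add sin_diff)
      ultimately have "(c k / 2) * cis t ^ (d + k) + (c k / 2) * cis t ^ (d - k)
          = (c k / 2) * (2 * (cis (d * t) * of_real (cos (k * t))))"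
        by (simp only: distrib_left[symmetric])
      then show "poly (monom (c k / 2) (d + k) + monom (c k / 2) (d - k)) z
          = cis (d * t) * (c k * of_real (cos (k * t)))"
        by (simp add: poly_monom z)
    qed
    also have "\<dots> = cis (d * t) * poly p (of_real (cos t))"
      by (simp add: p poly_sum chebyshev_cos sum_distrib_left)
    finally show ?thesis
      using B[of "cos t"] by (simp add: norm_mult)
  qed
  then have bd: "cmod (coeff Q n) \<le> B" for n
    by (rule coeff_bound_unit_circle)
  have "coeff Q (d + k) = (if k = 0 then c 0 else c k / 2)"
  proof -
    \<comment> \<open>\<open>d - i = d + k\<close> holds only for \<open>i = k = 0\<close>. So the
      middle coefficient is \<open>c 0\<close>, while those above it are halved, whence the factor 2
      in the bound.\<close>
    have "coeff Q (d + k) = (\<Sum>i\<le>d. (if i = k then c k / 2 else 0) + (if i = 0 \<and> k = 0 then c 0 / 2 else 0))"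
      unfolding Q_def coeff_sum using \<open>k \<le> d\<close> by (intro sum.cong) auto
    also have "\<dots> = (if k = 0 then c 0 else c k / 2)"
      using \<open>k \<le> d\<close> by (cases "k = 0") (auto simp: sum.distrib sum.delta)
    finally show ?thesis .
  qed
  with bd[of "d + k"] have "cmod (if k = 0 then c 0 else c k / 2) \<le> B"
    by simp
  moreover have "0 \<le> B"
    using bd[of 0] norm_ge_zero order_trans by blast
  ultimately show ?thesis
    by (auto simp: norm_divide split: if_splits)
qed

text \<open>An abstraction of the map from \<open>p\<close> to the norm of \<open>p(x)\<close>, for
  a self-adjoint \<open>x\<close> of norm at most 1. \<open>N_1\<close> is an inequality so that the
  zero algebra is included.\<close>

locale cstar_poly_seminorm =
  fixes N :: "complex poly \<Rightarrow> real"
  assumes N_add: "N (p + q) \<le> N p + N q"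
    and N_smult: "N (Polynomial.smult c p) = cmod c * N p"
    and N_mult: "N (p * q) \<le> N p * N q"
    and N_star: "N (pcnj p * p) = (N p)\<^sup>2"
    and N_1: "N 1 \<le> 1"
    and N_X: "N [:0, 1:] \<le> 1"
begin

lemma N_0 [simp]: "N 0 = 0"
  using N_smult[of 0 0] by simp

lemma N_uminus [simp]: "N (- p) = N p"
  using N_smult[of "-1" p] by simp

lemma N_nonneg: "0 \<le> N p"
  using N_add[of p "-p"] by simp

lemma N_diff: "N (p - q) \<le> N p + N q"
  using N_add[of p "-q"] by simp

lemma N_sum: "N (\<Sum>k\<in>K. f k) \<le> (\<Sum>k\<in>K. N (f k))"
proof (induction K rule: infinite_finite_induct)
  case (insert x F)
  then show ?case
    using N_add[of "f x" "sum f F"] by simp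
qed auto

lemma N_mult_le: "N p \<le> a \<Longrightarrow> N q \<le> b \<Longrightarrow> N (p * q) \<le> a * b"
  by (meson N_mult N_nonneg mult_mono order_trans)

lemma N_power: "N p \<le> a \<Longrightarrow> N (p ^ n) \<le> a ^ n"
proof (induction n)
  case (Suc n)
  then show ?case
    using N_mult_le by simp
qed (simp add: N_1)

text \<open>By the C*-identity the square of \<open>N q\<close> is at most
  \<open>N (pcnj q) * N q\<close>. Cancel \<open>N q\<close>, and use this for \<open>p\<close> and
  for \<open>pcnj p\<close>.\<close>

lemma N_pcnj [simp]: "N (pcnj p) = N p"
proof -
  have le: "N q \<le> N (pcnj q)" for q
  proof (cases "N q = 0")
    case False
    have "N q * N q \<le> N (pcnj q) * N q"
      using N_star[of q] N_mult[of "pcnj q" q] by (simp add: power2_eq_square)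
    then show ?thesis
      using False N_nonneg[of q] by simp
  qed (simp add: N_nonneg)
  show ?thesis
    using le[of p] le[of "pcnj p"] by simp
qed

section \<open>Fixed point iteration for 1 - sqrt (1 - x^2)\<close>

fun r :: "nat \<Rightarrow> complex poly" where
  "r 0 = 0"
| "r (Suc n) = Polynomial.smult (1/2) ([:0, 1:]\<^sup>2 + (r n)\<^sup>2)"

text \<open>The iteration \<open>r\<close> at the scalar 1. It majorizes \<open>r\<close>, since the
  recursion has nonnegative coefficients and \<open>N [:0, 1:]\<close> is at most 1.\<close>

fun \<rho> :: "nat \<Rightarrow> real" where
  "\<rho> 0 = 0"
| "\<rho> (Suc n) = (1 + (\<rho> n)\<^sup>2) / 2"

declare r.simps(2) [simp del] \<rho>.simps(2) [simp del]

lemma pcnj_r: "pcnj (r n) = r n"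
  by (induction n) (auto simp: r.simps(2) pcnj_smult pcnj_add pcnj_power)

lemma N_r: "N (r n) \<le> \<rho> n"
proof (induction n)
  case (Suc n)
  have "N ([:0, 1:]\<^sup>2 + (r n)\<^sup>2) \<le> 1\<^sup>2 + (\<rho> n)\<^sup>2"
    using N_add N_power[OF N_X, of 2] N_power[OF Suc, of 2] by (meson add_mono order_trans)
  then show ?case
    by (simp add: N_smult r.simps(2) \<rho>.simps(2))
qed simp

text \<open>Both sequences of increments obey the same recursion: by a difference of squares, the
  new increment is half of the old one times the sum of the last two iterates. Compare factor by
  factor.\<close>

lemma N_r_diff: "N (r (Suc n) - r n) \<le> \<rho> (Suc n) - \<rho> n"
proof (induction n)
  case 0
  have "N ([:0, 1:]\<^sup>2) \<le> 1\<^sup>2"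
    by (rule N_power[OF N_X])
  then show ?case
    by (simp add: N_smult r.simps(2) \<rho>.simps(2))
next
  case (Suc n)
  have "r (Suc (Suc n)) - r (Suc n) = Polynomial.smult (1/2) ((r (Suc n))\<^sup>2 - (r n)\<^sup>2)"
    by (simp only: r.simps(2)[of "Suc n"] r.simps(2)[of n] smult_diff_right[symmetric]) (simp only: add_diff_cancel_left)
  also have "\<dots> = Polynomial.smult (1/2) ((r (Suc n) - r n) * (r (Suc n) + r n))"
    by (simp add: power2_eq_square algebra_simps)
  finally have "N (r (Suc (Suc n)) - r (Suc n)) = N ((r (Suc n) - r n) * (r (Suc n) + r n)) / 2"
    by (simp only: N_smult) simp
  also have "N ((r (Suc n) - r n) * (r (Suc n) + r n)) \<le> (\<rho> (Suc n) - \<rho> n) * (\<rho> (Suc n) + \<rho> n)"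
    using N_add[of "r (Suc n)" "r n"] N_r[of n] N_r[of "Suc n"]
    by (intro N_mult_le Suc) linarith
  also have "\<dots> / 2 = \<rho> (Suc (Suc n)) - \<rho> (Suc n)"
    by (simp add: \<rho>.simps(2) field_simps power2_eq_square)
  finally show ?case
    by simp
qed

text \<open>The increments are \<open>(1 - \<rho> n)\<^sup>2 / 2\<close>, so the sequence increases.
  Being bounded by 1, it converges, and the increments of a convergent sequence tend to 0.\<close>

lemma \<rho>_diff_tendsto: "(\<lambda>n. \<rho> (Suc n) - \<rho> n) \<longlonglongrightarrow> 0"
proof -
  have b: "0 \<le> \<rho> n \<and> \<rho> n \<le> 1" for n
  proof (induction n)
    case (Suc n)
    then have "(\<rho> n)\<^sup>2 \<le> 1"
      by (simp add: power_le_one)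
    then show ?case
      by (simp add: \<rho>.simps(2))
  qed simp
  have "\<rho> (Suc n) - \<rho> n = (1 - \<rho> n)\<^sup>2 / 2" for n
    by (simp add: \<rho>.simps(2) power2_eq_square field_simps)
  then have "incseq \<rho>"
    by (intro incseq_SucI) (metis diff_ge_0_iff_ge divide_nonneg_nonneg zero_le_numeral zero_le_power2)
  then obtain l where "\<rho> \<longlonglongrightarrow> l"
    using b incseq_convergent by metis
  then have "(\<lambda>n. \<rho> (Suc n) - \<rho> n) \<longlonglongrightarrow> l - l"
    by (intro tendsto_diff LIMSEQ_Suc)
  then show ?thesis
    by simp
qed

text \<open>
  As \<open>r n\<close> approximates \<open>1 - sqrt (1 - x\<^sup>2)\<close>, the polynomial \<open>w n\<close> is almost unitary with real
  part \<open>x\<close>; the Chebyshev polynomials are close to the real parts of its powers.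
\<close>

definition w :: "nat \<Rightarrow> complex poly" where
  "w n = [:0, 1:] + [:\<i>:] * (1 - r n)"

lemma pcnj_w: "pcnj (w n) = [:0, 1:] - [:\<i>:] * (1 - r n)"
  unfolding w_def pcnj_add pcnj_mult pcnj_diff pcnj_r pcnj_X
  by (simp add: map_poly_pCons)

lemma w_add_pcnj: "w n + pcnj (w n) = 2 * [:0, 1:]"
  unfolding pcnj_w by (simp add: w_def)

text \<open>The failure of \<open>w n\<close> to be unitary is twice an increment of
  \<open>r\<close>, hence small in \<open>N\<close>.\<close>

lemma pcnj_w_mult: "pcnj (w n) * w n = 1 + 2 * (r (Suc n) - r n)"
proof -
  have "2 * r (Suc n) = [:0, 1:]\<^sup>2 + (r n)\<^sup>2"
    by (simp only: r.simps two_mult_half)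
  moreover have "[:\<i>:] * [:\<i>:] = - 1"
    by (simp add: one_pCons)
  \<comment> \<open>The computation uses only the recursion for \<open>R'\<close> and the square of
    \<open>J\<close>; with abstract letters the concrete polynomials are not unfolded.\<close>
  moreover have "(X - J * (1 - R)) * (X + J * (1 - R)) = 1 + 2 * (R' - R)"
    if "2 * R' = X\<^sup>2 + R\<^sup>2" "J * J = - 1" for X J R R' :: "complex poly"
  proof -
    have "(X - J * (1 - R)) * (X + J * (1 - R)) = X\<^sup>2 - (J * J) * (1 - R)\<^sup>2"
      by (simp add: algebra_simps power2_eq_square)
    also have "\<dots> = 1 + (X\<^sup>2 + R\<^sup>2) - 2 * R"
      unfolding that(2) by (simp add: algebra_simps power2_eq_square)
    finally show ?thesis
      unfolding that(1)[symmetric] by (simp add: algebra_simps)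
  qed
  ultimately show ?thesis
    unfolding pcnj_w unfolding w_def by blast
qed

lemma N_two_mult [simp]: "N (2 * p) = 2 * N p"
  using N_smult[of 2 p] by (simp add: numeral_poly)

lemma N_half [simp]: "N (Polynomial.smult (1 / 2) p) = N p / 2"
  by (simp add: N_smult)

definition A :: "nat \<Rightarrow> nat \<Rightarrow> complex poly" where
  "A k n = Polynomial.smult (1 / 2) (w n ^ k + pcnj (w n) ^ k)"

text \<open>The Chebyshev recursion, perturbed by the unitarity defect of \<open>w n\<close>: the
  two factors \<open>w n\<close> and \<open>pcnj (w n)\<close> have sum \<open>2 X\<close> and the
  product computed in \<open>pcnj_w_mult\<close>.\<close>

lemma A_Suc_Suc:
  "A (Suc (Suc k)) n = 2 * ([:0, 1:] * A (Suc k) n) - (1 + 2 * (r (Suc n) - r n)) * A k n"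
proof -
  have "w n ^ Suc (Suc k) + pcnj (w n) ^ Suc (Suc k)
      = (w n + pcnj (w n)) * (w n ^ Suc k + pcnj (w n) ^ Suc k)
        - (pcnj (w n) * w n) * (w n ^ k + pcnj (w n) ^ k)"
    by (simp add: algebra_simps)
  then show ?thesis
    unfolding A_def w_add_pcnj pcnj_w_mult
    by (simp only: mult_smult_right smult_diff_right mult.assoc)
qed

lemma N_w_le: "N (w n) \<le> sqrt (1 + 2 * (\<rho> (Suc n) - \<rho> n))"
proof -
  have "N (1 + 2 * q) \<le> 1 + 2 * e" if "N q \<le> e" for q e
    using N_add[of 1 "2 * q"] N_1 that by simp
  then have "(N (w n))\<^sup>2 \<le> 1 + 2 * (\<rho> (Suc n) - \<rho> n)"
    unfolding N_star[symmetric] pcnj_w_mult using N_r_diff by blast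
  then show ?thesis
    using real_le_rsqrt by blast
qed

lemma N_A_le: "N (A k n) \<le> sqrt (1 + 2 * (\<rho> (Suc n) - \<rho> n)) ^ k"
  using N_add[of "w n ^ k" "pcnj (w n) ^ k"] N_power[OF N_w_le, of n k]
    N_power[OF N_w_le[of n, folded N_pcnj[of "w n"]], of k]
  unfolding A_def N_half by linarith

lemma sqrt_tendsto_1: "(\<lambda>n. sqrt (1 + 2 * (\<rho> (Suc n) - \<rho> n)) ^ k) \<longlonglongrightarrow> 1"
proof -
  have "(\<lambda>n. sqrt (1 + 2 * (\<rho> (Suc n) - \<rho> n)) ^ k) \<longlonglongrightarrow> sqrt (1 + 2 * 0) ^ k"
    by (intro tendsto_intros \<rho>_diff_tendsto)
  then show ?thesis
    by simp
qed

text \<open>Subtracting the Chebyshev recursion from \<open>A_Suc_Suc\<close> bounds the error at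
  \<open>k + 2\<close> by the errors at \<open>k + 1\<close> and \<open>k\<close> and a term that
  vanishes with the unitarity defect. So the errors tend to 0 one index after another.\<close>

lemma N_A_diff_tendsto: "(\<lambda>n. N (A k n - chebyshev k)) \<longlonglongrightarrow> 0"
proof (induction k rule: chebyshev.induct)
  case 1
  have "A 0 n = 1" for n
    by (simp add: A_def one_pCons)
  then show ?case
    by simp
next
  case 2
  have "A (Suc 0) n = [:0, 1:]" for n
    unfolding A_def power_Suc0_right power_one_right w_add_pcnj
    by (simp add: numeral_poly)
  then show ?case
    by simp
next
  case (3 k)
  define \<epsilon> where "\<epsilon> = (\<lambda>n. \<rho> (Suc n) - \<rho> n)"
  have "A (Suc (Suc k)) n - chebyshev (Suc (Suc k))
      = 2 * ([:0, 1:] * (A (Suc k) n - chebyshev (Suc k))) - (A k n - chebyshev k)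
        - 2 * ((r (Suc n) - r n) * A k n)" for n
    unfolding A_Suc_Suc chebyshev.simps
    by (simp only: two_mult_poly[symmetric] algebra_simps mult_1_left)
  moreover have "N (2 * ([:0, 1:] * f) - g - 2 * (e * a)) \<le> 2 * (1 * N f) + N g + 2 * (x * y)"
    if "N e \<le> x" "N a \<le> y" for e f g a x y
    using N_diff[of "2 * ([:0, 1:] * f) - g" "2 * (e * a)"] N_diff[of "2 * ([:0, 1:] * f)" g]
      N_mult_le[OF that] N_mult_le[OF N_X order_refl, of f]
    unfolding N_two_mult by linarith
  ultimately have le: "N (A (Suc (Suc k)) n - chebyshev (Suc (Suc k)))
      \<le> 2 * (1 * N (A (Suc k) n - chebyshev (Suc k))) + N (A k n - chebyshev k)
        + 2 * (\<epsilon> n * sqrt (1 + 2 * \<epsilon> n) ^ k)" for n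
    unfolding \<epsilon>_def using N_r_diff N_A_le by presburger
  have lim: "(\<lambda>n. 2 * (1 * N (A (Suc k) n - chebyshev (Suc k))) + N (A k n - chebyshev k)
        + 2 * (\<epsilon> n * sqrt (1 + 2 * \<epsilon> n) ^ k)) \<longlonglongrightarrow> 2 * (1 * 0) + 0 + 2 * (0 * 1)"
    unfolding \<epsilon>_def by (intro tendsto_intros 3 \<rho>_diff_tendsto sqrt_tendsto_1)
  show ?case
  proof (rule tendsto_sandwich)
    show "(\<lambda>_. 0 :: real) \<longlonglongrightarrow> 0"
      by (rule tendsto_const)
    show "\<forall>\<^sub>F n in sequentially. 0 \<le> N (A (Suc (Suc k)) n - chebyshev (Suc (Suc k)))"
      by (intro always_eventually allI N_nonneg)
    show "\<forall>\<^sub>F n in sequentially. N (A (Suc (Suc k)) n - chebyshev (Suc (Suc k)))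
      \<le> 2 * (1 * N (A (Suc k) n - chebyshev (Suc k))) + N (A k n - chebyshev k)
        + 2 * (\<epsilon> n * sqrt (1 + 2 * \<epsilon> n) ^ k)"
      by (intro always_eventually allI le)
  qed (use lim in simp)
qed

text \<open>The bounds for the approximants \<open>A k n\<close> tend to 1, and their distance from
  the Chebyshev polynomial tends to 0.\<close>

lemma N_chebyshev: "N (chebyshev k) \<le> 1"
proof -
  have "N (chebyshev k) \<le> N (A k n - chebyshev k) + sqrt (1 + 2 * (\<rho> (Suc n) - \<rho> n)) ^ k" for n
    using N_diff[of "A k n" "A k n - chebyshev k"] N_A_le[of k n] by simp
  moreover have "(\<lambda>n. N (A k n - chebyshev k) + sqrt (1 + 2 * (\<rho> (Suc n) - \<rho> n)) ^ k) \<longlonglongrightarrow> 0 + 1"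
    by (intro tendsto_add N_A_diff_tendsto sqrt_tendsto_1)
  ultimately show ?thesis
    by (intro LIMSEQ_le_const[where a = "N (chebyshev k)"]) auto
qed

text \<open>Each of the \<open>degree p + 1\<close> Chebyshev coefficients has modulus at most
  \<open>2 * B\<close>, and each Chebyshev polynomial has seminorm at most 1.\<close>

lemma N_le_linear:
  assumes B: "\<And>x::real. \<bar>x\<bar> \<le> 1 \<Longrightarrow> cmod (poly p (of_real x)) \<le> B"
  shows "N p \<le> 2 * (real (degree p) + 1) * B"
proof -
  obtain c where c: "p = (\<Sum>k\<le>degree p. Polynomial.smult (c k) (chebyshev k))"
    using chebyshev_expansion by blast
  have "N p \<le> (\<Sum>k\<le>degree p. N (Polynomial.smult (c k) (chebyshev k)))"
    by (subst c) (rule N_sum)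
  also have "\<dots> \<le> (\<Sum>k\<le>degree p. 2 * B * 1)"
    unfolding N_smult using chebyshev_coeff_bound[OF c B] order_trans[OF norm_ge_zero B[of 0]]
    by (intro sum_mono mult_mono N_chebyshev N_nonneg) auto
  finally show ?thesis
    by (simp add: algebra_simps)
qed

text \<open>
  The linear factor of the previous bound disappears by applying it to the powers of \<open>p\<^sup>* p\<close>.
\<close>

theorem N_le_sup:
  assumes B: "\<And>x::real. \<bar>x\<bar> \<le> 1 \<Longrightarrow> cmod (poly p (of_real x)) \<le> B"
  shows "N p \<le> B"
proof -
  define q where "q = pcnj p * p"
  have B0: "0 \<le> B"
    using order_trans[OF norm_ge_zero B[of 0]] by simp
  have q: "cmod (poly q (of_real x)) \<le> B\<^sup>2" if "\<bar>x\<bar> \<le> 1" for x :: real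
    using power_mono[OF B[OF that] norm_ge_zero, of 2] by (simp add: q_def norm_mult power2_eq_square)
  have sa: "pcnj (q ^ n) = q ^ n" for n
    by (simp only: pcnj_power q_def pcnj_mult pcnj_pcnj mult.commute[of "pcnj p" p])
  \<comment> \<open>Powers of \<open>q\<close> are self-adjoint, so the C*-identity computes the
    seminorm exactly at each squaring; this is why the exponents are powers of two.\<close>
  have pw: "N q ^ (2 ^ m) = N (q ^ (2 ^ m))" for m
  proof (induction m)
    case (Suc m)
    have "N (q ^ (2 ^ Suc m)) = N (pcnj (q ^ (2 ^ m)) * q ^ (2 ^ m))"
      unfolding sa by (simp add: mult_2 power_add)
    then show ?case
      unfolding N_star Suc[symmetric] power_Suc2 power_mult by simp
  qed simp
  have le: "N q ^ (2 ^ m) \<le> 2 * (real (2 ^ m * degree q) + 1) * (B\<^sup>2) ^ (2 ^ m)" for m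
  proof -
    have "N q ^ (2 ^ m) \<le> 2 * (real (degree (q ^ (2 ^ m))) + 1) * (B\<^sup>2) ^ (2 ^ m)"
      unfolding pw by (rule N_le_linear) (auto simp: norm_power intro!: power_mono q)
    also have "\<dots> \<le> 2 * (real (2 ^ m * degree q) + 1) * (B\<^sup>2) ^ (2 ^ m)"
      using degree_power_le[of q "2 ^ m"] by (intro mult_right_mono) (auto simp: mult.commute simp flip: of_nat_mult)
    finally show ?thesis .
  qed
  have "N q \<le> B\<^sup>2"
  proof (rule ccontr)
    assume "\<not> N q \<le> B\<^sup>2"
    show False
    proof (cases "B = 0")
      case True
      then show False
        using le[of 0] \<open>\<not> N q \<le> B\<^sup>2\<close> by simp
    next
      case False
      \<comment> \<open>This ratio exceeds 1, so its powers outgrow every linear function of the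
        exponent, against \<open>le\<close>.\<close>
      define x where "x = N q / B\<^sup>2"
      have "x > 1"
        using \<open>\<not> N q \<le> B\<^sup>2\<close> False by (simp add: x_def field_simps)
      have "x ^ (2 ^ m) \<le> 2 * (real (2 ^ m * degree q) + 1)" for m
        using le[of m] False unfolding x_def by (simp add: power_divide field_simps)
      moreover have "eventually (\<lambda>M. x ^ M > 2 * (real M * real (degree q) + 1)) at_top"
        using \<open>x > 1\<close> by real_asymp
      then obtain m where "x ^ M > 2 * (real M * real (degree q) + 1)" if "M \<ge> m" for M
        unfolding eventually_at_top_linorder by blast
      ultimately show False
        by (metis less_exp linorder_not_less nless_le of_nat_mult)
    qed
  qed
  then have "(N p)\<^sup>2 \<le> B\<^sup>2"
    unfolding q_def N_star .
  then show ?thesis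
    using B0 power2_le_imp_le by blast
qed

end

section \<open>Polynomial functional calculus in C*-algebras\<close>

context cstar_algebra
begin

section \<open>Elementary rules for scalars, involution and norm\<close>

lemma complex_ring_simps [simp]:
  "carrier complex_ring = UNIV" "\<one>\<^bsub>complex_ring\<^esub> = 1" "\<zero>\<^bsub>complex_ring\<^esub> = 0"
  "x \<oplus>\<^bsub>complex_ring\<^esub> y = x + y" "x \<otimes>\<^bsub>complex_ring\<^esub> y = x * y"
  by (simp_all add: complex_ring_def)

text \<open>Unqualified fact names of the ring locales refer to \<^const>\<open>complex_ring\<close> in this context.\<close>

lemma ring_A: "ring A"
  by unfold_locales

lemmas A_ring = ring.ring_simprules[OF ring_A]
lemmas A_ac = A_ring(7,10,22)
lemmas A_comm = A_ring(10)
lemmas A_assoc = A_ring(11)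
lemmas A_distrib = A_ring(13,23)
lemmas A_neg = A_ring(9,16,17,18)
lemmas A_minus_equality = abelian_group.minus_equality[OF ring.is_abelian_group[OF ring_A]]
lemmas A_pow_Suc = monoid.nat_pow_Suc2[OF ring.is_monoid[OF ring_A]]

lemma scale_closed [simp]: "x \<in> carrier A \<Longrightarrow> c \<odot> x \<in> carrier A"
  using smult_closed[of c x] by simp

lemma scale_add_left: "x \<in> carrier A \<Longrightarrow> (c + d) \<odot> x = c \<odot> x \<oplus> d \<odot> x"
  using smult_l_distr[of c d x] by simp

lemma scale_add_right:
  "\<lbrakk>x \<in> carrier A; y \<in> carrier A\<rbrakk> \<Longrightarrow> c \<odot> (x \<oplus> y) = c \<odot> x \<oplus> c \<odot> y"
  using smult_r_distr[of c x y] by simp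

lemma scale_scale: "x \<in> carrier A \<Longrightarrow> c \<odot> (d \<odot> x) = (c * d) \<odot> x"
  using smult_assoc1[of c d x] by simp

lemma scale_one [simp]: "x \<in> carrier A \<Longrightarrow> 1 \<odot> x = x"
  using smult_one[of x] by simp

lemma scale_0_left [simp]: "x \<in> carrier A \<Longrightarrow> 0 \<odot> x = \<zero>"
  using smult_l_null[of x] by simp

lemma scale_0_right [simp]: "c \<odot> \<zero> = \<zero>"
  using smult_r_null[of c] by simp

lemma uminus_conv_scale: "x \<in> carrier A \<Longrightarrow> \<ominus> x = (- 1) \<odot> x"
  using scale_add_left[of x "-1" 1] by (intro A_minus_equality) (auto simp: A_comm)

lemma star_zero [simp]: "star A \<zero> = \<zero>"
  using star_smult[of \<zero> 0] star_closed[of \<zero>] by simp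

lemma star_one [simp]: "star A \<one> = \<one>"
  using star_mult[of \<one> "star A \<one>"] star_closed[of \<one>] star_star[of \<one>] by simp

lemma cnorm_zero [simp]: "cnorm A \<zero> = 0"
  using cnorm_eq_0[of \<zero>] by simp

lemma cnorm_one_le: "cnorm A \<one> \<le> 1"
  using cstar_identity[of \<one>] by (auto simp: power2_eq_square)

lemma cnorm_minus_commute:
  "\<lbrakk>x \<in> carrier A; y \<in> carrier A\<rbrakk> \<Longrightarrow> cnorm A (x \<ominus> y) = cnorm A (y \<ominus> x)"
  using cnorm_smult[of "x \<ominus> y" "-1"]
  by (simp add: uminus_conv_scale a_minus_def scale_add_right scale_scale A_comm)

lemma cnorm_dist_triangle:
  assumes "x \<in> carrier A" "y \<in> carrier A" "z \<in> carrier A"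
  shows "cnorm A (x \<ominus> z) \<le> cnorm A (x \<ominus> y) + cnorm A (y \<ominus> z)"
proof -
  have "x \<ominus> z = (x \<ominus> y) \<oplus> (y \<ominus> z)"
    using assms by (simp add: a_minus_def A_ac A_neg)
  then show ?thesis
    using assms cnorm_triangle[of "x \<ominus> y" "y \<ominus> z"] by simp
qed

lemma cnorm_star [simp]:
  assumes "x \<in> carrier A"
  shows "cnorm A (star A x) = cnorm A x"
proof -
  have le: "cnorm A x \<le> cnorm A (star A x)" if "x \<in> carrier A" for x
  proof (cases "cnorm A x = 0")
    case False
    then show ?thesis
      using cstar_identity[OF that] cnorm_mult[OF star_closed[OF that] that] cnorm_nonneg[OF that]
      by (simp add: power2_eq_square)
  qed (simp add: cnorm_nonneg star_closed that)
  show ?thesis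
    using le[OF assms] le[OF star_closed[OF assms]] by (simp add: star_star assms)
qed

section \<open>Evaluation of polynomials at an element, by the Horner scheme\<close>

definition peval :: "'a \<Rightarrow> complex poly \<Rightarrow> 'a" where
  "peval x p = fold_coeffs (\<lambda>c y. c \<odot> \<one> \<oplus> x \<otimes> y) p \<zero>"

lemma peval_0 [simp]: "peval x 0 = \<zero>"
  by (simp add: peval_def)

lemma peval_pCons [simp]:
  "x \<in> carrier A \<Longrightarrow> peval x (pCons c p) = c \<odot> \<one> \<oplus> x \<otimes> peval x p"
  by (cases "p = 0"; cases "c = 0") (simp_all add: peval_def)

lemma peval_closed [simp]: "x \<in> carrier A \<Longrightarrow> peval x p \<in> carrier A"
  by (induction p) auto

lemma peval_1 [simp]: "x \<in> carrier A \<Longrightarrow> peval x 1 = \<one>"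
  by (simp add: one_pCons)

lemma peval_add:
  assumes "x \<in> carrier A"
  shows "peval x (p + q) = peval x p \<oplus> peval x q"
proof (induction p q rule: poly_induct2)
  case (pCons a p b q)
  then show ?case
    using assms by (simp add: scale_add_left A_distrib A_ac)
qed simp

lemma peval_smult:
  assumes "x \<in> carrier A"
  shows "peval x (Polynomial.smult c p) = c \<odot> peval x p"
  by (induction p) (use assms in \<open>auto simp: scale_add_right scale_scale smult_mult_right\<close>)

lemma peval_mult:
  assumes "x \<in> carrier A"
  shows "peval x (p * q) = peval x p \<otimes> peval x q"
  by (induction p)
    (use assms in \<open>auto simp: peval_add peval_smult A_distrib A_assoc smult_mult_left\<close>)

lemma peval_diff:
  assumes "x \<in> carrier A"
  shows "peval x (p - q) = peval x p \<ominus> peval x q"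
proof -
  have "p - q = p + Polynomial.smult (- 1) q"
    by simp
  then show ?thesis
    using assms by (simp only: peval_add peval_smult a_minus_def uminus_conv_scale peval_closed)
qed

lemma peval_X [simp]: "x \<in> carrier A \<Longrightarrow> peval x [:0, 1:] = x"
  by simp

lemma peval_power: "x \<in> carrier A \<Longrightarrow> peval x (p ^ n) = peval x p [^] n"
  by (induction n) (auto simp: peval_mult power_Suc2 simp del: power_Suc)

lemma peval_commute: "x \<in> carrier A \<Longrightarrow> peval x p \<otimes> peval x q = peval x q \<otimes> peval x p"
  by (metis peval_mult mult.commute)

lemma peval_pcompose:
  assumes "x \<in> carrier A"
  shows "peval x (pcompose p q) = peval (peval x q) p"
  by (induction p) (use assms in \<open>auto simp: pcompose_pCons peval_add peval_mult\<close>)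

lemma peval_pcnj:
  assumes x: "x \<in> carrier A" "star A x = x"
  shows "peval x (pcnj p) = star A (peval x p)"
proof (induction p)
  case (pCons a p)
  \<comment> \<open>The involution reverses products; commutativity of polynomials in
    \<open>x\<close> restores the order.\<close>
  have "star A (peval x p) \<otimes> x = x \<otimes> star A (peval x p)"
    using peval_commute[OF x(1), of "pcnj p" "[:0, 1:]"] unfolding peval_X[OF x(1)] pCons.IH .
  then show ?case
    using x pCons by (simp add: map_poly_pCons star_add star_smult star_mult)
qed simp

lemma cstar_poly_seminorm_peval:
  assumes x: "x \<in> carrier A" "star A x = x" and "cnorm A x \<le> 1"
  shows "cstar_poly_seminorm (\<lambda>p. cnorm A (peval x p))"
proof
  show "cnorm A (peval x (pcnj p * p)) = (cnorm A (peval x p))\<^sup>2" for p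
    by (simp only: peval_mult[OF x(1)] peval_pcnj[OF x] cstar_identity peval_closed x)
qed (use assms cnorm_one_le in \<open>auto simp: peval_add peval_mult peval_smult cnorm_triangle cnorm_mult cnorm_smult
      simp del: peval_pCons peval_X intro: order_trans[OF eq_refl[OF arg_cong[where f = "cnorm A", OF peval_X]]]\<close>)

text \<open>Rescaling by \<open>1 / L\<close> reduces to norm at most 1, where
  \<open>N_le_sup\<close> applies to \<open>p(L t)\<close>. A bound \<open>L > 0\<close> in place of
  the norm also covers the zero element.\<close>

theorem cnorm_peval_le:
  assumes x: "x \<in> carrier A" "star A x = x" and L: "cnorm A x \<le> L" "0 < L"
    and B: "\<And>t::real. \<bar>t\<bar> \<le> L \<Longrightarrow> cmod (poly p (of_real t)) \<le> B"
  shows "cnorm A (peval x p) \<le> B"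
proof -
  define y where "y = of_real (1 / L) \<odot> x"
  have y: "y \<in> carrier A" "star A y = y" "cnorm A y \<le> 1"
    using x L by (auto simp: y_def star_smult cnorm_smult norm_divide field_simps)
  interpret cstar_poly_seminorm "\<lambda>p. cnorm A (peval y p)"
    by (rule cstar_poly_seminorm_peval[OF y])
  have "peval y [:0, of_real L:] = x"
    using x L by (simp add: y_def smult_mult_left smult_mult_right scale_scale)
  then have "peval x p = peval y (pcompose p [:0, of_real L:])"
    by (simp only: peval_pcompose y)
  also have "cnorm A \<dots> \<le> B"
  proof (rule N_le_sup)
    fix t :: real assume "\<bar>t\<bar> \<le> 1"
    then have "\<bar>t * L\<bar> \<le> L"
      using L by (simp add: abs_mult)
    then show "cmod (poly (pcompose p [:0, of_real L:]) (of_real t)) \<le> B"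
      using B[of "t * L"] by (simp add: poly_pcompose)
  qed
  finally show ?thesis .
qed

text \<open>Norm estimates do the work of positivity. If \<open>x\<close> had norm above 1, then
  \<open>x\<^sup>2 = 1 - y\<^sup>2\<close> would make the squared norm of \<open>y\<close> exceed
  that of \<open>x\<close> by at least 1; then \<open>y\<close> has norm above 1 too, and the same
  holds with the roles exchanged.\<close>

lemma cnorm_le_1_if_sum_squares:
  assumes x: "x \<in> carrier A" "star A x = x" and y: "y \<in> carrier A" "star A y = y"
    and sum: "x \<otimes> x \<oplus> y \<otimes> y = \<one>"
  shows "cnorm A x \<le> 1"
proof (rule ccontr)
  have square: "(cnorm A z)\<^sup>2 \<le> max 1 ((cnorm A w)\<^sup>2 - 1)"
    if z: "z \<in> carrier A" "star A z = z" and w: "w \<in> carrier A" "star A w = w"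
      and sum: "z \<otimes> z \<oplus> w \<otimes> w = \<one>" for z w
  proof -
    have "peval w [:1, 0, - 1:] = \<one> \<ominus> w \<otimes> w"
      using w by (simp add: a_minus_def uminus_conv_scale smult_mult_right A_distrib)
    also have "\<dots> = z \<otimes> z"
      using z w by (simp add: sum[symmetric] a_minus_def A_ring(7) A_neg)
    finally have eq: "(cnorm A z)\<^sup>2 = cnorm A (peval w [:1, 0, - 1:])"
      using cstar_identity[OF z(1)] z by simp
    have "cnorm A (peval w [:1, 0, - 1:]) \<le> max 1 (L\<^sup>2 - 1)" if L: "cnorm A w \<le> L" "0 < L" for L
    proof (rule cnorm_peval_le[OF w L])
      fix t :: real assume "\<bar>t\<bar> \<le> L"
      then have "t\<^sup>2 \<le> L\<^sup>2"
        by (rule abs_le_square_iff[THEN iffD1, of t L, unfolded abs_of_pos[OF L(2)]])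
      have "poly [:1, 0, - 1:] (of_real t) = complex_of_real (1 - t\<^sup>2)"
        by (simp add: power2_eq_square)
      then show "cmod (poly [:1, 0, - 1:] (of_real t)) \<le> max 1 (L\<^sup>2 - 1)"
        using \<open>t\<^sup>2 \<le> L\<^sup>2\<close> by (simp only: norm_of_real) (smt (verit) zero_le_power2)
    qed
    \<comment> \<open>\<open>L = 1\<close> serves the case where \<open>w\<close> has norm 0, since
      \<open>L\<close> must be positive.\<close>
    from this[of "cnorm A w"] this[of 1] show ?thesis
      using eq cnorm_nonneg[OF w(1)] by (cases "cnorm A w = 0") (auto simp: less_le)
  qed
  assume "\<not> cnorm A x \<le> 1"
  then have "(cnorm A x)\<^sup>2 > 1"
    by (simp add: one_less_power)
  moreover have "y \<otimes> y \<oplus> x \<otimes> x = \<one>"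
    using sum x y by (simp add: A_comm)
  ultimately show False
    using square[OF x y sum] square[OF y x] by linarith
qed

text \<open>\<open>p(x\<^sup>2)\<close> is the value at \<open>x\<close> of the polynomial
  \<open>p(t\<^sup>2)\<close>, and \<open>x\<close> has norm at most 1; so only the values of
  \<open>p\<close> on \<open>[0, 1]\<close> matter.\<close>

theorem cnorm_peval_square_le:
  assumes x: "x \<in> carrier A" "star A x = x" and y: "y \<in> carrier A" "star A y = y"
    and sum: "x \<otimes> x \<oplus> y \<otimes> y = \<one>"
    and B: "\<And>t::real. 0 \<le> t \<Longrightarrow> t \<le> 1 \<Longrightarrow> cmod (poly p (of_real t)) \<le> B"
  shows "cnorm A (peval (x \<otimes> x) p) \<le> B"
proof -
  have "peval (x \<otimes> x) p = peval x (pcompose p [:0, 0, 1:])"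
    using x by (simp add: peval_pcompose)
  moreover have "cnorm A (peval x (pcompose p [:0, 0, 1:])) \<le> B"
  proof (rule cnorm_peval_le[OF x cnorm_le_1_if_sum_squares[OF x y sum]])
    fix t :: real assume "\<bar>t\<bar> \<le> 1"
    then have "t * t \<le> 1"
      using abs_square_le_1[of t] by (simp add: power2_eq_square)
    then show "cmod (poly (pcompose p [:0, 0, 1:]) (of_real t)) \<le> B"
      using B[of "t * t"] by (simp add: poly_pcompose)
  qed simp
  ultimately show ?thesis
    by simp
qed

end

section \<open>Continuous functional calculus and laws on the unit interval\<close>

definition poly_close :: "complex poly \<Rightarrow> (real \<Rightarrow> complex) \<Rightarrow> real \<Rightarrow> bool" where
  "poly_close p f e \<longleftrightarrow> (\<forall>t\<in>{0..1}. cmod (poly p (of_real t) - f t) \<le> e)"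

lemma poly_close_exists_real:
  fixes f :: "real \<Rightarrow> real"
  assumes "continuous_on UNIV f" "0 < e"
  shows "\<exists>p. poly_close p (\<lambda>t. of_real (f t)) e"
proof -
  have "continuous_on {0..1} f"
    using assms continuous_on_subset by blast
  then obtain g where g: "real_polynomial_function g" "\<And>t. t \<in> {0..1} \<Longrightarrow> \<bar>f t - g t\<bar> < e"
    using Stone_Weierstrass_real_polynomial_function[OF compact_Icc _ \<open>0 < e\<close>] by blast
  then obtain a n where a: "g = (\<lambda>x. \<Sum>i\<le>n. a i * x ^ i)"
    unfolding real_polynomial_function_iff_sum by blast
  have "poly (\<Sum>i\<le>n. monom (of_real (a i)) i) (of_real t) = complex_of_real (g t)" for t
    by (simp add: a poly_sum poly_monom)
  then have "poly_close (\<Sum>i\<le>n. monom (of_real (a i)) i) (\<lambda>t. of_real (f t)) e"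
    unfolding poly_close_def using g(2)
    by (auto simp flip: of_real_diff simp: abs_minus_commute less_imp_le)
  then show ?thesis
    by blast
qed

lemma poly_close_add:
  assumes "poly_close p f d" "poly_close q g e"
  shows "poly_close (p + q) (\<lambda>t. f t + g t) (d + e)"
  unfolding poly_close_def
proof
  fix t :: real assume "t \<in> {0..1}"
  then have "cmod (poly p (of_real t) - f t) \<le> d" "cmod (poly q (of_real t) - g t) \<le> e"
    using assms by (auto simp: poly_close_def)
  then show "cmod (poly (p + q) (of_real t) - (f t + g t)) \<le> d + e"
    using norm_triangle_mono by (fastforce simp: add_diff_add)
qed

lemma poly_close_smult:
  assumes "poly_close p f e"
  shows "poly_close (Polynomial.smult c p) (\<lambda>t. c * f t) (cmod c * e)"
  using assms unfolding poly_close_def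
  by (auto simp: norm_mult mult_left_mono simp flip: right_diff_distrib)

lemma poly_close_exists:
  assumes f: "continuous_on UNIV f" "0 < e"
  shows "\<exists>p. poly_close p f e"
proof -
  have "continuous_on UNIV (\<lambda>t. Re (f t))" "continuous_on UNIV (\<lambda>t. Im (f t))"
    using f by (auto intro!: continuous_intros)
  then obtain p q where "poly_close p (\<lambda>t. of_real (Re (f t))) (e / 2)"
      "poly_close q (\<lambda>t. of_real (Im (f t))) (e / 2)"
    using poly_close_exists_real[of _ "e / 2"] f by fastforce
  then have "poly_close (p + Polynomial.smult \<i> q)
      (\<lambda>t. of_real (Re (f t)) + \<i> * of_real (Im (f t))) (e / 2 + cmod \<i> * (e / 2))"
    by (intro poly_close_add poly_close_smult)
  then show ?thesis
    by (auto simp flip: complex_eq)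
qed

lemma poly_close_diff:
  assumes "poly_close p f d" "poly_close q f e" "t \<in> {0..1}"
  shows "cmod (poly (p - q) (of_real t)) \<le> d + e"
proof -
  have "poly (p - q) (of_real t) = (poly p (of_real t) - f t) - (poly q (of_real t) - f t)"
    by simp
  also have "cmod \<dots> \<le> cmod (poly p (of_real t) - f t) + cmod (poly q (of_real t) - f t)"
    by (rule norm_triangle_ineq4)
  finally show ?thesis
    using assms unfolding poly_close_def by (meson add_mono order_trans)
qed

text \<open>Write \<open>p q - f g = p (q - g) + (p - f) g\<close>; as \<open>e \<le> 1\<close>, the
  factor \<open>p\<close> is bounded by \<open>M + 1\<close>.\<close>

lemma poly_close_mult:
  assumes p: "poly_close p f e" and q: "poly_close q g e" and e: "0 \<le> e" "e \<le> 1"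
    and f: "\<And>t. t \<in> {0..1} \<Longrightarrow> cmod (f t) \<le> M" and g: "\<And>t. t \<in> {0..1} \<Longrightarrow> cmod (g t) \<le> M"
  shows "poly_close (p * q) (\<lambda>t. f t * g t) ((2 * M + 1) * e)"
  unfolding poly_close_def
proof
  fix t :: real assume t: "t \<in> {0..1}"
  let ?p = "poly p (of_real t)" and ?q = "poly q (of_real t)"
  have pf: "cmod (?p - f t) \<le> e" and qg: "cmod (?q - g t) \<le> e"
    using p q t by (auto simp: poly_close_def)
  have "cmod ?p \<le> cmod (?p - f t) + cmod (f t)"
    using norm_triangle_sub[of ?p "f t"] by simp
  then have P: "cmod ?p \<le> M + 1"
    using pf f[OF t] e by linarith
  have "0 \<le> M"
    using f[OF t] norm_ge_zero order_trans by blast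
  have "?p * ?q - f t * g t = ?p * (?q - g t) + (?p - f t) * g t"
    by (simp add: algebra_simps)
  also have "cmod \<dots> \<le> cmod ?p * cmod (?q - g t) + cmod (?p - f t) * cmod (g t)"
    by (metis norm_triangle_ineq norm_mult)
  also have "\<dots> \<le> (M + 1) * e + e * M"
    using P pf qg g[OF t] e \<open>0 \<le> M\<close> by (intro add_mono mult_mono) auto
  finally show "cmod (poly (p * q) (of_real t) - f t * g t) \<le> (2 * M + 1) * e"
    by (simp add: algebra_simps)
qed

lemma continuous_bounded_Icc:
  fixes f :: "real \<Rightarrow> complex"
  assumes "continuous_on UNIV f"
  obtains M where "\<And>t. t \<in> {0..1} \<Longrightarrow> cmod (f t) \<le> M"
proof -
  have "compact (f ` {0..1})"
    using assms continuous_on_subset by (intro compact_continuous_image) auto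
  then show ?thesis
    using that by (metis bounded_iff compact_imp_bounded imageI)
qed

text \<open>The norm estimate for polynomials takes the place of the inclusion of the spectrum of
  \<open>a\<close> in the unit interval.\<close>

locale unit_interval_element = cstar_algebra +
  fixes a :: 'a
  assumes a_closed' [simp]: "a \<in> carrier A"
    and a_star: "star A a = a"
    and cnorm_peval_a:
      "(\<And>t::real. 0 \<le> t \<Longrightarrow> t \<le> 1 \<Longrightarrow> cmod (poly p (of_real t)) \<le> B) \<Longrightarrow> cnorm A (peval a p) \<le> B"
begin

text \<open>Describing the value by its distances from all approximating polynomials avoids the
  choice of an approximating sequence and shows at once that only \<open>f\<close> on
  \<open>[0, 1]\<close> matters.\<close>

definition calc :: "(real \<Rightarrow> complex) \<Rightarrow> 'a" where
  "calc f = (THE z. z \<in> carrier A \<and> (\<forall>p e. poly_close p f e \<longrightarrow> cnorm A (peval a p \<ominus> z) \<le> e))"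

lemma eq_if_cnorm_le:
  assumes "x \<in> carrier A" "y \<in> carrier A" and "\<And>e. 0 < e \<Longrightarrow> e \<le> 1 \<Longrightarrow> cnorm A (x \<ominus> y) \<le> C * e"
  shows "x = y"
proof -
  have "cnorm A (x \<ominus> y) \<le> 0"
  proof (rule ccontr)
    assume *: "\<not> cnorm A (x \<ominus> y) \<le> 0"
    \<comment> \<open>\<open>\<bar>C\<bar> + 1\<close> is positive for every real \<open>C\<close>,
      and the choice makes \<open>C * e\<close> at most half of the norm.\<close>
    define e where "e = min 1 (cnorm A (x \<ominus> y) / (2 * (\<bar>C\<bar> + 1)))"
    have e: "0 < e" "e \<le> 1" "e \<le> cnorm A (x \<ominus> y) / (2 * (\<bar>C\<bar> + 1))"
      using * by (auto simp: e_def)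
    have "C * e \<le> (\<bar>C\<bar> + 1) * e"
      using e by (intro mult_right_mono) auto
    also have "\<dots> \<le> cnorm A (x \<ominus> y) / 2"
      using e(3) by (simp add: field_simps)
    finally show False
      using assms(3)[OF e(1,2)] * by simp
  qed
  then have "x \<ominus> y = \<zero>"
    using assms cnorm_eq_0[of "x \<ominus> y"] cnorm_nonneg[of "x \<ominus> y"] by simp
  then have "x \<oplus> \<ominus> y = y \<oplus> \<ominus> y"
    using assms by (simp add: a_minus_def A_neg)
  then show ?thesis
    using assms abelian_group.a_inv_closed[OF ring.is_abelian_group[OF ring_A]]
    by (metis A_comm A_neg(3))
qed

lemma cnorm_peval_diff:
  assumes "poly_close p f d" "poly_close q f e"
  shows "cnorm A (peval a p \<ominus> peval a q) \<le> d + e"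
  using cnorm_peval_a[of "p - q" "d + e"] poly_close_diff[OF assms] by (simp add: peval_diff)

lemma calc_exists:
  assumes "continuous_on UNIV f"
  shows "\<exists>z \<in> carrier A. \<forall>p e. poly_close p f e \<longrightarrow> cnorm A (peval a p \<ominus> z) \<le> e"
proof -
  have "\<exists>p. poly_close p f (inverse (real (Suc n)))" for n
    using poly_close_exists[OF assms, of "inverse (real (Suc n))"] by simp
  then obtain P where P: "\<And>n. poly_close (P n) f (inverse (real (Suc n)))"
    by metis
  define X where "X n = peval a (P n)" for n
  have dist: "cnorm A (X m \<ominus> X n) \<le> inverse (real (Suc m)) + inverse (real (Suc n))" for m n
    unfolding X_def by (rule cnorm_peval_diff[OF P P])
  have "\<exists>x \<in> carrier A. (\<lambda>n. cnorm A (X n \<ominus> x)) \<longlonglongrightarrow> 0"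
  proof (rule complete)
    show "\<forall>e>0. \<exists>N. \<forall>m\<ge>N. \<forall>n\<ge>N. cnorm A (X m \<ominus> X n) < e"
    proof (intro allI impI)
      fix e :: real assume "0 < e"
      then obtain N where N: "inverse (real (Suc N)) < e / 2"
        using reals_Archimedean[of "e / 2"] by auto
      have "inverse (real (Suc m)) < e / 2" if "m \<ge> N" for m
        using that by (intro le_less_trans[OF _ N]) (simp add: field_simps)
      then show "\<exists>N. \<forall>m\<ge>N. \<forall>n\<ge>N. cnorm A (X m \<ominus> X n) < e"
        using dist by (intro exI[of _ N]) (smt (verit) field_sum_of_halves)
    qed
  qed (simp add: X_def)
  then obtain z where z: "z \<in> carrier A" "(\<lambda>n. cnorm A (X n \<ominus> z)) \<longlonglongrightarrow> 0"
    by blast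
  have "cnorm A (peval a p \<ominus> z) \<le> e" if p: "poly_close p f e" for p e
  proof -
    \<comment> \<open>Pass through \<open>X n\<close> and let \<open>n\<close> tend to infinity; the
      closed inequality keeps the exact bound \<open>e\<close>.\<close>
    have "cnorm A (peval a p \<ominus> z) \<le> e + inverse (real (Suc n)) + cnorm A (X n \<ominus> z)" for n
      using cnorm_dist_triangle[of "peval a p" "X n" z] cnorm_peval_diff[OF p P, of n] z
      by (simp add: X_def)
    moreover have "(\<lambda>n. e + inverse (real (Suc n)) + cnorm A (X n \<ominus> z)) \<longlonglongrightarrow> e + 0 + 0"
      by (intro tendsto_intros LIMSEQ_inverse_real_of_nat z)
    ultimately show ?thesis
      by (intro LIMSEQ_le_const[where a = "cnorm A (peval a p \<ominus> z)"]) auto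
  qed
  then show ?thesis
    using z by blast
qed

text \<open>For \<open>z'\<close> a single approximating polynomial per tolerance is enough, and the
  tolerance may carry a constant factor. This reduces each algebraic law of the calculus to
  exhibiting one polynomial.\<close>

lemma calc_unique:
  assumes f: "continuous_on UNIV f" and z: "z \<in> carrier A" "z' \<in> carrier A"
    and "\<And>p e. poly_close p f e \<Longrightarrow> cnorm A (peval a p \<ominus> z) \<le> e"
    and C: "\<And>e. 0 < e \<Longrightarrow> e \<le> 1 \<Longrightarrow> \<exists>p. poly_close p f (C * e) \<and> cnorm A (peval a p \<ominus> z') \<le> C * e"
  shows "z = z'"
proof (rule eq_if_cnorm_le[OF z])
  fix e :: real assume "0 < e" "e \<le> 1"
  then obtain p where p: "poly_close p f (C * e)" "cnorm A (peval a p \<ominus> z') \<le> C * e"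
    using C by blast
  then show "cnorm A (z \<ominus> z') \<le> (2 * C) * e"
    using assms(4)[OF p(1)] cnorm_dist_triangle[of z "peval a p" z'] z
      cnorm_minus_commute[of z "peval a p"] by simp
qed

lemma calc_props:
  assumes "continuous_on UNIV f"
  shows calc_closed: "calc f \<in> carrier A"
    and cnorm_calc: "poly_close p f e \<Longrightarrow> cnorm A (peval a p \<ominus> calc f) \<le> e"
proof -
  have "\<exists>!z. z \<in> carrier A \<and> (\<forall>p e. poly_close p f e \<longrightarrow> cnorm A (peval a p \<ominus> z) \<le> e)"
  proof (rule ex_ex1I)
    fix z z'
    assume z: "z \<in> carrier A \<and> (\<forall>p e. poly_close p f e \<longrightarrow> cnorm A (peval a p \<ominus> z) \<le> e)"
      and z': "z' \<in> carrier A \<and> (\<forall>p e. poly_close p f e \<longrightarrow> cnorm A (peval a p \<ominus> z') \<le> e)"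
    show "z = z'"
    proof (rule calc_unique[OF assms, of _ _ 1])
      fix e :: real assume "0 < e"
      then obtain p where "poly_close p f e"
        using poly_close_exists[OF assms] by blast
      then show "\<exists>p. poly_close p f (1 * e) \<and> cnorm A (peval a p \<ominus> z') \<le> 1 * e"
        using z' by auto
    qed (use z z' in auto)
  qed (use calc_exists[OF assms] in blast)
  from theI'[OF this] show "calc f \<in> carrier A" "poly_close p f e \<Longrightarrow> cnorm A (peval a p \<ominus> calc f) \<le> e"
    unfolding calc_def by blast+
qed

lemma calc_eqI:
  assumes "continuous_on UNIV f" "z \<in> carrier A"
    and "\<And>e. 0 < e \<Longrightarrow> e \<le> 1 \<Longrightarrow> \<exists>p. poly_close p f (C * e) \<and> cnorm A (peval a p \<ominus> z) \<le> C * e"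
  shows "calc f = z"
  by (rule calc_unique[OF assms(1) calc_closed[OF assms(1)] assms(2) cnorm_calc[OF assms(1)] assms(3)])

lemma calc_poly: "calc (\<lambda>t. poly p (of_real t)) = peval a p"
proof (rule calc_eqI[of _ _ 1])
  show "\<exists>q. poly_close q (\<lambda>t. poly p (of_real t)) (1 * e) \<and> cnorm A (peval a q \<ominus> peval a p) \<le> 1 * e"
    if "0 < e" for e
    using that by (intro exI[of _ p]) (auto simp: poly_close_def a_minus_def A_neg)
qed (auto intro!: continuous_intros)

lemma calc_cong:
  assumes "\<And>t. t \<in> {0..1} \<Longrightarrow> f t = g t"
  shows "calc f = calc g"
proof -
  have "poly_close p f e = poly_close p g e" for p e
    using assms by (auto simp: poly_close_def)
  then show ?thesis
    by (simp add: calc_def)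
qed

lemma calc_add:
  assumes f: "continuous_on UNIV f" and g: "continuous_on UNIV g"
  shows "calc (\<lambda>x. f x + g x) = calc f \<oplus> calc g"
proof (rule calc_eqI[of _ _ 2])
  fix e :: real assume "0 < e"
  then obtain p q where p: "poly_close p f e" and q: "poly_close q g e"
    using poly_close_exists f g by metis
  have [simp]: "calc f \<in> carrier A" "calc g \<in> carrier A"
    using calc_closed f g by auto
  have "peval a (p + q) \<ominus> (calc f \<oplus> calc g) = (peval a p \<ominus> calc f) \<oplus> (peval a q \<ominus> calc g)"
    by (simp add: peval_add a_minus_def A_ac A_ring(19))
  then have "cnorm A (peval a (p + q) \<ominus> (calc f \<oplus> calc g)) \<le> e + e"
    using cnorm_triangle[of "peval a p \<ominus> calc f" "peval a q \<ominus> calc g"]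
      cnorm_calc[OF f p] cnorm_calc[OF g q] by simp
  then show "\<exists>p. poly_close p (\<lambda>x. f x + g x) (2 * e) \<and> cnorm A (peval a p \<ominus> (calc f \<oplus> calc g)) \<le> 2 * e"
    using poly_close_add[OF p q] by (intro exI[of _ "p + q"]) simp
qed (use f g calc_closed in \<open>auto intro!: continuous_intros\<close>)

lemma calc_scale:
  assumes f: "continuous_on UNIV f"
  shows "calc (\<lambda>x. c * f x) = c \<odot> calc f"
proof (rule calc_eqI[of _ _ "cmod c"])
  fix e :: real assume "0 < e"
  then obtain p where p: "poly_close p f e"
    using poly_close_exists f by metis
  have [simp]: "calc f \<in> carrier A"
    using calc_closed f by auto
  have "peval a (Polynomial.smult c p) \<ominus> c \<odot> calc f = c \<odot> (peval a p \<ominus> calc f)"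
    by (simp add: peval_smult a_minus_def uminus_conv_scale scale_add_right scale_scale)
  then have "cnorm A (peval a (Polynomial.smult c p) \<ominus> c \<odot> calc f) \<le> cmod c * e"
    using cnorm_calc[OF f p] by (simp add: cnorm_smult mult_left_mono)
  then show "\<exists>p. poly_close p (\<lambda>x. c * f x) (cmod c * e) \<and> cnorm A (peval a p \<ominus> c \<odot> calc f) \<le> cmod c * e"
    using poly_close_smult[OF p] by blast
qed (use f calc_closed in \<open>auto intro!: continuous_intros\<close>)

lemma calc_cnj:
  assumes f: "continuous_on UNIV f"
  shows "calc (\<lambda>x. cnj (f x)) = star A (calc f)"
proof (rule calc_eqI[of _ _ 1])
  fix e :: real assume "0 < e"
  then obtain p where p: "poly_close p f e"
    using poly_close_exists f by metis
  have [simp]: "calc f \<in> carrier A"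
    using calc_closed f by auto
  have "poly_close (pcnj p) (\<lambda>x. cnj (f x)) e"
    using p by (auto simp: poly_close_def simp flip: complex_cnj_diff)
  moreover have "peval a (pcnj p) \<ominus> star A (calc f) = star A (peval a p \<ominus> calc f)"
    by (simp add: peval_pcnj a_star star_add a_minus_def uminus_conv_scale star_smult star_closed)
  then have "cnorm A (peval a (pcnj p) \<ominus> star A (calc f)) \<le> e"
    using cnorm_calc[OF f p] by simp
  ultimately show "\<exists>p. poly_close p (\<lambda>x. cnj (f x)) (1 * e) \<and> cnorm A (peval a p \<ominus> star A (calc f)) \<le> 1 * e"
    by auto
qed (use f calc_closed star_closed in \<open>auto intro!: continuous_intros\<close>)

lemma calc_mult:
  assumes f: "continuous_on UNIV f" and g: "continuous_on UNIV g"
  shows "calc (\<lambda>x. f x * g x) = calc f \<otimes> calc g"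
proof -
  obtain M1 M2 where "\<And>t. t \<in> {0..1} \<Longrightarrow> cmod (f t) \<le> M1" "\<And>t. t \<in> {0..1} \<Longrightarrow> cmod (g t) \<le> M2"
    using continuous_bounded_Icc f g by meson
  then obtain M where M: "\<And>t. t \<in> {0..1} \<Longrightarrow> cmod (f t) \<le> M" "\<And>t. t \<in> {0..1} \<Longrightarrow> cmod (g t) \<le> M"
    by (metis (no_types, lifting) max.coboundedI1 max.coboundedI2)
  have "0 \<le> M"
    using M(1)[of 0] order_trans[OF norm_ge_zero] by simp
  have [simp]: "calc f \<in> carrier A" "calc g \<in> carrier A"
    using calc_closed f g by auto
  \<comment> \<open>\<open>C\<close> covers both the rate of approximation in
    \<open>poly_close_mult\<close> and the norm estimate derived below.\<close>
  define C where "C = max (2 * M + 1) ((M + 1) + cnorm A (calc g))"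
  show ?thesis
  proof (rule calc_eqI[of _ _ C])
    fix e :: real assume e: "0 < e" "e \<le> 1"
    then obtain p q where p: "poly_close p f e" and q: "poly_close q g e"
      using poly_close_exists f g by metis
    have "poly_close (p * q) (\<lambda>x. f x * g x) ((2 * M + 1) * e)"
      using e M by (intro poly_close_mult p q) auto
    moreover have "(2 * M + 1) * e \<le> C * e"
      using e by (intro mult_right_mono) (auto simp: C_def)
    ultimately have 1: "poly_close (p * q) (\<lambda>x. f x * g x) (C * e)"
      unfolding poly_close_def by (meson order_trans)
    have "cnorm A (peval a p) \<le> M + 1"
    proof (rule cnorm_peval_a)
      fix t :: real assume "0 \<le> t" "t \<le> 1"
      then show "cmod (poly p (of_real t)) \<le> M + 1"
        using p M(1)[of t] e norm_triangle_sub[of "poly p (of_real t)" "f t"]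
        by (force simp: poly_close_def)
    qed
    moreover have "peval a (p * q) \<ominus> calc f \<otimes> calc g
        = peval a p \<otimes> (peval a q \<ominus> calc g) \<oplus> (peval a p \<ominus> calc f) \<otimes> calc g"
      by (simp add: peval_mult a_minus_def A_ring(7,9,17,18,13,23,26,27))
    then have "cnorm A (peval a (p * q) \<ominus> calc f \<otimes> calc g)
        \<le> cnorm A (peval a p) * cnorm A (peval a q \<ominus> calc g) + cnorm A (peval a p \<ominus> calc f) * cnorm A (calc g)"
      using cnorm_triangle[of "peval a p \<otimes> (peval a q \<ominus> calc g)" "(peval a p \<ominus> calc f) \<otimes> calc g"]
        cnorm_mult[of "peval a p" "peval a q \<ominus> calc g"] cnorm_mult[of "peval a p \<ominus> calc f" "calc g"]
      by simp
    ultimately have "cnorm A (peval a (p * q) \<ominus> calc f \<otimes> calc g) \<le> (M + 1) * e + e * cnorm A (calc g)"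
      using cnorm_calc[OF f p] cnorm_calc[OF g q] \<open>0 \<le> M\<close> e
      by (elim order_trans) (intro add_mono mult_mono cnorm_nonneg, auto)
    also have "\<dots> = ((M + 1) + cnorm A (calc g)) * e"
      by (simp add: algebra_simps)
    also have "\<dots> \<le> C * e"
      using e by (intro mult_right_mono) (auto simp: C_def)
    finally show "\<exists>p. poly_close p (\<lambda>x. f x * g x) (C * e)
        \<and> cnorm A (peval a p \<ominus> calc f \<otimes> calc g) \<le> C * e"
      using 1 by blast
  qed (use f g in \<open>auto intro!: continuous_intros\<close>)
qed

text \<open>\<open>calc\<close> depends only on values in \<open>[0, 1]\<close>; by the assumption,
  a function that vanishes on the spectrum vanishes there.\<close>

lemma functional_calculus_calc:
  assumes "\<And>t. t \<in> {0..1} \<Longrightarrow> complex_of_real t \<in> spectrum A a"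
  shows "functional_calculus A a calc"
proof -
  have zero: "calc f = \<zero>" if "\<forall>x. complex_of_real x \<in> spectrum A a \<longrightarrow> f x = 0" for f
    using calc_cong[of f "\<lambda>x. poly 0 (of_real x)"] calc_poly[of 0] that assms by simp
  show ?thesis
    unfolding functional_calculus_def
  proof (intro conjI allI impI; (elim conjE)?)
    show "calc (\<lambda>x. 1) = \<one>" "calc complex_of_real = a"
      using calc_poly[of 1] calc_poly[of "[:0, 1:]"] by simp_all
    show "calc f = \<zero>" if "\<forall>x. complex_of_real x \<in> spectrum A a \<longrightarrow> f x = 0" for f
      by (rule zero) fact
  qed (fact calc_closed calc_add calc_mult calc_scale calc_cnj)+
qed

section \<open>Positive forms on the functional calculus\<close>

lemma form_calc_nonneg:
  assumes h: "positive_unital_form A h" and g: "continuous_on UNIV g" "\<And>t. t \<in> {0..1} \<Longrightarrow> 0 \<le> g t"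
  shows "h (calc (\<lambda>t. of_real (g t))) \<in> nonneg_Reals"
proof -
  \<comment> \<open>A continuous real square root of \<open>g\<close> on \<open>[0, 1]\<close>; it
    exhibits the element as the star of \<open>calc s\<close> times \<open>calc s\<close>.\<close>
  define s where "s = (\<lambda>t. complex_of_real (sqrt (max 0 (g t))))"
  have s: "continuous_on UNIV s"
    unfolding s_def using g by (auto intro!: continuous_intros)
  have "calc (\<lambda>t. of_real (g t)) = calc (\<lambda>t. s t * s t)"
    by (rule calc_cong) (use g in \<open>auto simp: s_def simp flip: of_real_mult\<close>)
  also have "\<dots> = star A (calc s) \<otimes> calc s"
    using calc_cnj[OF s] unfolding calc_mult[OF s s] by (simp add: s_def)
  finally show ?thesis
    using h calc_closed[OF s] by (simp add: positive_unital_form_def)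
qed

text \<open>\<open>e + g\<close> and \<open>e - g\<close> are nonnegative on \<open>[0, 1]\<close>.
  So adding the value of \<open>h\<close> to \<open>e\<close>, or subtracting it, gives a
  nonnegative real, which forces that value to be real and between \<open>- e\<close> and
  \<open>e\<close>.\<close>

lemma form_calc_bound_real:
  assumes h: "positive_unital_form A h" and g: "continuous_on UNIV g"
    and e: "\<And>t. t \<in> {0..1} \<Longrightarrow> \<bar>g t\<bar> \<le> e"
  shows "cmod (h (calc (\<lambda>t. of_real (g t)))) \<le> e"
proof -
  have g': "continuous_on UNIV (\<lambda>t. complex_of_real (g t))"
    using g by (auto intro!: continuous_intros)
  have const: "calc (\<lambda>x. of_real e) = of_real e \<odot> \<one>"
    using calc_poly[of "[:of_real e:]"] by simp
  have h': "h (x \<oplus> y) = h x + h y" "h (c \<odot> x) = c * h x" "h \<one> = 1"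
    if "x \<in> carrier A" "y \<in> carrier A" for x y c
    using h that by (auto simp: positive_unital_form_def)
  note one = h'(3)[OF a_closed' a_closed']
  have "calc (\<lambda>t. of_real (e + s * g t)) = of_real e \<odot> \<one> \<oplus> of_real s \<odot> calc (\<lambda>t. of_real (g t))" for s :: real
    using calc_add[OF continuous_on_const[of UNIV "of_real e"] continuous_on_mult_left[OF g', of "of_real s"]]
    by (simp add: const calc_scale[OF g'])
  then have "h (calc (\<lambda>t. of_real (e + s * g t))) = of_real e + of_real s * h (calc (\<lambda>t. of_real (g t)))" for s :: real
    by (simp add: h'(1) h'(2)[OF _ a_closed'] one calc_closed[OF g'])
  moreover have "h (calc (\<lambda>t. of_real (e + s * g t))) \<in> nonneg_Reals" if "s = 1 \<or> s = - 1" for s :: real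
  proof (rule form_calc_nonneg[OF h])
    show "0 \<le> e + s * g t" if "t \<in> {0..1}" for t
      using e[OF that] \<open>s = 1 \<or> s = - 1\<close> by auto
  qed (use g in \<open>auto intro!: continuous_intros\<close>)
  ultimately have "of_real e + h (calc (\<lambda>t. of_real (g t))) \<in> nonneg_Reals"
      "of_real e - h (calc (\<lambda>t. of_real (g t))) \<in> nonneg_Reals"
    by (metis mult_1 of_real_1, metis diff_conv_add_uminus mult_minus1 of_real_1 of_real_minus)
  then show ?thesis
    by (auto simp: complex_nonneg_Reals_iff cmod_def)
qed

text \<open>Treat real and imaginary parts separately; the resulting factor 2 does not disturb the
  approximation argument that follows.\<close>

lemma form_calc_bound:
  assumes h: "positive_unital_form A h" and f: "continuous_on UNIV f"
    and e: "\<And>t. t \<in> {0..1} \<Longrightarrow> cmod (f t) \<le> e"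
  shows "cmod (h (calc f)) \<le> 2 * e"
proof -
  have Re: "continuous_on UNIV (\<lambda>t. Re (f t))" and Im: "continuous_on UNIV (\<lambda>t. Im (f t))"
    using f by (auto intro!: continuous_intros)
  have cont: "continuous_on UNIV (\<lambda>t. complex_of_real (Re (f t)))" "continuous_on UNIV (\<lambda>t. complex_of_real (Im (f t)))"
    using f by (auto intro!: continuous_intros)
  have "calc f = calc (\<lambda>t. of_real (Re (f t)) + \<i> * of_real (Im (f t)))"
    by (simp flip: complex_eq)
  also have "\<dots> = calc (\<lambda>t. of_real (Re (f t))) \<oplus> \<i> \<odot> calc (\<lambda>t. of_real (Im (f t)))"
    using cont by (simp add: calc_add calc_scale continuous_on_mult_left)
  finally have "h (calc f) = h (calc (\<lambda>t. of_real (Re (f t)))) + \<i> * h (calc (\<lambda>t. of_real (Im (f t))))"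
    using h calc_closed cont by (simp add: positive_unital_form_def)
  moreover have "cmod (h (calc (\<lambda>t. of_real (Re (f t))))) \<le> e" "cmod (h (calc (\<lambda>t. of_real (Im (f t))))) \<le> e"
    using e abs_Re_le_cmod abs_Im_le_cmod order_trans
    by (blast intro: form_calc_bound_real[OF h Re] form_calc_bound_real[OF h Im])+
  ultimately show ?thesis
    using norm_triangle_ineq[of "h (calc (\<lambda>t. of_real (Re (f t))))" "\<i> * h (calc (\<lambda>t. of_real (Im (f t))))"]
    by (simp add: norm_mult)
qed

text \<open>Both sides are bounded in the supremum norm on \<open>[0, 1]\<close> and agree on
  polynomials, which are dense.\<close>

lemma form_calc_eq_integral:
  assumes h: "positive_unital_form A h" and f: "continuous_on UNIV f"
    and moments: "\<And>p. h (peval a p) = integral {0..1} (\<lambda>t. poly p (of_real t))"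
  shows "h (calc f) = integral {0..1} f"
proof -
  have "cmod (h (calc f) - integral {0..1} f) \<le> 0 + e" if e: "0 < e" for e
  proof -
    \<comment> \<open>\<open>e / 3\<close>, because the form contributes twice the error and the
      integral once.\<close>
    obtain p where p: "poly_close p f (e / 3)"
      using poly_close_exists[OF f, of "e / 3"] e by auto
    define g where "g = (\<lambda>t. f t + (- 1) * poly p (of_real t))"
    have P: "continuous_on UNIV (\<lambda>t::real. poly p (of_real t))"
      by (intro continuous_intros)
    have g: "continuous_on UNIV g"
      unfolding g_def by (intro continuous_intros f)
    have ge: "cmod (g t) \<le> e / 3" if "t \<in> {0..1}" for t
      using p that by (auto simp: poly_close_def g_def norm_minus_commute)
    have "calc g = calc f \<oplus> (- 1) \<odot> peval a p"
      unfolding g_def by (simp only: calc_add[OF f continuous_on_mult_left[OF P]] calc_scale[OF P] calc_poly)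
    then have "h (calc g) = h (calc f) - h (peval a p)"
      using h calc_closed[OF f] by (simp add: positive_unital_form_def)
    moreover have "integral {0..1} g = integral {0..1} f - integral {0..1} (\<lambda>t. poly p (of_real t))"
      using continuous_on_subset[OF f] continuous_on_subset[OF P]
      by (simp add: g_def) (intro integral_diff integrable_continuous_interval; blast)
    moreover have "cmod (h (calc g)) \<le> 2 * (e / 3)"
      by (rule form_calc_bound[OF h g ge])
    moreover have "cmod (integral {0..1} g) \<le> e / 3 * (1 - 0)"
      using continuous_on_subset[OF g] by (intro integral_bound ge) auto
    ultimately show ?thesis
      using norm_triangle_ineq4[of "h (calc g)" "integral {0..1} g"] moments[of p] by simp
  qed
  then have "cmod (h (calc f) - integral {0..1} f) \<le> 0"
    by (rule field_le_epsilon)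
  then show ?thesis
    by simp
qed

end

lemma uniform_measure_Icc_01:
  fixes f :: "real \<Rightarrow> complex"
  assumes f: "continuous_on UNIV f"
  shows "integrable (uniform_measure lborel {0..1}) f"
    and "(\<integral>x. f x \<partial>uniform_measure lborel {0..1}) = integral {0..1} f"
proof -
  \<comment> \<open>The interval has measure 1, so its indicator function is the density.\<close>
  have eq: "uniform_measure lborel {0..1::real} = density lborel (\<lambda>x. ennreal (indicator {0..1} x))"
    by (simp add: uniform_measure_def ennreal_indicator divide_ennreal_def)
  have meas: "f \<in> borel_measurable borel"
    using f by (rule borel_measurable_continuous_onI)
  have int: "integrable lborel (\<lambda>x. indicator {0..1} x *\<^sub>R f x)"
    using continuous_on_subset[OF f] by (intro borel_integrable_compact) auto
  show "integrable (uniform_measure lborel {0..1}) f"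
    unfolding eq using meas int by (subst integrable_density) auto
  have "(\<integral>x. f x \<partial>uniform_measure lborel {0..1}) = (\<integral>x. indicator {0..1} x *\<^sub>R f x \<partial>lborel)"
    unfolding eq using meas by (subst integral_density) auto
  also have "\<dots> = integral {0..1} f"
    using set_borel_integral_eq_integral(2)[of "{0..1}" f] int
    by (simp add: set_integrable_def set_lebesgue_integral_def)
  finally show "(\<integral>x. f x \<partial>uniform_measure lborel {0..1}) = integral {0..1} f" .
qed

lemma (in unit_interval_element) has_law_uniform:
  assumes h: "positive_unital_form A h"
    and spec: "\<And>t. t \<in> {0..1} \<Longrightarrow> complex_of_real t \<in> spectrum A a"
    and moments: "\<And>p. h (peval a p) = integral {0..1} (\<lambda>t. poly p (of_real t))"
  shows "has_law A h a (uniform_measure lborel {0..1})"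
proof -
  have "prob_space (uniform_measure lborel {0..1::real})"
    by (intro prob_space_uniform_measure) auto
  then show ?thesis
    unfolding has_law_def using functional_calculus_calc[OF spec]
    by (auto simp: a_star uniform_measure_Icc_01 form_calc_eq_integral[OF h _ moments] intro!: exI[of _ calc])
qed

section \<open>The C*-algebra of two by two matrices\<close>

type_synonym cmat = "complex^2^2"

definition mscale :: "complex \<Rightarrow> cmat \<Rightarrow> cmat" where
  "mscale c X = (\<chi> i j. c * X $ i $ j)"

definition madj :: "cmat \<Rightarrow> cmat" where
  "madj X = (\<chi> i j. cnj (X $ j $ i))"

text \<open>\<open>onorm\<close> refers to the real structure of \<open>complex^2\<close>, but it
  involves only Euclidean norms of vectors and so is the usual operator norm.\<close>

definition mnorm :: "cmat \<Rightarrow> real" where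
  "mnorm X = onorm ((*v) X)"

lemma matrix_eq_iff: "X = Y \<longleftrightarrow> (\<forall>i j. X $ i $ j = (Y :: cmat) $ i $ j)"
  by (simp add: vec_eq_iff)

lemmas cmat_simps = matrix_eq_iff forall_2 mscale_def madj_def matrix_matrix_mult_def sum_2 mat_def

lemma cmat_algebra:
  "(X + Y) ** Z = X ** Z + Y ** Z" "Z ** (X + Y) = Z ** X + Z ** Y"
  "mscale (a + b) X = mscale a X + mscale b X" "mscale a (X + Y) = mscale a X + mscale a Y"
  "mscale (a * b) X = mscale a (mscale b X)" "mscale 1 X = X"
  "mscale a X ** Y = mscale a (X ** Y)" "X ** mscale a Y = mscale a (X ** Y)"
  "madj (X + Y) = madj X + madj Y" "madj (mscale a X) = mscale (cnj a) (madj X)"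
  "madj (X ** Y) = madj Y ** madj X" "madj (madj X) = X"
  for X Y Z :: cmat
  by (simp_all add: cmat_simps algebra_simps)

lemma bounded_linear_cmat: "bounded_linear ((*v) (X :: cmat))"
  unfolding linear_conv_bounded_linear[symmetric]
  by (rule linearI)
    (auto simp: vec_eq_iff matrix_vector_mult_def sum_2 forall_2 algebra_simps)

lemma norm_cmat_vector: "norm (X *v v) \<le> mnorm X * norm v"
  unfolding mnorm_def by (rule onorm[OF bounded_linear_cmat])

lemma mnorm_le: "0 \<le> b \<Longrightarrow> (\<And>v. norm (X *v v) \<le> b * norm v) \<Longrightarrow> mnorm X \<le> b"
  unfolding mnorm_def by (rule onorm_bound)

lemma mnorm_nonneg: "0 \<le> mnorm X"
  unfolding mnorm_def by (rule onorm_pos_le[OF bounded_linear_cmat])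

lemma mscale_vector: "mscale c X *v v = c *s (X *v v)"
  by (simp add: vec_eq_iff matrix_vector_mult_def mscale_def sum_2 forall_2 algebra_simps)

lemma norm_vector_scale: "norm (c *s (v :: complex^2)) = cmod c * norm v"
  by (simp add: norm_vec_def L2_set_def sum_2 norm_mult power_mult_distrib real_sqrt_mult flip: distrib_left)

lemma mnorm_scale: "mnorm (mscale c X) = cmod c * mnorm X"
proof -
  have le: "mnorm (mscale c X) \<le> cmod c * mnorm X" for c X
    by (rule mnorm_le)
      (auto simp: mnorm_nonneg mscale_vector norm_vector_scale mult.assoc intro!: mult_left_mono norm_cmat_vector)
  show ?thesis
  proof (cases "c = 0")
    case False
    have "mscale (1 / c) (mscale c X) = X"
      using False by (simp add: cmat_simps)
    then have "mnorm X \<le> mnorm (mscale c X) / cmod c"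
      using le[of "1 / c" "mscale c X"] by (simp add: norm_divide)
    then show ?thesis
      using False le[of c X] by (simp add: field_simps)
  qed (use le[of 0 X] mnorm_nonneg[of "mscale 0 X"] in auto)
qed

lemma mnorm_add: "mnorm (X + Y) \<le> mnorm X + mnorm Y"
proof (rule mnorm_le)
  fix v :: "complex^2"
  have "norm ((X + Y) *v v) \<le> norm (X *v v) + norm (Y *v v)"
    by (metis matrix_vector_mult_add_rdistrib norm_triangle_ineq)
  then show "norm ((X + Y) *v v) \<le> (mnorm X + mnorm Y) * norm v"
    using norm_cmat_vector[of X v] norm_cmat_vector[of Y v] by (simp add: distrib_right)
qed (simp add: mnorm_nonneg)

lemma mnorm_mult: "mnorm (X ** Y) \<le> mnorm X * mnorm Y"
proof (rule mnorm_le)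
  fix v :: "complex^2"
  have "norm ((X ** Y) *v v) \<le> mnorm X * norm (Y *v v)"
    by (metis matrix_vector_mul_assoc norm_cmat_vector)
  also have "\<dots> \<le> mnorm X * (mnorm Y * norm v)"
    by (intro mult_left_mono norm_cmat_vector mnorm_nonneg)
  finally show "norm ((X ** Y) *v v) \<le> mnorm X * mnorm Y * norm v"
    by (simp add: mult.assoc)
qed (simp add: mnorm_nonneg)

text \<open>The inner product on \<open>complex^2\<close> is the real part of the Hermitian one, for
  which \<open>madj X\<close> is the adjoint.\<close>

lemma inner_madj: "(X *v v) \<bullet> w = v \<bullet> (madj X *v w)"
  by (simp add: inner_vec_def matrix_vector_mult_def sum_2 madj_def inner_complex_def algebra_simps)

text \<open>By \<open>inner_madj\<close> and Cauchy-Schwarz the left side is at least the right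
  side. This inequality also shows that \<open>madj X\<close> and \<open>X\<close> have equal norms,
  and submultiplicativity then gives the converse.\<close>

lemma mnorm_cstar: "mnorm (madj X ** X) = (mnorm X)\<^sup>2"
proof -
  have sq: "(mnorm X)\<^sup>2 \<le> mnorm (madj X ** X)" for X
  proof -
    have "mnorm X \<le> sqrt (mnorm (madj X ** X))"
    proof (rule mnorm_le)
      fix v :: "complex^2"
      have "(norm (X *v v))\<^sup>2 = v \<bullet> ((madj X ** X) *v v)"
        by (metis power2_norm_eq_inner inner_madj matrix_vector_mul_assoc)
      also have "\<dots> \<le> norm v * norm ((madj X ** X) *v v)"
        by (rule norm_cauchy_schwarz)
      also have "\<dots> \<le> norm v * (mnorm (madj X ** X) * norm v)"
        by (intro mult_left_mono norm_cmat_vector norm_ge_zero)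
      also have "\<dots> = (sqrt (mnorm (madj X ** X)) * norm v)\<^sup>2"
        by (simp add: power_mult_distrib mnorm_nonneg power2_eq_square algebra_simps)
      finally show "norm (X *v v) \<le> sqrt (mnorm (madj X ** X)) * norm v"
        by (rule power2_le_imp_le) (simp add: mnorm_nonneg)
    qed (simp add: mnorm_nonneg)
    from power_mono[OF this mnorm_nonneg, of 2] show ?thesis
      by (simp add: mnorm_nonneg)
  qed
  have le: "mnorm X \<le> mnorm (madj X)" for X
  proof (cases "mnorm X = 0")
    case False
    have "mnorm X * mnorm X \<le> mnorm (madj X) * mnorm X"
      using sq[of X] mnorm_mult[of "madj X" X] by (simp add: power2_eq_square)
    then show ?thesis
      using False mnorm_nonneg[of X] by simp
  qed (simp add: mnorm_nonneg)
  have "mnorm (madj X) = mnorm X"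
    using le[of X] le[of "madj X"] by (simp add: cmat_algebra)
  then show ?thesis
    using sq[of X] mnorm_mult[of "madj X" X] by (simp add: power2_eq_square)
qed

lemma cmod_entry_le: "cmod (X $ i $ j) \<le> mnorm X"
proof -
  have "X $ i $ j = (X *v axis j 1) $ i"
    by (simp add: matrix_vector_mult_def axis_def if_distrib cong: if_cong)
  then show ?thesis
    using Finite_Cartesian_Product.norm_nth_le[of "X *v axis j 1" i] norm_cmat_vector[of X "axis j 1"] by (simp add: norm_axis_1)
qed

lemma mnorm_le_sum: "mnorm X \<le> (\<Sum>i\<in>UNIV. \<Sum>j\<in>UNIV. cmod (X $ i $ j))"
proof (rule mnorm_le)
  fix v :: "complex^2"
  have "norm (X *v v) \<le> (\<Sum>i\<in>UNIV. cmod ((X *v v) $ i))"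
    unfolding norm_vec_def by (intro L2_set_le_sum) auto
  also have "\<dots> \<le> (\<Sum>i\<in>UNIV. \<Sum>j\<in>UNIV. cmod (X $ i $ j) * norm v)"
  proof (rule sum_mono)
    fix i :: 2
    have "cmod ((X *v v) $ i) \<le> (\<Sum>j\<in>UNIV. cmod (X $ i $ j * v $ j))"
      unfolding matrix_vector_mult_def by (simp add: sum_norm_le norm_sum)
    also have "\<dots> \<le> (\<Sum>j\<in>UNIV. cmod (X $ i $ j) * norm v)"
      by (intro sum_mono) (simp add: norm_mult mult_left_mono Finite_Cartesian_Product.norm_nth_le)
    finally show "cmod ((X *v v) $ i) \<le> (\<Sum>j\<in>UNIV. cmod (X $ i $ j) * norm v)" .
  qed
  finally show "norm (X *v v) \<le> (\<Sum>i\<in>UNIV. \<Sum>j\<in>UNIV. cmod (X $ i $ j)) * norm v"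
    by (simp add: sum_distrib_right)
qed (simp add: sum_nonneg)

lemma mnorm_eq_0: "mnorm X = 0 \<longleftrightarrow> X = 0"
proof
  assume "mnorm X = 0"
  then show "X = 0"
    using cmod_entry_le[of X] by (simp add: matrix_eq_iff)
next
  assume "X = 0"
  then show "mnorm X = 0"
    using mnorm_le_sum[of X] mnorm_nonneg[of X] by simp
qed

text \<open>Entries are bounded by the norm, and the norm by the sum of the moduli of the entries,
  so the limit can be taken entrywise.\<close>

lemma mnorm_complete:
  assumes "\<forall>e>0. \<exists>N. \<forall>m\<ge>N. \<forall>n\<ge>N. mnorm (X m - X n) < e"
  shows "\<exists>Y. (\<lambda>n. mnorm (X n - Y)) \<longlonglongrightarrow> 0"
proof -
  have "Cauchy (\<lambda>n. X n $ i $ j)" for i j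
  proof (rule CauchyI)
    fix e :: real assume "0 < e"
    then obtain N where N: "\<forall>m\<ge>N. \<forall>n\<ge>N. mnorm (X m - X n) < e"
      using assms by blast
    have "cmod (X m $ i $ j - X n $ i $ j) < e" if "m \<ge> N" "n \<ge> N" for m n
      using cmod_entry_le[of "X m - X n" i j, unfolded vector_minus_component] N that le_less_trans by blast
    then show "\<exists>N. \<forall>m\<ge>N. \<forall>n\<ge>N. cmod (X m $ i $ j - X n $ i $ j) < e"
      by blast
  qed
  then have "\<exists>y. (\<lambda>n. X n $ i $ j) \<longlonglongrightarrow> y" for i j
    using Cauchy_convergent convergent_def by blast
  then obtain y where y: "\<And>i j. (\<lambda>n. X n $ i $ j) \<longlonglongrightarrow> y i j"
    by metis
  define Y :: cmat where "Y = (\<chi> i j. y i j)"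
  have "(\<lambda>n. \<Sum>i\<in>UNIV. \<Sum>j\<in>UNIV. cmod ((X n - Y) $ i $ j)) \<longlonglongrightarrow> 0"
    unfolding Y_def using y by (auto intro!: tendsto_null_sum tendsto_norm_zero LIM_zero)
  then have "(\<lambda>n. mnorm (X n - Y)) \<longlonglongrightarrow> 0"
    by (rule tendsto_sandwich[OF _ _ tendsto_const, rotated 2])
      (intro always_eventually allI mnorm_nonneg mnorm_le_sum)+
  then show ?thesis
    by blast
qed

section \<open>Transport of the matrix algebra into a given type\<close>

definition matrix_cstar :: "(cmat \<Rightarrow> 'a) \<Rightarrow> 'a cstar" where
  "matrix_cstar \<iota> = \<lparr>carrier = range \<iota>, monoid.mult = (\<lambda>x y. \<iota> (inv_into UNIV \<iota> x ** inv_into UNIV \<iota> y)), one = \<iota> (mat 1),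
     zero = \<iota> 0, add = (\<lambda>x y. \<iota> (inv_into UNIV \<iota> x + inv_into UNIV \<iota> y)), smult = (\<lambda>c x. \<iota> (mscale c (inv_into UNIV \<iota> x))),
     star = (\<lambda>x. \<iota> (madj (inv_into UNIV \<iota> x))), cnorm = (\<lambda>x. mnorm (inv_into UNIV \<iota> x))\<rparr>"

lemma cring_complex_ring: "cring complex_ring"
proof (rule cringI)
  show "abelian_group complex_ring"
  proof (rule abelian_groupI)
    show "\<exists>y\<in>carrier complex_ring. y \<oplus>\<^bsub>complex_ring\<^esub> x = \<zero>\<^bsub>complex_ring\<^esub>" for x
      by (rule bexI[of _ "- x"]) (auto simp: complex_ring_def)
  qed (auto simp: complex_ring_def)
  show "comm_monoid complex_ring"
    by (rule comm_monoidI) (auto simp: complex_ring_def)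
qed (auto simp: complex_ring_def algebra_simps)

text \<open>The universal property in \<open>is_Ao\<close> tests algebras whose carrier lies in the
  type of \<open>A\<close>; the range of an injection \<open>\<iota>\<close> provides a copy of the
  matrix algebra there.\<close>

locale matrix_transport =
  fixes \<iota> :: "cmat \<Rightarrow> 'a"
  assumes inj: "inj \<iota>"
begin

abbreviation B :: "'a cstar" where
  "B \<equiv> matrix_cstar \<iota>"

lemma inv_\<iota> [simp]: "inv_into UNIV \<iota> (\<iota> X) = X"
  by (rule inv_f_f[OF inj])

lemma B_simps [simp]:
  "carrier B = range \<iota>" "\<iota> X \<otimes>\<^bsub>B\<^esub> \<iota> Y = \<iota> (X ** Y)" "\<one>\<^bsub>B\<^esub> = \<iota> (mat 1)" "\<zero>\<^bsub>B\<^esub> = \<iota> 0"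
  "\<iota> X \<oplus>\<^bsub>B\<^esub> \<iota> Y = \<iota> (X + Y)" "c \<odot>\<^bsub>B\<^esub> \<iota> X = \<iota> (mscale c X)"
  "star B (\<iota> X) = \<iota> (madj X)" "cnorm B (\<iota> X) = mnorm X"
  by (simp_all add: matrix_cstar_def)

lemma ring_B: "ring B"
proof (rule ringI)
  show "abelian_group B"
  proof (rule abelian_groupI)
    show "\<exists>y\<in>carrier B. y \<oplus>\<^bsub>B\<^esub> x = \<zero>\<^bsub>B\<^esub>" if "x \<in> carrier B" for x
    proof -
      obtain X where "x = \<iota> X"
        using \<open>x \<in> carrier B\<close> by auto
      then show ?thesis
        by (intro bexI[of _ "\<iota> (- X)"]) auto
    qed
  qed (auto simp: algebra_simps)
  show "Group.monoid B"
    by (rule monoidI) (auto simp: matrix_mul_assoc)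
qed (auto simp: cmat_algebra)

lemma minus_B [simp]: "\<iota> X \<ominus>\<^bsub>B\<^esub> \<iota> Y = \<iota> (X - Y)"
proof -
  have "\<ominus>\<^bsub>B\<^esub> \<iota> Y = \<iota> (- Y)"
    by (rule abelian_group.minus_equality[OF ring.is_abelian_group[OF ring_B]]) auto
  then show ?thesis
    by (simp add: a_minus_def)
qed

lemma cstar_algebra_B: "cstar_algebra B"
proof (intro cstar_algebra.intro cstar_algebra_axioms.intro)
  show "ring B"
    by (rule ring_B)
  show "Module.module complex_ring B"
  proof (rule moduleI)
    show "cring complex_ring"
      by (rule cring_complex_ring)
    show "abelian_group B"
      using ring_B ring.is_abelian_group by blast
  qed (auto simp: complex_ring_def cmat_algebra)
  fix x y c and X :: "nat \<Rightarrow> 'a"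
  show "cnorm B x = 0 \<longleftrightarrow> x = \<zero>\<^bsub>B\<^esub>" if "x \<in> carrier B"
    using that by (auto simp: mnorm_eq_0 inj_eq[OF inj])
  assume X: "\<forall>n. X n \<in> carrier B" "\<forall>e>0. \<exists>N. \<forall>m\<ge>N. \<forall>n\<ge>N. cnorm B (X m \<ominus>\<^bsub>B\<^esub> X n) < e"
  then have "\<forall>n. \<exists>Z. X n = \<iota> Z"
    by auto
  then obtain Z where Z: "X = (\<lambda>n. \<iota> (Z n))"
    by metis
  show "\<exists>x\<in>carrier B. (\<lambda>n. cnorm B (X n \<ominus>\<^bsub>B\<^esub> x)) \<longlonglongrightarrow> 0"
    using mnorm_complete[of Z] X(2) by (auto simp: Z)
qed (auto simp: cmat_algebra mnorm_nonneg mnorm_add mnorm_scale mnorm_mult mnorm_cstar)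

end

text \<open>The complex numbers are equinumerous with their square; nesting the bijection encodes
  four entries in one number.\<close>

lemma inj_cmat_complex: "\<exists>g :: cmat \<Rightarrow> complex. inj g"
proof -
  have "\<not> finite (UNIV :: complex set)"
    by (rule infinite_UNIV_char_0)
  then have "(card_of (UNIV \<times> UNIV :: (complex \<times> complex) set), card_of (UNIV :: complex set)) \<in> ordIso"
    by (rule card_of_Times_same_infinite)
  then obtain f :: "complex \<times> complex \<Rightarrow> complex" where "bij_betw f (UNIV \<times> UNIV) UNIV"
    using card_of_ordIso by blast
  then have f: "f p = f q \<longleftrightarrow> p = q" for p q
    by (simp add: bij_betw_def inj_eq)
  have "inj (\<lambda>X :: cmat. f (f (X $ 1 $ 1, X $ 1 $ 2), f (X $ 2 $ 1, X $ 2 $ 2)))"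
    by (rule injI) (simp add: f cmat_simps)
  then show ?thesis
    by blast
qed

section \<open>Matrix representations of A_o(2), partial characters and the spectrum\<close>

definition morthogonal :: "(nat \<Rightarrow> nat \<Rightarrow> cmat) \<Rightarrow> bool" where
  "morthogonal v \<longleftrightarrow> (\<forall>i\<in>{1, 2}. \<forall>j\<in>{1, 2}. madj (v i j) = v i j \<and>
     v i 1 ** v j 1 + v i 2 ** v j 2 = (if i = j then mat 1 else 0) \<and>
     v 1 i ** v 1 j + v 2 i ** v 2 j = (if i = j then mat 1 else 0))"

lemma finsum_Icc_1_2:
  assumes "abelian_monoid G" "f 1 \<in> carrier G" "f 2 \<in> carrier G"
  shows "(\<Oplus>\<^bsub>G\<^esub>k\<in>{1..2::nat}. f k) = f 1 \<oplus>\<^bsub>G\<^esub> f 2"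
proof -
  interpret abelian_monoid G by fact
  have "{1..2::nat} = {1, 2}"
    by auto
  then show ?thesis
    using assms by simp
qed

definition matrix_rep :: "'a cstar \<Rightarrow> ('a \<Rightarrow> cmat) \<Rightarrow> bool" where
  "matrix_rep A \<pi> \<longleftrightarrow>
     (\<forall>x\<in>carrier A. \<forall>y\<in>carrier A. \<pi> (x \<oplus>\<^bsub>A\<^esub> y) = \<pi> x + \<pi> y \<and> \<pi> (x \<otimes>\<^bsub>A\<^esub> y) = \<pi> x ** \<pi> y) \<and>
     (\<forall>c. \<forall>x\<in>carrier A. \<pi> (c \<odot>\<^bsub>A\<^esub> x) = mscale c (\<pi> x)) \<and> \<pi> \<one>\<^bsub>A\<^esub> = mat 1"

text \<open>In a nonzero algebra the multiples of the unit form a copy of the complex numbers, so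
  the matrices embed into its type. The universal property for the embedded matrix algebra yields
  the representation.\<close>

lemma is_Ao_matrix_rep:
  fixes A :: "'a cstar"
  assumes Ao: "is_Ao 2 A u" and nz: "\<one>\<^bsub>A\<^esub> \<noteq> \<zero>\<^bsub>A\<^esub>" and v: "morthogonal v"
  shows "\<exists>\<pi>. matrix_rep A \<pi> \<and> (\<forall>i\<in>{1, 2}. \<forall>j\<in>{1, 2}. \<pi> (u i j) = v i j)"
proof -
  interpret cstar_algebra A
    using Ao by (simp add: is_Ao_def)
  obtain g :: "cmat \<Rightarrow> complex" where g: "inj g"
    using inj_cmat_complex by blast
  have "inj (\<lambda>c. c \<odot>\<^bsub>A\<^esub> \<one>\<^bsub>A\<^esub>)"
  proof (rule injI)
    fix c d assume cd: "c \<odot>\<^bsub>A\<^esub> \<one>\<^bsub>A\<^esub> = d \<odot>\<^bsub>A\<^esub> \<one>\<^bsub>A\<^esub>"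
    have "(c - d) \<odot>\<^bsub>A\<^esub> \<one>\<^bsub>A\<^esub> = \<zero>\<^bsub>A\<^esub>"
      using scale_add_left[of "\<one>\<^bsub>A\<^esub>" c "- d"] scale_add_left[of "\<one>\<^bsub>A\<^esub>" d "- d"] cd by simp
    then have "cmod (c - d) * cnorm A \<one>\<^bsub>A\<^esub> = 0"
      using cnorm_smult[of "\<one>\<^bsub>A\<^esub>" "c - d"] by simp
    then show "c = d"
      using nz cnorm_eq_0[of "\<one>\<^bsub>A\<^esub>"] by simp
  qed
  then have "inj ((\<lambda>c. c \<odot>\<^bsub>A\<^esub> \<one>\<^bsub>A\<^esub>) \<circ> g)"
    using g by (rule inj_compose)
  then interpret matrix_transport "(\<lambda>c. c \<odot>\<^bsub>A\<^esub> \<one>\<^bsub>A\<^esub>) \<circ> g"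
    by unfold_locales
  define \<iota> where "\<iota> = (\<lambda>c. c \<odot>\<^bsub>A\<^esub> \<one>\<^bsub>A\<^esub>) \<circ> g"
  note [simp] = B_simps[folded \<iota>_def] inv_\<iota>[folded \<iota>_def]
  have am: "abelian_monoid (matrix_cstar \<iota>)"
    using ring_B by (simp add: \<iota>_def ring_def abelian_group_def)
  have "orthogonal_matrix_in (matrix_cstar \<iota>) 2 (\<lambda>i j. \<iota> (v i j))"
    unfolding orthogonal_matrix_in_def
  proof (intro ballI)
    fix i j :: nat assume "i \<in> {1..2}" "j \<in> {1..2}"
    then have "i \<in> {1, 2}" "j \<in> {1, 2}"
      by auto
    then have v: "madj (v i j) = v i j"
        "v i 1 ** v j 1 + v i 2 ** v j 2 = (if i = j then mat 1 else 0)"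
        "v 1 i ** v 1 j + v 2 i ** v 2 j = (if i = j then mat 1 else 0)"
      using v unfolding morthogonal_def by blast+
    show "\<iota> (v i j) \<in> carrier (matrix_cstar \<iota>) \<and> star (matrix_cstar \<iota>) (\<iota> (v i j)) = \<iota> (v i j) \<and>
      (\<Oplus>\<^bsub>matrix_cstar \<iota>\<^esub>k\<in>{1..2}. \<iota> (v i k) \<otimes>\<^bsub>matrix_cstar \<iota>\<^esub> \<iota> (v j k))
        = (if i = j then \<one>\<^bsub>matrix_cstar \<iota>\<^esub> else \<zero>\<^bsub>matrix_cstar \<iota>\<^esub>) \<and>
      (\<Oplus>\<^bsub>matrix_cstar \<iota>\<^esub>k\<in>{1..2}. \<iota> (v k i) \<otimes>\<^bsub>matrix_cstar \<iota>\<^esub> \<iota> (v k j))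
        = (if i = j then \<one>\<^bsub>matrix_cstar \<iota>\<^esub> else \<zero>\<^bsub>matrix_cstar \<iota>\<^esub>)"
      using v by (subst (1 2) finsum_Icc_1_2[OF am]) auto
  qed
  moreover have "cstar_algebra (matrix_cstar \<iota>)"
    using cstar_algebra_B by (simp add: \<iota>_def)
  ultimately obtain f where f: "star_hom A (matrix_cstar \<iota>) f"
      "\<And>i j. i \<in> {1..2} \<Longrightarrow> j \<in> {1..2} \<Longrightarrow> f (u i j) = \<iota> (v i j)"
    using Ao unfolding is_Ao_def by blast
  have f': "f x \<in> range \<iota>" if "x \<in> carrier A" for x
    using f(1) that by (auto simp: star_hom_def ring_hom_def)
  have "matrix_rep A (\<lambda>x. inv_into UNIV \<iota> (f x))"
    unfolding matrix_rep_def
  proof (intro conjI ballI allI)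
    fix x y c assume x: "x \<in> carrier A"
    then obtain X where X: "f x = \<iota> X"
      using f' by blast
    show "inv_into UNIV \<iota> (f (c \<odot>\<^bsub>A\<^esub> x)) = mscale c (inv_into UNIV \<iota> (f x))"
      using f(1) x by (auto simp: star_hom_def X)
    assume y: "y \<in> carrier A"
    then obtain Y where Y: "f y = \<iota> Y"
      using f' by blast
    show "inv_into UNIV \<iota> (f (x \<oplus>\<^bsub>A\<^esub> y)) = inv_into UNIV \<iota> (f x) + inv_into UNIV \<iota> (f y)"
      "inv_into UNIV \<iota> (f (x \<otimes>\<^bsub>A\<^esub> y)) = inv_into UNIV \<iota> (f x) ** inv_into UNIV \<iota> (f y)"
      using f(1) x y by (auto simp: star_hom_def ring_hom_def X Y)
  next
    show "inv_into UNIV \<iota> (f \<one>\<^bsub>A\<^esub>) = mat 1"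
      using f(1) by (simp add: star_hom_def ring_hom_def)
  qed
  moreover have "\<forall>i\<in>{1, 2}. \<forall>j\<in>{1, 2}. inv_into UNIV \<iota> (f (u i j)) = v i j"
    using f(2) by auto
  ultimately show ?thesis
    by blast
qed

text \<open>
  \<open>\<kappa> = 1\<close> gives a scalar rotation, \<open>\<kappa> = \<i>\<close> a matrix in which the entries of each row anticommute,
  being multiples of two different Pauli matrices.
\<close>

definition Ao_point :: "complex \<Rightarrow> nat \<Rightarrow> real \<Rightarrow> real \<Rightarrow> nat \<Rightarrow> nat \<Rightarrow> cmat" where
  "Ao_point \<kappa> i c s p q =
     (if \<kappa> = 1 then mscale (of_real (if p = i then (if q = 1 then c else s) else (if q = 1 then - s else c))) (mat 1)
      else if (p = i) = (q = 1) then mscale (of_real c) (\<chi> k l. if k = l then 0 else 1)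
      else mscale (of_real s) (\<chi> k l. if k = l then 0 else if k = 1 then - \<i> else \<i>))"

lemma morthogonal_Ao_point:
  assumes "i \<in> {1, 2}" "c\<^sup>2 + s\<^sup>2 = 1"
  shows "morthogonal (Ao_point \<kappa> i c s)"
proof -
  have "of_real c * of_real c + of_real s * of_real s = (1::complex)"
    using assms(2) by (simp add: power2_eq_square flip: of_real_mult of_real_add)
  moreover have "of_real s * \<i> * (of_real s * \<i>) = - (of_real s * of_real s)"
    by (simp add: algebra_simps)
  moreover from calculation have "of_real s * of_real s + of_real c * of_real c = (1::complex)"
    by (simp add: add.commute)
  ultimately show ?thesis
    using assms(1) by (auto simp: morthogonal_def Ao_point_def cmat_simps)
qed

text \<open>Models the upper left entry of a matrix representation: linear everywhere, but
  multiplicative only on a set \<open>D\<close> of elements that go to diagonal matrices.\<close>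

definition partial_character :: "'a cstar \<Rightarrow> 'a set \<Rightarrow> ('a \<Rightarrow> complex) \<Rightarrow> bool" where
  "partial_character A D \<psi> \<longleftrightarrow> D \<subseteq> carrier A \<and> \<one>\<^bsub>A\<^esub> \<in> D \<and> \<psi> \<one>\<^bsub>A\<^esub> = 1 \<and>
     (\<forall>x\<in>D. \<forall>y\<in>D. x \<otimes>\<^bsub>A\<^esub> y \<in> D \<and> \<psi> (x \<otimes>\<^bsub>A\<^esub> y) = \<psi> x * \<psi> y) \<and>
     (\<forall>x\<in>carrier A. \<forall>y\<in>carrier A. \<psi> (x \<oplus>\<^bsub>A\<^esub> y) = \<psi> x + \<psi> y) \<and>
     (\<forall>c. \<forall>x\<in>carrier A. \<psi> (c \<odot>\<^bsub>A\<^esub> x) = c * \<psi> x)"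

lemma matrix_rep_partial_character:
  assumes "cstar_algebra A" and \<pi>: "matrix_rep A \<pi>"
  shows "partial_character A {x \<in> carrier A. \<pi> x $ 1 $ 2 = 0 \<and> \<pi> x $ 2 $ 1 = 0} (\<lambda>x. \<pi> x $ 1 $ 1)"
proof -
  interpret cstar_algebra A by fact
  have m: "x \<otimes>\<^bsub>A\<^esub> y \<in> carrier A" if "x \<in> carrier A" "y \<in> carrier A" for x y
    using that by simp
  have "\<one>\<^bsub>A\<^esub> \<in> carrier A"
    by simp
  then show ?thesis
    using \<pi> m unfolding partial_character_def matrix_rep_def by (auto simp: cmat_simps)
qed

text \<open>In the representation \<open>Ao_point\<close> products of two entries of row
  \<open>i\<close> are diagonal. For \<open>\<kappa> = \<i>\<close> the entries are \<open>c\<close>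
  and \<open>s\<close> times the first two Pauli matrices, whose product has upper left entry
  \<open>\<i>\<close>, and \<open>- \<i>\<close> in the opposite order.\<close>

lemma is_Ao_partial_character:
  assumes Ao: "is_Ao 2 A u" and nz: "\<one>\<^bsub>A\<^esub> \<noteq> \<zero>\<^bsub>A\<^esub>"
    and i: "i \<in> {1, 2}" and cs: "c\<^sup>2 + s\<^sup>2 = 1" and \<kappa>: "\<kappa> \<in> {1, \<i>}"
  shows "\<exists>D \<psi>. partial_character A D \<psi> \<and>
     u i 1 \<otimes>\<^bsub>A\<^esub> u i 1 \<in> D \<and> u i 2 \<otimes>\<^bsub>A\<^esub> u i 2 \<in> D \<and> u i 1 \<otimes>\<^bsub>A\<^esub> u i 2 \<in> D \<and> u i 2 \<otimes>\<^bsub>A\<^esub> u i 1 \<in> D \<and>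
     \<psi> (u i 1 \<otimes>\<^bsub>A\<^esub> u i 1) = of_real (c\<^sup>2) \<and> \<psi> (u i 2 \<otimes>\<^bsub>A\<^esub> u i 2) = of_real (s\<^sup>2) \<and>
     \<psi> (u i 1 \<otimes>\<^bsub>A\<^esub> u i 2) = of_real (c * s) * \<kappa> \<and> \<psi> (u i 2 \<otimes>\<^bsub>A\<^esub> u i 1) = of_real (c * s) * cnj \<kappa>"
proof -
  interpret cstar_algebra A
    using Ao by (simp add: is_Ao_def)
  obtain \<pi> where \<pi>: "matrix_rep A \<pi>"
      and "\<forall>i'\<in>{1, 2}. \<forall>j\<in>{1, 2}. \<pi> (u i' j) = Ao_point \<kappa> i c s i' j"
    using is_Ao_matrix_rep[OF Ao nz morthogonal_Ao_point[OF i cs]] by blast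
  then have \<pi>u: "\<pi> (u i 1) = Ao_point \<kappa> i c s i 1" "\<pi> (u i 2) = Ao_point \<kappa> i c s i 2"
    using i by auto
  have u: "u i 1 \<in> carrier A" "u i 2 \<in> carrier A"
    using Ao i by (auto simp: is_Ao_def orthogonal_matrix_in_def)
  have m: "\<pi> (x \<otimes>\<^bsub>A\<^esub> y) = \<pi> x ** \<pi> y" if "x \<in> carrier A" "y \<in> carrier A" for x y
    using \<pi> that by (simp add: matrix_rep_def)
  show ?thesis
  proof (intro exI conjI)
    show "partial_character A {x \<in> carrier A. \<pi> x $ 1 $ 2 = 0 \<and> \<pi> x $ 2 $ 1 = 0} (\<lambda>x. \<pi> x $ 1 $ 1)"
      by (rule matrix_rep_partial_character[OF cstar_algebra_axioms \<pi>])
  qed (use \<kappa> u in \<open>auto simp: m \<pi>u[unfolded One_nat_def] \<pi>u(1) Ao_point_def cmat_simps power2_eq_square algebra_simps\<close>)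
qed

text \<open>A scalar representation with \<open>u i j\<close> sent to \<open>sqrt t\<close>
  annihilates \<open>t 1 - u\<^sub>i\<^sub>j\<^sup>2\<close>. No invertible element is annihilated,
  since the unit goes to the identity matrix.\<close>

lemma is_Ao_spectrum:
  assumes Ao: "is_Ao 2 A u" and nz: "\<one>\<^bsub>A\<^esub> \<noteq> \<zero>\<^bsub>A\<^esub>"
    and i: "i \<in> {1, 2}" and j: "j \<in> {1, 2}" and t: "t \<in> {0..1}"
  shows "complex_of_real t \<in> spectrum A (u i j \<otimes>\<^bsub>A\<^esub> u i j)"
proof -
  interpret cstar_algebra A
    using Ao by (simp add: is_Ao_def)
  \<comment> \<open>Row \<open>i\<close> of the rotation is \<open>(c, s)\<close>; the choice puts
    \<open>sqrt t\<close> into column \<open>j\<close>.\<close>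
  define c where "c = (if j = 1 then sqrt t else sqrt (1 - t))"
  define s where "s = (if j = 1 then sqrt (1 - t) else sqrt t)"
  have "c\<^sup>2 + s\<^sup>2 = 1"
    using t by (simp add: c_def s_def)
  then obtain \<pi> where \<pi>: "matrix_rep A \<pi>"
      and "\<forall>i'\<in>{1, 2}. \<forall>j\<in>{1, 2}. \<pi> (u i' j) = Ao_point 1 i c s i' j"
    using is_Ao_matrix_rep[OF Ao nz morthogonal_Ao_point[OF i]] by blast
  then have "\<pi> (u i j) = mscale (of_real (sqrt t)) (mat 1)"
    using i j by (auto simp: Ao_point_def c_def s_def)
  moreover have u: "u i j \<in> carrier A"
    using Ao i j by (auto simp: is_Ao_def orthogonal_matrix_in_def)
  ultimately have sq: "\<pi> (u i j \<otimes>\<^bsub>A\<^esub> u i j) = mscale (of_real t) (mat 1)"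
    using \<pi> t by (simp add: matrix_rep_def) (simp add: cmat_simps flip: of_real_mult)
  let ?y = "of_real t \<odot>\<^bsub>A\<^esub> \<one>\<^bsub>A\<^esub> \<ominus>\<^bsub>A\<^esub> u i j \<otimes>\<^bsub>A\<^esub> u i j"
  have "?y \<notin> Units A"
  proof
    assume "?y \<in> Units A"
    then obtain x where x: "x \<in> carrier A" "x \<otimes>\<^bsub>A\<^esub> ?y = \<one>\<^bsub>A\<^esub>"
      by (auto simp: Units_def)
    have y: "?y = of_real t \<odot>\<^bsub>A\<^esub> \<one>\<^bsub>A\<^esub> \<oplus>\<^bsub>A\<^esub> (- 1) \<odot>\<^bsub>A\<^esub> (u i j \<otimes>\<^bsub>A\<^esub> u i j)" "?y \<in> carrier A"
      using u by (simp_all add: a_minus_def uminus_conv_scale)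
    then have "\<pi> ?y = mscale (of_real t) (mat 1) + mscale (- 1) (mscale (of_real t) (mat 1))"
      using \<pi> u sq by (simp add: matrix_rep_def)
    also have "\<dots> = 0"
      by (simp add: cmat_simps)
    finally have "\<pi> x ** \<pi> ?y = 0"
      by (simp add: cmat_simps)
    moreover have "\<pi> (x \<otimes>\<^bsub>A\<^esub> ?y) = \<pi> x ** \<pi> ?y"
      using \<pi> x(1) y(2) unfolding matrix_rep_def by blast
    ultimately have "mat 1 = (0 :: cmat)"
      using \<pi> unfolding x(2) matrix_rep_def by simp
    then show False
      by (simp add: cmat_simps)
  qed
  then show ?thesis
    by (simp add: spectrum_def)
qed

section \<open>Moments of the squared generators\<close>

lemma coeff_one_plus_X2_power:
  "coeff ([:1, 0, 1:] ^ l :: complex poly) 0 = 1 \<and> coeff ([:1, 0, 1:] ^ l :: complex poly) (Suc 0) = 0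
    \<and> coeff ([:1, 0, 1:] ^ l :: complex poly) (Suc (Suc 0)) = of_nat l"
  by (induction l) (auto simp: coeff_pCons split: nat.splits)

text \<open>The powers of \<open>2 X - 1\<close> span all polynomials, because this substitution has
  the inverse \<open>(X + 1) / 2\<close>.\<close>

lemma poly_linear_eqI:
  fixes L R :: "complex poly \<Rightarrow> complex"
  assumes L: "\<And>p q. L (p + q) = L p + L q" "\<And>c p. L (Polynomial.smult c p) = c * L p"
    and R: "\<And>p q. R (p + q) = R p + R q" "\<And>c p. R (Polynomial.smult c p) = c * R p"
    and eq: "\<And>n. L ([:-1, 2:] ^ n) = R ([:-1, 2:] ^ n)"
  shows "L p = R p"
proof -
  let ?g = "[:-1, 2:] :: complex poly"
  \<comment> \<open>The factor \<open>?g ^ k\<close> lets the induction along the coefficients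
    absorb one factor \<open>?g\<close> at each step.\<close>
  have *: "L (?g ^ k * pcompose q ?g) = R (?g ^ k * pcompose q ?g)" for k q
  proof (induction q arbitrary: k)
    case 0
    then show ?case
      using L(2)[of 0 0] R(2)[of 0 0] by simp
  next
    case (pCons c q)
    have "?g ^ k * pcompose (pCons c q) ?g = Polynomial.smult c (?g ^ k) + ?g ^ Suc k * pcompose q ?g"
      unfolding pcompose_pCons by (simp only: distrib_left power_Suc2 mult.assoc) simp
    then show ?case
      by (simp only: L R eq pCons.IH)
  qed
  have "pcompose (pcompose p [:1/2, 1/2:]) ?g = p"
    unfolding pcompose_assoc[symmetric] by (simp add: pcompose_pCons)
  then show ?thesis
    using *[of 0 "pcompose p [:1/2, 1/2:]"] by simp
qed

lemma integral_shifted_power: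
  "integral {0..1::real} (\<lambda>t. poly ([:-1, 2:] ^ n) (complex_of_real t)) = (1 + (- 1) ^ n) / (2 * (of_nat n + 1))"
proof -
  \<comment> \<open>An antiderivative of \<open>(2 t - 1) ^ n\<close>.\<close>
  define F where "F = (\<lambda>t::real. (- 1 + complex_of_real t * 2) ^ Suc n / (2 * (of_nat n + 1)))"
  have nz: "(of_nat n + 1 :: complex) \<noteq> 0"
    by (metis of_nat_Suc of_nat_0_neq add.commute)
  have "(F has_vector_derivative (- 1 + complex_of_real t * 2) ^ n) (at t within {0..1})" for t
    unfolding F_def
  proof (rule has_vector_derivative_real_field)
    have "((\<lambda>z. - 1 + z * 2) has_field_derivative 2) (at (complex_of_real t))"
      by (auto intro!: derivative_eq_intros)
    from DERIV_cdivide[OF DERIV_power_Suc[OF this]]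
    have "((\<lambda>z. (- 1 + z * 2) ^ Suc n / (2 * (of_nat n + 1))) has_field_derivative
      (of_nat (Suc n) * (2 * (- 1 + complex_of_real t * 2) ^ n)) / (2 * (of_nat n + 1))) (at (complex_of_real t))"
      by (simp only: of_nat_Suc)
    moreover have "(of_nat (Suc n) * (2 * (- 1 + complex_of_real t * 2) ^ n)) / (2 * (of_nat n + 1))
      = (- 1 + complex_of_real t * 2) ^ n"
      using nz unfolding of_nat_Suc by (metis (no_types) add.commute mult.assoc mult.commute mult_zero_right nonzero_mult_div_cancel_left zero_neq_numeral no_zero_divisors)
    ultimately show "((\<lambda>z. (- 1 + z * 2) ^ Suc n / (2 * (of_nat n + 1))) has_field_derivative
      (- 1 + complex_of_real t * 2) ^ n) (at (complex_of_real t))"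
      by simp
  qed
  then have "((\<lambda>t. (- 1 + complex_of_real t * 2) ^ n) has_integral F 1 - F 0) {0..1}"
    by (intro fundamental_theorem_of_calculus) auto
  moreover have "F 1 - F 0 = (1 + (- 1) ^ n) / (2 * (of_nat n + 1))"
    by (simp add: F_def add_divide_distrib)
  ultimately show ?thesis
    by (simp add: poly_power integral_unique)
qed

text \<open>The graph of the slice by \<open>\<psi>\<close> in the first leg, on finite sums of
  elementary tensors with first leg in \<open>D\<close>. For a relation it need not be shown that
  the value is independent of the decomposition or extends to all of \<open>T\<close>.\<close>

inductive slice_rel :: "'a cstar \<Rightarrow> 't cstar \<Rightarrow> ('a \<Rightarrow> 'a \<Rightarrow> 't) \<Rightarrow> 'a set \<Rightarrow> ('a \<Rightarrow> complex) \<Rightarrow> 't \<Rightarrow> 'a \<Rightarrow> bool"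
  for A T t D \<psi> where
  tensor: "\<lbrakk>a \<in> D; b \<in> carrier A\<rbrakk> \<Longrightarrow> slice_rel A T t D \<psi> (t a b) (\<psi> a \<odot>\<^bsub>A\<^esub> b)"
| add: "\<lbrakk>slice_rel A T t D \<psi> X x; slice_rel A T t D \<psi> Y y\<rbrakk> \<Longrightarrow> slice_rel A T t D \<psi> (X \<oplus>\<^bsub>T\<^esub> Y) (x \<oplus>\<^bsub>A\<^esub> y)"

section \<open>Calculation rules for slicing with a partial character\<close>

locale tensor_character =
  fixes A :: "'a cstar" and T :: "'t cstar" and t D \<psi>
  assumes tens: "cstar_tensor A A T t" and char: "partial_character A D \<psi>"
begin

sublocale A: cstar_algebra A
  using tens by (simp add: cstar_tensor_def)

sublocale T: cstar_algebra T
  using tens by (simp add: cstar_tensor_def)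

abbreviation rel :: "'t \<Rightarrow> 'a \<Rightarrow> bool" where
  "rel \<equiv> slice_rel A T t D \<psi>"

lemma D_carrier: "a \<in> D \<Longrightarrow> a \<in> carrier A"
  using char by (auto simp: partial_character_def)

lemma t_closed: "a \<in> carrier A \<Longrightarrow> b \<in> carrier A \<Longrightarrow> t a b \<in> carrier T"
  using tens by (simp add: cstar_tensor_def)

lemma t_mult:
  "\<lbrakk>a \<in> carrier A; a' \<in> carrier A; b \<in> carrier A; b' \<in> carrier A\<rbrakk>
    \<Longrightarrow> t a b \<otimes>\<^bsub>T\<^esub> t a' b' = t (a \<otimes>\<^bsub>A\<^esub> a') (b \<otimes>\<^bsub>A\<^esub> b')"
  using tens by (simp add: cstar_tensor_def)

lemma rel_closed: "rel X x \<Longrightarrow> X \<in> carrier T \<and> x \<in> carrier A"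
  by (induction rule: slice_rel.induct) (auto simp: t_closed D_carrier)

lemma rel_mult:
  assumes "rel X x" "rel Y y"
  shows "rel (X \<otimes>\<^bsub>T\<^esub> Y) (x \<otimes>\<^bsub>A\<^esub> y)"
  using assms(1)
proof (induction rule: slice_rel.induct)
  case (tensor a b)
  note ab = tensor
  show ?case
    using assms(2)
  proof (induction rule: slice_rel.induct)
    case (tensor a' b')
    have "rel (t (a \<otimes>\<^bsub>A\<^esub> a') (b \<otimes>\<^bsub>A\<^esub> b')) (\<psi> (a \<otimes>\<^bsub>A\<^esub> a') \<odot>\<^bsub>A\<^esub> (b \<otimes>\<^bsub>A\<^esub> b'))"
      using char ab tensor by (intro slice_rel.tensor) (auto simp: partial_character_def)
    moreover have "\<psi> (a \<otimes>\<^bsub>A\<^esub> a') = \<psi> a * \<psi> a'"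
      using char ab tensor by (auto simp: partial_character_def)
    ultimately show ?case
      using ab tensor D_carrier
      by (simp add: t_mult A.smult_mult_left A.smult_mult_right A.scale_scale mult.commute)
  next
    case (add X x Y y)
    then show ?case
      using ab rel_closed[of X x] rel_closed[of Y y] D_carrier t_closed slice_rel.add
      by (fastforce simp: T.A_distrib A.A_distrib)
  qed
next
  case (add X x Y' y')
  then show ?case
    using rel_closed[of X x] rel_closed[of Y' y'] rel_closed[OF assms(2)] slice_rel.add
    by (fastforce simp: T.A_distrib A.A_distrib)
qed

lemma rel_one: "rel \<one>\<^bsub>T\<^esub> \<one>\<^bsub>A\<^esub>"
  using slice_rel.tensor[of "\<one>\<^bsub>A\<^esub>" D "\<one>\<^bsub>A\<^esub>" A T t \<psi>] tens char
  by (simp add: partial_character_def cstar_tensor_def)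

lemma rel_scale: "rel X x \<Longrightarrow> rel (c \<odot>\<^bsub>T\<^esub> X) (c \<odot>\<^bsub>A\<^esub> x)"
proof (induction rule: slice_rel.induct)
  case (tensor a b)
  have "t a (c \<odot>\<^bsub>A\<^esub> b) = c \<odot>\<^bsub>T\<^esub> t a b"
    using tens tensor D_carrier by (simp add: cstar_tensor_def)
  then show ?case
    using slice_rel.tensor[OF tensor(1), of "c \<odot>\<^bsub>A\<^esub> b" A T t \<psi>] tensor
    by (simp add: A.scale_scale mult.commute)
next
  case (add X x Y y)
  then show ?case
    using rel_closed[of X x] rel_closed[of Y y] slice_rel.add
    by (fastforce simp: T.scale_add_right A.scale_add_right)
qed

lemma rel_power: "rel X x \<Longrightarrow> rel (X [^]\<^bsub>T\<^esub> (n::nat)) (x [^]\<^bsub>A\<^esub> n)"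
  by (induction n) (auto simp: rel_one rel_mult)

text \<open>Slicing the two legs in either order gives the same number: on \<open>t a b\<close> both
  sides are \<open>\<psi> a * h b\<close>.\<close>

lemma rel_slice:
  assumes S: "is_right_slice A T t h S" and h: "positive_unital_form A h" and "rel X x"
  shows "\<psi> (S X) = h x"
proof -
  have S_t: "S (t a b) = h b \<odot>\<^bsub>A\<^esub> a" if "a \<in> carrier A" "b \<in> carrier A" for a b
    using S that by (simp add: is_right_slice_def)
  have S_add: "S (X \<oplus>\<^bsub>T\<^esub> Y) = S X \<oplus>\<^bsub>A\<^esub> S Y" if "X \<in> carrier T" "Y \<in> carrier T" for X Y
    using S that by (auto simp: is_right_slice_def bounded_linear_map_def)
  have S_closed: "S X \<in> carrier A" if "X \<in> carrier T" for X
    using S that by (auto simp: is_right_slice_def bounded_linear_map_def)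
  have \<psi>: "\<psi> (x \<oplus>\<^bsub>A\<^esub> y) = \<psi> x + \<psi> y" "\<psi> (c \<odot>\<^bsub>A\<^esub> x) = c * \<psi> x"
    "h (x \<oplus>\<^bsub>A\<^esub> y) = h x + h y" "h (c \<odot>\<^bsub>A\<^esub> x) = c * h x"
    if "x \<in> carrier A" "y \<in> carrier A" for x y c
    using char h that by (auto simp: partial_character_def positive_unital_form_def)
  from \<open>rel X x\<close> show ?thesis
  proof (induction rule: slice_rel.induct)
    case (tensor a b)
    then show ?case
      using D_carrier by (simp add: S_t \<psi>(2) \<psi>(4) mult.commute)
  next
    case (add X x Y y)
    then show ?case
      using rel_closed[of X x] rel_closed[of Y y] by (simp add: S_add S_closed \<psi>(1) \<psi>(3))
  qed
qed

text \<open>Apply \<open>\<psi>\<close> to the invariance of \<open>h\<close> at the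
  \<open>n\<close>-th power of \<open>w\<close>. Since the slice relation is multiplicative, the
  slice of the comultiplied power is the power of \<open>y\<close>.\<close>

lemma haar_power_eq:
  assumes \<Delta>: "star_hom A T \<Delta>" and haar: "is_haar A T t \<Delta> h"
    and w: "w \<in> carrier A" and rel: "rel (\<Delta> w) y"
  shows "h (y [^]\<^bsub>A\<^esub> (n::nat)) = h (w [^]\<^bsub>A\<^esub> n)"
proof -
  obtain S where S: "is_right_slice A T t h S" "\<And>x. x \<in> carrier A \<Longrightarrow> S (\<Delta> x) = h x \<odot>\<^bsub>A\<^esub> \<one>\<^bsub>A\<^esub>"
    using haar unfolding is_haar_def by blast
  have h: "positive_unital_form A h"
    using haar by (simp add: is_haar_def)
  have pow_closed: "w [^]\<^bsub>A\<^esub> n \<in> carrier A" for n :: nat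
    by (induction n) (auto simp: w)
  have "\<Delta> (w [^]\<^bsub>A\<^esub> n) = \<Delta> w [^]\<^bsub>T\<^esub> n" for n :: nat
    by (induction n) (use \<Delta> w pow_closed in \<open>auto simp: star_hom_def ring_hom_def\<close>)
  then have "h (y [^]\<^bsub>A\<^esub> n) = \<psi> (h (w [^]\<^bsub>A\<^esub> n) \<odot>\<^bsub>A\<^esub> \<one>\<^bsub>A\<^esub>)"
    using rel_slice[OF S(1) h rel_power[OF rel]] S(2) pow_closed by metis
  then show ?thesis
    using char by (simp add: partial_character_def)
qed

end

section \<open>Moment recursion from rotation invariance\<close>

context cstar_algebra
begin

lemma pow_closed [simp]: "x \<in> carrier A \<Longrightarrow> x [^] (n::nat) \<in> carrier A"
  by (induction n) auto

lemma scale_pow: "x \<in> carrier A \<Longrightarrow> (c \<odot> x) [^] (n::nat) = (c ^ n) \<odot> (x [^] n)"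
  by (induction n) (auto simp: smult_mult_left smult_mult_right scale_scale mult.commute)

lemma pow_commute:
  assumes "x \<in> carrier A" "y \<in> carrier A" "x \<otimes> y = y \<otimes> x"
  shows "x [^] (n::nat) \<otimes> y = y \<otimes> x [^] n"
proof (induction n)
  case (Suc n)
  have "x [^] Suc n \<otimes> y = x [^] n \<otimes> (x \<otimes> y)"
    using assms by (simp add: A_assoc)
  also have "\<dots> = (x [^] n \<otimes> y) \<otimes> x"
    using assms by (simp add: A_assoc)
  finally show ?case
    using assms Suc by (simp add: A_assoc)
qed (use assms in auto)

text \<open>The binomial expansion to second order in \<open>x\<close>. The left factor
  \<open>y\<close> is arbitrary because the induction moves the first factor \<open>m\<close> or
  \<open>k\<close> into it. Where \<open>n - 1\<close> or \<open>n - 2\<close> is truncated, the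
  binomial coefficient in front is 0.\<close>

lemma power_expansion:
  assumes h: "positive_unital_form A h"
    and m: "m \<in> carrier A" and k: "k \<in> carrier A" and mk: "m \<otimes> k = k \<otimes> m"
    and y: "y \<in> carrier A"
  shows "\<exists>P. (\<forall>x. h (y \<otimes> (m \<oplus> x \<odot> k) [^] n) = poly P x) \<and>
    coeff P 0 = h (y \<otimes> m [^] n) \<and>
    coeff P (Suc 0) = of_nat n * h (y \<otimes> (m [^] (n - 1) \<otimes> k)) \<and>
    coeff P (Suc (Suc 0)) = of_nat (n * (n - 1)) / 2 * h (y \<otimes> (m [^] (n - 2) \<otimes> (k \<otimes> k)))"
  using y
proof (induction n arbitrary: y)
  case 0
  then show ?case
    by (intro exI[of _ "[:h y:]"]) simp
next
  case (Suc n)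
  have h_simps: "h (x \<oplus> y) = h x + h y" "h (c \<odot> x) = c * h x" if "x \<in> carrier A" "y \<in> carrier A" for x y c
    using h that by (auto simp: positive_unital_form_def)
  have km: "k \<otimes> m [^] i = m [^] i \<otimes> k" for i :: nat
    using pow_commute[OF m k mk] by simp
  obtain P Q where P: "\<And>x. h ((y \<otimes> m) \<otimes> (m \<oplus> x \<odot> k) [^] n) = poly P x"
      "coeff P 0 = h ((y \<otimes> m) \<otimes> m [^] n)"
      "coeff P (Suc 0) = of_nat n * h ((y \<otimes> m) \<otimes> (m [^] (n - 1) \<otimes> k))"
      "coeff P (Suc (Suc 0)) = of_nat (n * (n - 1)) / 2 * h ((y \<otimes> m) \<otimes> (m [^] (n - 2) \<otimes> (k \<otimes> k)))"
    and Q: "\<And>x. h ((y \<otimes> k) \<otimes> (m \<oplus> x \<odot> k) [^] n) = poly Q x"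
      "coeff Q 0 = h ((y \<otimes> k) \<otimes> m [^] n)"
      "coeff Q (Suc 0) = of_nat n * h ((y \<otimes> k) \<otimes> (m [^] (n - 1) \<otimes> k))"
    using Suc.IH[of "y \<otimes> m"] Suc.IH[of "y \<otimes> k"] Suc.prems m k by auto
  have 1: "h (y \<otimes> (m \<oplus> x \<odot> k) [^] Suc n) = poly (P + pCons 0 Q) x" for x
  proof -
    have "y \<otimes> (m \<oplus> x \<odot> k) [^] Suc n
        = (y \<otimes> m) \<otimes> (m \<oplus> x \<odot> k) [^] n \<oplus> x \<odot> ((y \<otimes> k) \<otimes> (m \<oplus> x \<odot> k) [^] n)"
      using Suc.prems m k
      by (simp only: A_pow_Suc A_assoc A_distrib smult_mult_left smult_mult_right
        A_ring(1,5) scale_closed pow_closed)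
    then show ?thesis
      using Suc.prems m k by (simp add: h_simps P(1) Q(1))
  qed
  have 2: "(y \<otimes> m) \<otimes> m [^] n = y \<otimes> m [^] Suc n" "(y \<otimes> k) \<otimes> m [^] n = y \<otimes> (m [^] n \<otimes> k)"
    using Suc.prems m k by (simp_all only: A_pow_Suc A_assoc km pow_closed)
  have 3: "(y \<otimes> m) \<otimes> (m [^] (n - 1) \<otimes> k) = y \<otimes> (m [^] n \<otimes> k)"
    "(y \<otimes> k) \<otimes> (m [^] (n - 1) \<otimes> k) = y \<otimes> (m [^] (n - 1) \<otimes> (k \<otimes> k))" if "n > 0"
  proof -
    obtain i where i: "n = Suc i"
      using \<open>n > 0\<close> gr0_conv_Suc by blast
    show "(y \<otimes> m) \<otimes> (m [^] (n - 1) \<otimes> k) = y \<otimes> (m [^] n \<otimes> k)"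
      using Suc.prems m k by (simp only: i diff_Suc_1 A_pow_Suc A_assoc A_ring(5) pow_closed)
    have "k \<otimes> (m [^] i \<otimes> k) = m [^] i \<otimes> (k \<otimes> k)"
      using m k by (simp add: km A_assoc[symmetric])
    then show "(y \<otimes> k) \<otimes> (m [^] (n - 1) \<otimes> k) = y \<otimes> (m [^] (n - 1) \<otimes> (k \<otimes> k))"
      using Suc.prems m k by (simp add: i A_assoc)
  qed
  have 4: "(y \<otimes> m) \<otimes> (m [^] (n - 2) \<otimes> (k \<otimes> k)) = y \<otimes> (m [^] (n - 1) \<otimes> (k \<otimes> k))" if "n > 1"
  proof -
    have i: "n = Suc (Suc (n - 2))"
      using \<open>n > 1\<close> by simp
    then obtain i where i: "n = Suc (Suc i)" ..
    show ?thesis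
      using Suc.prems m k by (simp only: i diff_Suc_1 diff_Suc_Suc numeral_2_eq_2 diff_zero A_pow_Suc A_assoc A_ring(5) pow_closed)
  qed
  show ?case
  proof (intro exI[of _ "P + pCons 0 Q"] conjI allI 1)
    show "coeff (P + pCons 0 Q) 0 = h (y \<otimes> m [^] Suc n)"
      by (simp only: coeff_add coeff_pCons_0 P(2) 2 add_0_right)
    show "coeff (P + pCons 0 Q) (Suc 0) = of_nat (Suc n) * h (y \<otimes> (m [^] (Suc n - 1) \<otimes> k))"
      using P(3) Q(2) 2 3 by (cases "n = 0") (simp_all add: algebra_simps del: nat_pow_Suc)
    show "coeff (P + pCons 0 Q) (Suc (Suc 0))
        = of_nat (Suc n * (Suc n - 1)) / 2 * h (y \<otimes> (m [^] (Suc n - 2) \<otimes> (k \<otimes> k)))"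
    proof (cases "n > 1")
      case True
      have "of_nat (n * (n - 1)) / 2 + of_nat n = (of_nat (Suc n * (Suc n - 1)) / 2 :: complex)"
        using True by (simp add: of_nat_diff field_simps)
      then show ?thesis
        using True 3(2) 4
        by (simp only: coeff_add coeff_pCons_Suc P(4) Q(3) diff_Suc_1 diff_Suc_Suc numeral_2_eq_2
          One_nat_def distrib_right[symmetric])
    next
      case False
      then have "n = 0 \<or> n = 1"
        by auto
      then show ?thesis
        using P(4) Q(3) 3(2) by auto
    qed
  qed
qed

text \<open>With \<open>x = tan \<theta>\<close> the hypothesis says that
  \<open>h ((m + x k) ^ (2 l + 2)) = (1 + x\<^sup>2) ^ (l + 1) E\<close>. Compare the coefficients
  of \<open>x\<^sup>2\<close>: on the left \<open>(l + 1) (2 l + 1)\<close> times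
  \<open>h (m ^ (2 l) k\<^sup>2)\<close> by \<open>power_expansion\<close>, on the right
  \<open>(l + 1) E\<close>.\<close>

lemma even_moment_recursion:
  assumes h: "positive_unital_form A h"
    and m: "m \<in> carrier A" and k: "k \<in> carrier A" and mk: "m \<otimes> k = k \<otimes> m"
    and rot: "\<And>\<theta>. h ((of_real (cos \<theta>) \<odot> m \<oplus> of_real (sin \<theta>) \<odot> k) [^] (2 * l + 2)) = E"
  shows "of_nat (2 * l + 1) * h (m [^] (2 * l) \<otimes> (k \<otimes> k)) = E"
proof -
  define n where "n = 2 * l + 2"
  have h_scale: "h (c \<odot> x) = c * h x" if "x \<in> carrier A" for x c
    using h that by (auto simp: positive_unital_form_def)
  obtain P where P: "\<And>x. h (\<one> \<otimes> (m \<oplus> x \<odot> k) [^] n) = poly P x"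
      "coeff P (Suc (Suc 0)) = of_nat (n * (n - 1)) / 2 * h (\<one> \<otimes> (m [^] (n - 2) \<otimes> (k \<otimes> k)))"
    using power_expansion[OF h m k mk, of \<one> n] by auto
  have eq: "poly P (of_real x) = poly (Polynomial.smult E ([:1, 0, 1:] ^ (l + 1))) (of_real x)" for x :: real
  proof -
    \<comment> \<open>The length of the vector \<open>(1, x)\<close>, whose angle is
      \<open>arctan x\<close>.\<close>
    define r where "r = sqrt (1 + x\<^sup>2)"
    have r: "r > 0" "r\<^sup>2 = 1 + x\<^sup>2"
      by (auto simp: r_def add_pos_nonneg)
    have "m \<oplus> of_real x \<odot> k = of_real r \<odot> (of_real (cos (arctan x)) \<odot> m \<oplus> of_real (sin (arctan x)) \<odot> k)"
      using m k r(1) by (simp add: scale_add_right scale_scale cos_arctan sin_arctan flip: r_def)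
    then have "h ((m \<oplus> of_real x \<odot> k) [^] n) = of_real r ^ n * E"
      using m k rot[of "arctan x"] by (simp only: scale_pow h_scale A_ring(1) scale_closed pow_closed n_def)
    moreover have "complex_of_real r ^ n = (1 + of_real x * of_real x) ^ (l + 1)"
    proof -
      have "r ^ n = (r\<^sup>2) ^ (l + 1)"
        unfolding n_def power_mult[symmetric] by simp
      then have "r ^ n = (1 + x * x) ^ (l + 1)"
        unfolding r(2) unfolding power2_eq_square .
      then have "complex_of_real (r ^ n) = complex_of_real ((1 + x * x) ^ (l + 1))"
        by (rule arg_cong)
      then show ?thesis
        by (simp only: of_real_power of_real_mult of_real_1 of_real_add)
    qed
    ultimately show ?thesis
      using P(1)[of "of_real x"] m k by (simp add: poly_power algebra_simps)
  qed
  \<comment> \<open>The two polynomials agree at all real points, of which there are infinitely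
    many.\<close>
  have "P = Polynomial.smult E ([:1, 0, 1:] ^ (l + 1))"
  proof (rule ccontr)
    assume "P \<noteq> Polynomial.smult E ([:1, 0, 1:] ^ (l + 1))"
    then have "finite {x. poly (P - Polynomial.smult E ([:1, 0, 1:] ^ (l + 1))) x = 0}"
      by (intro poly_roots_finite) simp
    moreover have "range complex_of_real \<subseteq> {x. poly (P - Polynomial.smult E ([:1, 0, 1:] ^ (l + 1))) x = 0}"
      using eq by auto
    ultimately have "finite (range complex_of_real)"
      using finite_subset by blast
    then show False
      using finite_imageD[of complex_of_real UNIV] infinite_UNIV_char_0[where 'a = real]
      by (simp add: inj_on_def)
  qed
  then have "coeff P (Suc (Suc 0)) = E * of_nat (l + 1)"
    by (simp only: coeff_smult coeff_one_plus_X2_power)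
  then have "of_nat (n * (n - 1)) / 2 * h (m [^] (2 * l) \<otimes> (k \<otimes> k)) = E * of_nat (l + 1)"
    using P(2) m k by (simp add: n_def)
  moreover have "(of_nat (n * (n - 1)) / 2 :: complex) = of_nat (l + 1) * of_nat (2 * l + 1)"
    by (simp add: n_def field_simps)
  ultimately have "of_nat (l + 1) * (of_nat (2 * l + 1) * h (m [^] (2 * l) \<otimes> (k \<otimes> k))) = of_nat (l + 1) * E"
    by (simp only: mult.assoc mult.commute[of E])
  then show ?thesis
    using of_nat_neq_0[of l, where 'a = complex] by (simp only: mult_cancel_left) simp
qed

text \<open>Take \<open>z = m ^ (2 l)\<close> in the sphere relation and multiply by
  \<open>2 l + 1\<close>; by \<open>even_moment_recursion\<close> both mixed terms become
  \<open>E (2 l + 2)\<close>.\<close>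

lemma moments_from_rotations:
  assumes h: "positive_unital_form A h"
    and closed: "m \<in> carrier A" "k \<in> carrier A" "k' \<in> carrier A"
    and comm: "m \<otimes> k = k \<otimes> m" "m \<otimes> k' = k' \<otimes> m"
    and rot: "\<And>\<theta> n. h ((of_real (cos \<theta>) \<odot> m \<oplus> of_real (sin \<theta>) \<odot> k) [^] n) = E n"
    and rot': "\<And>\<theta> n. h ((of_real (cos \<theta>) \<odot> m \<oplus> of_real (sin \<theta>) \<odot> k') [^] n) = E n"
    and sphere: "\<And>z. z \<in> carrier A \<Longrightarrow> h (z \<otimes> (m \<otimes> m)) + h (z \<otimes> (k \<otimes> k)) + h (z \<otimes> (k' \<otimes> k')) = h z"
  shows "E n = (1 + (- 1) ^ n) / (2 * (of_nat n + 1))"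
proof -
  have hm: "h (m [^] n) = E n" for n
    using rot[of 0 n] closed by (simp add: A_ring(15))
  have step: "of_nat (2 * l + 3) * E (2 * l + 2) = of_nat (2 * l + 1) * E (2 * l)" for l
  proof -
    have "m [^] (2 * l + 2) = m [^] (2 * l) \<otimes> (m \<otimes> m)"
      using closed by (simp add: A_assoc)
    then have "E (2 * l + 2) + h (m [^] (2 * l) \<otimes> (k \<otimes> k)) + h (m [^] (2 * l) \<otimes> (k' \<otimes> k')) = E (2 * l)"
      using sphere[of "m [^] (2 * l)"] closed by (simp only: hm[symmetric] pow_closed)
    then have "of_nat (2 * l + 1) * E (2 * l + 2) + of_nat (2 * l + 1) * h (m [^] (2 * l) \<otimes> (k \<otimes> k))
        + of_nat (2 * l + 1) * h (m [^] (2 * l) \<otimes> (k' \<otimes> k')) = of_nat (2 * l + 1) * E (2 * l)"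
      by (simp only: distrib_left[symmetric])
    then have "of_nat (2 * l + 1) * E (2 * l + 2) + E (2 * l + 2) + E (2 * l + 2) = of_nat (2 * l + 1) * E (2 * l)"
      by (simp only: even_moment_recursion[OF h closed(1,2) comm(1) rot] even_moment_recursion[OF h closed(1,3) comm(2) rot'])
    then show ?thesis
      by (simp add: algebra_simps)
  qed
  have even: "of_nat (2 * l + 1) * E (2 * l) = 1" for l
  proof (induction l)
    case 0
    have "h \<one> = 1"
      using h by (simp add: positive_unital_form_def)
    then show ?case
      using hm[of 0] by simp
  next
    case (Suc l)
    then show ?case
      using step[of l] by (simp add: add.commute)
  qed
  show ?thesis
  proof (cases "even n")
    case True
    then obtain l where l: "n = 2 * l"
      by blast
    have "(of_nat (2 * l + 1) :: complex) \<noteq> 0"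
      by (simp only: of_nat_eq_0_iff)
    moreover have "(1 + (- 1) ^ n) / (2 * (of_nat n + 1)) = (1 / of_nat (2 * l + 1) :: complex)"
      using mult_divide_mult_cancel_left[of "2 :: complex" 1 "of_nat (2 * l + 1)"] by (simp add: l add.commute)
    moreover have "E n = 1 / of_nat (2 * l + 1)"
      using even[of l] \<open>of_nat (2 * l + 1) \<noteq> 0\<close> by (simp only: l eq_divide_eq mult.commute) simp
    ultimately show ?thesis
      by simp
  next
    case False
    \<comment> \<open>At \<open>\<theta> = pi\<close> the rotated element is \<open>- m\<close>, so
      each odd moment is its own negative.\<close>
    have "h ((of_real (cos pi) \<odot> m \<oplus> of_real (sin pi) \<odot> k) [^] n) = h (((- 1) \<odot> m) [^] n)"
      using closed by (simp add: A_ring(15))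
    also have "\<dots> = (- 1) ^ n * E n"
      using closed h by (simp add: scale_pow positive_unital_form_def hm)
    finally have "E n = - E n"
      using False rot[of pi n] by simp
    then show ?thesis
      using False by simp
  qed
qed

text \<open>As \<open>r\<^sup>2 + s\<^sup>2 = 1\<close> commutes with \<open>r\<close> and
  \<open>s\<close>, so do \<open>r\<^sup>2\<close> with \<open>s\<close> and
  \<open>s\<^sup>2\<close> with \<open>r\<close>; hence \<open>m\<close> commutes with both.
  Moreover \<open>(r s)(s r)\<close> and \<open>(s r)(r s)\<close> both equal
  \<open>r\<^sup>2 s\<^sup>2\<close>, which turns the sphere relation into
  \<open>(r\<^sup>2 + s\<^sup>2)\<^sup>2 = 1\<close>.\<close>

lemma column_relations:
  assumes r: "r \<in> carrier A" and s: "s \<in> carrier A" and sum: "r \<otimes> r \<oplus> s \<otimes> s = \<one>"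
  defines "m \<equiv> r \<otimes> r \<oplus> (- 1) \<odot> (s \<otimes> s)"
  shows column_commute: "m \<otimes> (c \<odot> (r \<otimes> s) \<oplus> d \<odot> (s \<otimes> r)) = (c \<odot> (r \<otimes> s) \<oplus> d \<odot> (s \<otimes> r)) \<otimes> m"
    and column_sphere: "\<lbrakk>positive_unital_form A h; z \<in> carrier A\<rbrakk> \<Longrightarrow>
      h (z \<otimes> (m \<otimes> m)) + h (z \<otimes> ((1 \<odot> (r \<otimes> s) \<oplus> 1 \<odot> (s \<otimes> r)) \<otimes> (1 \<odot> (r \<otimes> s) \<oplus> 1 \<odot> (s \<otimes> r))))
      + h (z \<otimes> ((\<i> \<odot> (r \<otimes> s) \<oplus> (- \<i>) \<odot> (s \<otimes> r)) \<otimes> (\<i> \<odot> (r \<otimes> s) \<oplus> (- \<i>) \<odot> (s \<otimes> r)))) = h z"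
proof -
  have add_cancel: "x = y" if "x \<oplus> z = y \<oplus> z" "x \<in> carrier A" "y \<in> carrier A" "z \<in> carrier A" for x y z
    using that by (metis A_comm A_neg(4) A_ring(3))
  have "r \<otimes> (r \<otimes> s) \<oplus> s \<otimes> (s \<otimes> s) = s \<otimes> (r \<otimes> r) \<oplus> s \<otimes> (s \<otimes> s)"
  proof -
    have "(r \<otimes> r \<oplus> s \<otimes> s) \<otimes> s = s \<otimes> (r \<otimes> r \<oplus> s \<otimes> s)"
      using s by (simp add: sum)
    then show ?thesis
      using r s by (simp add: A_distrib A_assoc)
  qed
  then have rrs: "r \<otimes> (r \<otimes> s) = s \<otimes> (r \<otimes> r)"
    by (rule add_cancel) (use r s in simp_all)
  have "s \<otimes> (s \<otimes> r) \<oplus> r \<otimes> (r \<otimes> r) = r \<otimes> (s \<otimes> s) \<oplus> r \<otimes> (r \<otimes> r)"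
  proof -
    have "(r \<otimes> r \<oplus> s \<otimes> s) \<otimes> r = r \<otimes> (r \<otimes> r \<oplus> s \<otimes> s)"
      using r by (simp add: sum)
    then show ?thesis
      using r s by (simp add: A_distrib A_assoc A_comm)
  qed
  then have ssr: "s \<otimes> (s \<otimes> r) = r \<otimes> (s \<otimes> s)"
    by (rule add_cancel) (use r s in simp_all)
  have m: "m \<in> carrier A"
    using r s by (simp add: m_def)
  have mr: "m \<otimes> r = r \<otimes> m"
    using r s by (simp add: m_def A_distrib A_assoc smult_mult_left smult_mult_right ssr)
  have ms: "m \<otimes> s = s \<otimes> m"
    using r s by (simp add: m_def A_distrib A_assoc smult_mult_left smult_mult_right rrs)
  have comm: "m \<otimes> (x \<otimes> y) = (x \<otimes> y) \<otimes> m"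
    if "x \<in> carrier A" "y \<in> carrier A" "m \<otimes> x = x \<otimes> m" "m \<otimes> y = y \<otimes> m" for x y
    using that m by (metis A_assoc)
  have "m \<otimes> (r \<otimes> s) = (r \<otimes> s) \<otimes> m" "m \<otimes> (s \<otimes> r) = (s \<otimes> r) \<otimes> m"
    using r s mr ms comm by auto
  then show "m \<otimes> (c \<odot> (r \<otimes> s) \<oplus> d \<odot> (s \<otimes> r)) = (c \<odot> (r \<otimes> s) \<oplus> d \<odot> (s \<otimes> r)) \<otimes> m"
    using r s m by (simp add: A_distrib smult_mult_left smult_mult_right)
  assume h: "positive_unital_form A h" and z: "z \<in> carrier A"
  have h_simps: "h (x \<oplus> y) = h x + h y" "h (c \<odot> x) = c * h x" if "x \<in> carrier A" "y \<in> carrier A" for x y c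
    using h that by (auto simp: positive_unital_form_def)
  define e f g g' where "e = r \<otimes> r" and "f = s \<otimes> s" and "g = r \<otimes> s" and "g' = s \<otimes> r"
  have c: "e \<in> carrier A" "f \<in> carrier A" "g \<in> carrier A" "g' \<in> carrier A"
    using r s by (simp_all add: e_def f_def g_def g'_def)
  have "r \<otimes> (s \<otimes> (s \<otimes> r)) = (r \<otimes> r) \<otimes> (s \<otimes> s)"
    using r s by (simp add: ssr A_assoc)
  then have gg': "g \<otimes> g' = e \<otimes> f"
    using r s by (simp add: e_def f_def g_def g'_def A_assoc)
  have "s \<otimes> (r \<otimes> (r \<otimes> s)) = (r \<otimes> (r \<otimes> s)) \<otimes> s"
    using r s by (simp add: rrs A_assoc)
  then have g'g: "g' \<otimes> g = e \<otimes> f"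
    using r s by (simp add: e_def f_def g_def g'_def A_assoc)
  have "s \<otimes> (s \<otimes> (r \<otimes> r)) = (r \<otimes> (r \<otimes> s)) \<otimes> s"
    using r s by (metis rrs A_assoc A_ring(5))
  then have fe: "f \<otimes> e = e \<otimes> f"
    using r s by (simp add: e_def f_def A_assoc)
  have "z = z \<otimes> ((e \<oplus> f) \<otimes> (e \<oplus> f))"
    using z sum by (simp add: e_def f_def monoid.r_one[OF ring.is_monoid[OF ring_A]])
  then have "h z = h (z \<otimes> ((e \<oplus> f) \<otimes> (e \<oplus> f)))"
    by (rule arg_cong)
  also have "\<dots> = h (z \<otimes> (e \<otimes> e)) + 2 * h (z \<otimes> (e \<otimes> f)) + h (z \<otimes> (f \<otimes> f))"
    using z c by (simp add: A_distrib fe h_simps)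
  finally have "h z = h (z \<otimes> (e \<otimes> e)) + 2 * h (z \<otimes> (e \<otimes> f)) + h (z \<otimes> (f \<otimes> f))" .
  moreover have "h (z \<otimes> (m \<otimes> m)) = h (z \<otimes> (e \<otimes> e)) - 2 * h (z \<otimes> (e \<otimes> f)) + h (z \<otimes> (f \<otimes> f))"
    unfolding m_def e_def[symmetric] f_def[symmetric]
    using z c by (simp add: A_distrib fe smult_mult_left smult_mult_right scale_scale h_simps)
  \<comment> \<open>Between \<open>(c, d) = (1, 1)\<close> and
    \<open>(c, d) = (\<i>, - \<i>)\<close> the terms with \<open>g \<otimes> g\<close> and
    \<open>g' \<otimes> g'\<close> cancel, while the mixed terms add up to four times
    \<open>h (z \<otimes> (e \<otimes> f))\<close>.\<close>
  moreover have "h (z \<otimes> ((c \<odot> g \<oplus> d \<odot> g') \<otimes> (c \<odot> g \<oplus> d \<odot> g')))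
      = c * c * h (z \<otimes> (g \<otimes> g)) + 2 * c * d * h (z \<otimes> (e \<otimes> f)) + d * d * h (z \<otimes> (g' \<otimes> g'))" for c d
    using z c by (simp add: A_distrib gg' g'g smult_mult_left smult_mult_right scale_scale scale_add_right h_simps algebra_simps)
  ultimately show "h (z \<otimes> (m \<otimes> m)) + h (z \<otimes> ((1 \<odot> (r \<otimes> s) \<oplus> 1 \<odot> (s \<otimes> r)) \<otimes> (1 \<odot> (r \<otimes> s) \<oplus> 1 \<odot> (s \<otimes> r))))
      + h (z \<otimes> ((\<i> \<odot> (r \<otimes> s) \<oplus> (- \<i>) \<odot> (s \<otimes> r)) \<otimes> (\<i> \<odot> (r \<otimes> s) \<oplus> (- \<i>) \<odot> (s \<otimes> r)))) = h z"
    unfolding g_def[symmetric] g'_def[symmetric] by simp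
qed

end

text \<open>Square \<open>\<Delta> (u i j) = t p r \<oplus> t q s\<close> and slice with the
  functional of \<open>is_Ao_partial_character\<close>: twice the result minus the unit is the
  rotated element on the left. Then \<open>haar_power_eq\<close> compares the moments.\<close>

lemma haar_rotation:
  fixes A :: "'a cstar" and T :: "'t cstar"
  assumes Ao: "is_Ao 2 A u" and tens: "cstar_tensor A A T t" and \<Delta>: "is_comult 2 A u T t \<Delta>"
    and haar: "is_haar A T t \<Delta> h" and nz: "\<one>\<^bsub>A\<^esub> \<noteq> \<zero>\<^bsub>A\<^esub>"
    and i: "i \<in> {1, 2}" and j: "j \<in> {1, 2}" and \<kappa>: "\<kappa> \<in> {1, \<i>}"
  defines "r \<equiv> u 1 j" and "s \<equiv> u 2 j"
  shows "h ((of_real (cos \<theta>) \<odot>\<^bsub>A\<^esub> (r \<otimes>\<^bsub>A\<^esub> r \<oplus>\<^bsub>A\<^esub> (- 1) \<odot>\<^bsub>A\<^esub> (s \<otimes>\<^bsub>A\<^esub> s))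
       \<oplus>\<^bsub>A\<^esub> of_real (sin \<theta>) \<odot>\<^bsub>A\<^esub> (\<kappa> \<odot>\<^bsub>A\<^esub> (r \<otimes>\<^bsub>A\<^esub> s) \<oplus>\<^bsub>A\<^esub> cnj \<kappa> \<odot>\<^bsub>A\<^esub> (s \<otimes>\<^bsub>A\<^esub> r))) [^]\<^bsub>A\<^esub> (n::nat))
    = h ((2 \<odot>\<^bsub>A\<^esub> (u i j \<otimes>\<^bsub>A\<^esub> u i j) \<oplus>\<^bsub>A\<^esub> (- 1) \<odot>\<^bsub>A\<^esub> \<one>\<^bsub>A\<^esub>) [^]\<^bsub>A\<^esub> n)"
proof -
  \<comment> \<open>The half angle makes the quadratic expressions in \<open>c\<close> and
    \<open>s'\<close> the cosine and sine of \<open>\<theta>\<close>.\<close>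
  define c s' where "c = cos (\<theta> / 2)" and "s' = sin (\<theta> / 2)"
  define p q where "p = u i 1" and "q = u i 2"
  have cs: "c\<^sup>2 + s'\<^sup>2 = 1" and cos: "cos \<theta> = c\<^sup>2 - s'\<^sup>2" and sin: "sin \<theta> = 2 * c * s'"
    using cos_double[of "\<theta> / 2"] sin_double[of "\<theta> / 2"] by (simp_all add: c_def s'_def)
  obtain D \<psi> where \<psi>: "partial_character A D \<psi>"
      "p \<otimes>\<^bsub>A\<^esub> p \<in> D" "q \<otimes>\<^bsub>A\<^esub> q \<in> D" "p \<otimes>\<^bsub>A\<^esub> q \<in> D" "q \<otimes>\<^bsub>A\<^esub> p \<in> D"
      "\<psi> (p \<otimes>\<^bsub>A\<^esub> p) = of_real (c\<^sup>2)" "\<psi> (q \<otimes>\<^bsub>A\<^esub> q) = of_real (s'\<^sup>2)"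
      "\<psi> (p \<otimes>\<^bsub>A\<^esub> q) = of_real (c * s') * \<kappa>" "\<psi> (q \<otimes>\<^bsub>A\<^esub> p) = of_real (c * s') * cnj \<kappa>"
    using is_Ao_partial_character[OF Ao nz i cs \<kappa>] unfolding p_def q_def by blast
  interpret tensor_character A T t D \<psi>
    using tens \<psi>(1) by unfold_locales
  have orth: "orthogonal_matrix_in A 2 u"
    using Ao by (simp add: is_Ao_def)
  have u: "u i j \<in> carrier A" if "i \<in> {1, 2}" "j \<in> {1, 2}" for i j
    using orth that by (auto simp: orthogonal_matrix_in_def)
  have c: "p \<in> carrier A" "q \<in> carrier A" "r \<in> carrier A" "s \<in> carrier A" "u i j \<in> carrier A"
    using u i j by (auto simp: p_def q_def r_def s_def)
  have sum: "r \<otimes>\<^bsub>A\<^esub> r \<oplus>\<^bsub>A\<^esub> s \<otimes>\<^bsub>A\<^esub> s = \<one>\<^bsub>A\<^esub>"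
  proof -
    have "(\<Oplus>\<^bsub>A\<^esub>k\<in>{1..2}. u k j \<otimes>\<^bsub>A\<^esub> u k j) = \<one>\<^bsub>A\<^esub>"
      using orth j by (auto simp: orthogonal_matrix_in_def)
    then show ?thesis
      using c by (subst (asm) finsum_Icc_1_2)
        (auto simp: r_def s_def intro: abelian_group.axioms(1)[OF ring.is_abelian_group[OF A.ring_A]])
  qed
  have hom: "star_hom A T \<Delta>"
    using \<Delta> by (simp add: is_comult_def)
  have "\<Delta> (u i j) = (\<Oplus>\<^bsub>T\<^esub>k\<in>{1..2}. t (u i k) (u k j))"
    using \<Delta> i j by (auto simp: is_comult_def)
  also have "\<dots> = t p r \<oplus>\<^bsub>T\<^esub> t q s"
    using c by (subst finsum_Icc_1_2)
      (auto simp: p_def q_def r_def s_def t_closed intro: abelian_group.axioms(1)[OF ring.is_abelian_group[OF T.ring_A]])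
  finally have "\<Delta> (u i j \<otimes>\<^bsub>A\<^esub> u i j) = (t p r \<oplus>\<^bsub>T\<^esub> t q s) \<otimes>\<^bsub>T\<^esub> (t p r \<oplus>\<^bsub>T\<^esub> t q s)"
    using hom c by (simp add: star_hom_def ring_hom_def)
  also have "\<dots> = (t (p \<otimes>\<^bsub>A\<^esub> p) (r \<otimes>\<^bsub>A\<^esub> r) \<oplus>\<^bsub>T\<^esub> t (q \<otimes>\<^bsub>A\<^esub> p) (s \<otimes>\<^bsub>A\<^esub> r)) \<oplus>\<^bsub>T\<^esub>
      (t (p \<otimes>\<^bsub>A\<^esub> q) (r \<otimes>\<^bsub>A\<^esub> s) \<oplus>\<^bsub>T\<^esub> t (q \<otimes>\<^bsub>A\<^esub> q) (s \<otimes>\<^bsub>A\<^esub> s))"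
    using c by (simp add: T.A_distrib t_closed t_mult)
  finally have "\<Delta> (2 \<odot>\<^bsub>A\<^esub> (u i j \<otimes>\<^bsub>A\<^esub> u i j) \<oplus>\<^bsub>A\<^esub> (- 1) \<odot>\<^bsub>A\<^esub> \<one>\<^bsub>A\<^esub>)
      = 2 \<odot>\<^bsub>T\<^esub> ((t (p \<otimes>\<^bsub>A\<^esub> p) (r \<otimes>\<^bsub>A\<^esub> r) \<oplus>\<^bsub>T\<^esub> t (q \<otimes>\<^bsub>A\<^esub> p) (s \<otimes>\<^bsub>A\<^esub> r)) \<oplus>\<^bsub>T\<^esub>
      (t (p \<otimes>\<^bsub>A\<^esub> q) (r \<otimes>\<^bsub>A\<^esub> s) \<oplus>\<^bsub>T\<^esub> t (q \<otimes>\<^bsub>A\<^esub> q) (s \<otimes>\<^bsub>A\<^esub> s))) \<oplus>\<^bsub>T\<^esub> (- 1) \<odot>\<^bsub>T\<^esub> \<one>\<^bsub>T\<^esub>"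
    using hom c by (simp add: star_hom_def ring_hom_def)
  moreover have "rel \<dots> (2 \<odot>\<^bsub>A\<^esub> ((of_real (c\<^sup>2) \<odot>\<^bsub>A\<^esub> (r \<otimes>\<^bsub>A\<^esub> r) \<oplus>\<^bsub>A\<^esub> (of_real (c * s') * cnj \<kappa>) \<odot>\<^bsub>A\<^esub> (s \<otimes>\<^bsub>A\<^esub> r)) \<oplus>\<^bsub>A\<^esub>
      ((of_real (c * s') * \<kappa>) \<odot>\<^bsub>A\<^esub> (r \<otimes>\<^bsub>A\<^esub> s) \<oplus>\<^bsub>A\<^esub> of_real (s'\<^sup>2) \<odot>\<^bsub>A\<^esub> (s \<otimes>\<^bsub>A\<^esub> s))) \<oplus>\<^bsub>A\<^esub> (- 1) \<odot>\<^bsub>A\<^esub> \<one>\<^bsub>A\<^esub>)"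
    unfolding \<psi>(6-9)[symmetric]
    by (intro slice_rel.add rel_scale rel_one slice_rel.tensor \<psi>) (use c in auto)
  moreover have "2 \<odot>\<^bsub>A\<^esub> ((of_real (c\<^sup>2) \<odot>\<^bsub>A\<^esub> (r \<otimes>\<^bsub>A\<^esub> r) \<oplus>\<^bsub>A\<^esub> (of_real (c * s') * cnj \<kappa>) \<odot>\<^bsub>A\<^esub> (s \<otimes>\<^bsub>A\<^esub> r)) \<oplus>\<^bsub>A\<^esub>
      ((of_real (c * s') * \<kappa>) \<odot>\<^bsub>A\<^esub> (r \<otimes>\<^bsub>A\<^esub> s) \<oplus>\<^bsub>A\<^esub> of_real (s'\<^sup>2) \<odot>\<^bsub>A\<^esub> (s \<otimes>\<^bsub>A\<^esub> s))) \<oplus>\<^bsub>A\<^esub> (- 1) \<odot>\<^bsub>A\<^esub> \<one>\<^bsub>A\<^esub>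
    = of_real (cos \<theta>) \<odot>\<^bsub>A\<^esub> (r \<otimes>\<^bsub>A\<^esub> r \<oplus>\<^bsub>A\<^esub> (- 1) \<odot>\<^bsub>A\<^esub> (s \<otimes>\<^bsub>A\<^esub> s))
       \<oplus>\<^bsub>A\<^esub> of_real (sin \<theta>) \<odot>\<^bsub>A\<^esub> (\<kappa> \<odot>\<^bsub>A\<^esub> (r \<otimes>\<^bsub>A\<^esub> s) \<oplus>\<^bsub>A\<^esub> cnj \<kappa> \<odot>\<^bsub>A\<^esub> (s \<otimes>\<^bsub>A\<^esub> r))"
  proof -
    define e f g g' where "e = r \<otimes>\<^bsub>A\<^esub> r" and "f = s \<otimes>\<^bsub>A\<^esub> s" and "g = r \<otimes>\<^bsub>A\<^esub> s" and "g' = s \<otimes>\<^bsub>A\<^esub> r"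
    have efg: "e \<in> carrier A" "f \<in> carrier A" "g \<in> carrier A" "g' \<in> carrier A"
      using c by (simp_all add: e_def f_def g_def g'_def)
    \<comment> \<open>Writing the unit as the column sum gives \<open>e\<close> the coefficient
      \<open>2 c\<^sup>2 - 1 = cos \<theta>\<close> and \<open>f\<close> the coefficient
      \<open>2 s'\<^sup>2 - 1 = - cos \<theta>\<close>.\<close>
    have one: "\<one>\<^bsub>A\<^esub> = e \<oplus>\<^bsub>A\<^esub> f"
      using sum by (simp add: e_def f_def)
    have e: "complex_of_real (cos \<theta>) \<odot>\<^bsub>A\<^esub> e = (2 * complex_of_real (c\<^sup>2)) \<odot>\<^bsub>A\<^esub> e \<oplus>\<^bsub>A\<^esub> (- 1) \<odot>\<^bsub>A\<^esub> e"
    proof -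
      have "cos \<theta> = 2 * c\<^sup>2 + - 1"
        using cs cos by linarith
      then show ?thesis
        using A.scale_add_left[OF efg(1), of "2 * complex_of_real (c\<^sup>2)" "- 1"] by simp
    qed
    have f: "complex_of_real (- cos \<theta>) \<odot>\<^bsub>A\<^esub> f = (2 * complex_of_real (s'\<^sup>2)) \<odot>\<^bsub>A\<^esub> f \<oplus>\<^bsub>A\<^esub> (- 1) \<odot>\<^bsub>A\<^esub> f"
    proof -
      have "- cos \<theta> = 2 * s'\<^sup>2 + - 1"
        using cs cos by linarith
      then show ?thesis
        using A.scale_add_left[OF efg(2), of "2 * complex_of_real (s'\<^sup>2)" "- 1"] by simp
    qed
    show ?thesis
      unfolding e_def[symmetric] f_def[symmetric] g_def[symmetric] g'_def[symmetric] one
      using efg e f by (simp add: A.scale_add_right A.scale_scale sin A.A_ac mult.assoc)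
  qed
  ultimately show ?thesis
    using haar_power_eq[OF hom haar, of "2 \<odot>\<^bsub>A\<^esub> (u i j \<otimes>\<^bsub>A\<^esub> u i j) \<oplus>\<^bsub>A\<^esub> (- 1) \<odot>\<^bsub>A\<^esub> \<one>\<^bsub>A\<^esub>"] c by simp
qed

section \<open>The law of a squared generator\<close>

theorem theorem8p1:
  fixes A :: "'a cstar" and u :: "nat \<Rightarrow> nat \<Rightarrow> 'a"
    and T :: "'t cstar" and t :: "'a \<Rightarrow> 'a \<Rightarrow> 't"
    and \<Delta> :: "'a \<Rightarrow> 't" and h :: "'a \<Rightarrow> complex" and i j :: nat
  assumes "is_Ao 2 A u"
    and "cstar_tensor A A T t"
    and "is_comult 2 A u T t \<Delta>"
    and "is_haar A T t \<Delta> h"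
    and "i \<in> {1, 2}" and "j \<in> {1, 2}"
  shows "has_law A h (u i j [^]\<^bsub>A\<^esub> (2::nat)) (uniform_measure lborel {0..1})"
proof -
  interpret cstar_algebra A
    using assms(1) by (simp add: is_Ao_def)
  have orth: "orthogonal_matrix_in A 2 u"
    using assms(1) by (simp add: is_Ao_def)
  have am: "abelian_monoid A"
    using ring_A by (simp add: ring_def abelian_group_def)
  have u: "u k l \<in> carrier A" "star A (u k l) = u k l" if "k \<in> {1, 2}" "l \<in> {1, 2}" for k l
    using orth that by (auto simp: orthogonal_matrix_in_def)
  note ij = assms(5,6)
  have h: "positive_unital_form A h"
    using assms(4) by (simp add: is_haar_def)
  \<comment> \<open>The zero algebra carries no unital form, as linearity would give its unit the
    value 0.\<close>
  have nz: "\<one>\<^bsub>A\<^esub> \<noteq> \<zero>\<^bsub>A\<^esub>"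
  proof
    assume "\<one>\<^bsub>A\<^esub> = \<zero>\<^bsub>A\<^esub>"
    moreover have "h (0 \<odot>\<^bsub>A\<^esub> \<one>\<^bsub>A\<^esub>) = 0 * h \<one>\<^bsub>A\<^esub>"
      using h by (simp only: positive_unital_form_def A_ring(6))
    ultimately show False
      using h by (simp add: positive_unital_form_def)
  qed
  define a where "a = u i j \<otimes>\<^bsub>A\<^esub> u i j"
  define w where "w = 2 \<odot>\<^bsub>A\<^esub> a \<oplus>\<^bsub>A\<^esub> (- 1) \<odot>\<^bsub>A\<^esub> \<one>\<^bsub>A\<^esub>"
  have a: "a \<in> carrier A" "star A a = a"
    using u ij by (simp_all add: a_def star_mult)
  have row: "u i 1 \<otimes>\<^bsub>A\<^esub> u i 1 \<oplus>\<^bsub>A\<^esub> u i 2 \<otimes>\<^bsub>A\<^esub> u i 2 = \<one>\<^bsub>A\<^esub>"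
  proof -
    have "(\<Oplus>\<^bsub>A\<^esub>k\<in>{1..2}. u i k \<otimes>\<^bsub>A\<^esub> u i k) = \<one>\<^bsub>A\<^esub>"
      using orth ij by (auto simp: orthogonal_matrix_in_def)
    then show ?thesis
      using u ij by (subst (asm) finsum_Icc_1_2[OF am]) auto
  qed
  have col: "u 1 j \<otimes>\<^bsub>A\<^esub> u 1 j \<oplus>\<^bsub>A\<^esub> u 2 j \<otimes>\<^bsub>A\<^esub> u 2 j = \<one>\<^bsub>A\<^esub>"
  proof -
    have "(\<Oplus>\<^bsub>A\<^esub>k\<in>{1..2}. u k j \<otimes>\<^bsub>A\<^esub> u k j) = \<one>\<^bsub>A\<^esub>"
      using orth ij by (auto simp: orthogonal_matrix_in_def)
    then show ?thesis
      using u ij by (subst (asm) finsum_Icc_1_2[OF am]) auto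
  qed
  interpret unit_interval_element A a
  proof
    fix p B
    assume B: "\<And>t::real. 0 \<le> t \<Longrightarrow> t \<le> 1 \<Longrightarrow> cmod (poly p (of_real t)) \<le> B"
    \<comment> \<open>The other column index; the row relation then supplies the partner of
      \<open>u i j\<close> in a sum of two squares equal to the unit.\<close>
    define j' where "j' = 3 - j"
    have "j' \<in> {1, 2}" "u i j \<otimes>\<^bsub>A\<^esub> u i j \<oplus>\<^bsub>A\<^esub> u i j' \<otimes>\<^bsub>A\<^esub> u i j' = \<one>\<^bsub>A\<^esub>"
      using ij row u[of i] by (auto simp: j'_def A_comm)
    then show "cnorm A (peval a p) \<le> B"
      unfolding a_def using u ij B by (intro cnorm_peval_square_le[of "u i j" "u i j'"]) auto
  qed (use a in auto)
  have rs: "u 1 j \<in> carrier A" "u 2 j \<in> carrier A"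
    using u ij by auto
  have moments: "h (w [^]\<^bsub>A\<^esub> n) = (1 + (- 1) ^ n) / (2 * (of_nat n + 1))" for n
  proof (rule moments_from_rotations[OF h])
    let ?r = "u 1 j" and ?s = "u 2 j"
    show "h ((of_real (cos \<theta>) \<odot>\<^bsub>A\<^esub> (?r \<otimes>\<^bsub>A\<^esub> ?r \<oplus>\<^bsub>A\<^esub> (- 1) \<odot>\<^bsub>A\<^esub> (?s \<otimes>\<^bsub>A\<^esub> ?s))
       \<oplus>\<^bsub>A\<^esub> of_real (sin \<theta>) \<odot>\<^bsub>A\<^esub> (1 \<odot>\<^bsub>A\<^esub> (?r \<otimes>\<^bsub>A\<^esub> ?s) \<oplus>\<^bsub>A\<^esub> 1 \<odot>\<^bsub>A\<^esub> (?s \<otimes>\<^bsub>A\<^esub> ?r))) [^]\<^bsub>A\<^esub> n)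
      = h (w [^]\<^bsub>A\<^esub> n)" for \<theta> and n :: nat
      unfolding w_def a_def
      by (rule haar_rotation[where \<kappa> = 1, unfolded complex_cnj_one, OF assms(1-4) nz ij insertI1])
    show "h ((of_real (cos \<theta>) \<odot>\<^bsub>A\<^esub> (?r \<otimes>\<^bsub>A\<^esub> ?r \<oplus>\<^bsub>A\<^esub> (- 1) \<odot>\<^bsub>A\<^esub> (?s \<otimes>\<^bsub>A\<^esub> ?s))
       \<oplus>\<^bsub>A\<^esub> of_real (sin \<theta>) \<odot>\<^bsub>A\<^esub> (\<i> \<odot>\<^bsub>A\<^esub> (?r \<otimes>\<^bsub>A\<^esub> ?s) \<oplus>\<^bsub>A\<^esub> (- \<i>) \<odot>\<^bsub>A\<^esub> (?s \<otimes>\<^bsub>A\<^esub> ?r))) [^]\<^bsub>A\<^esub> n)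
      = h (w [^]\<^bsub>A\<^esub> n)" for \<theta> and n :: nat
      unfolding w_def a_def
      by (rule haar_rotation[where \<kappa> = \<i>, unfolded complex_cnj_i, OF assms(1-4) nz ij insertI2[OF singletonI]])
  qed ((rule column_commute[OF rs col] column_sphere[OF rs col h], assumption?) | simp add: rs del: One_nat_def)+
  \<comment> \<open>Both sides are linear in \<open>p\<close> and agree on the powers of
    \<open>2 X - 1\<close>, where the left side is a moment of \<open>w = 2 a - 1\<close>.\<close>
  have "h (peval a p) = integral {0..1} (\<lambda>t. poly p (of_real t))" for p
  proof (rule poly_linear_eqI[of "\<lambda>p. h (peval a p)"])
    fix p q :: "complex poly" and c n
    show "h (peval a (p + q)) = h (peval a p) + h (peval a q)"
      "h (peval a (Polynomial.smult c p)) = c * h (peval a p)"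
      using h a by (simp_all add: peval_add peval_smult positive_unital_form_def)
    show "integral {0..1} (\<lambda>t. poly (p + q) (complex_of_real t))
      = integral {0..1} (\<lambda>t. poly p (of_real t)) + integral {0..1} (\<lambda>t. poly q (of_real t))"
      by (simp add: integral_add integrable_continuous_interval continuous_intros)
    show "integral {0..1} (\<lambda>t. poly (Polynomial.smult c p) (complex_of_real t))
      = c * integral {0..1} (\<lambda>t. poly p (of_real t))"
      by simp
    have "peval a [:-1, 2:] = w"
      using a by (simp add: w_def smult_mult_right A_comm)
    then show "h (peval a ([:-1, 2:] ^ n)) = integral {0..1} (\<lambda>t. poly ([:-1, 2:] ^ n) (complex_of_real t))"
      using a by (simp only: peval_power moments integral_shifted_power)
  qed
  moreover have "u i j [^]\<^bsub>A\<^esub> (2::nat) = a"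
    using u ij by (simp add: a_def numeral_2_eq_2)
  ultimately show ?thesis
    using has_law_uniform[OF h] is_Ao_spectrum[OF assms(1) nz ij] by (simp add: a_def)
qed

end
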